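(* Let $\mathbb{D}$ be a division ring with finite dimension $d$ over a central subfield $\mathbb{F}$, and assume that $\mathbb{D}$ is of quadratic type over $\mathbb{F}$, with associated pair $(\sigma,e)$. Let $n\geq 1$ be an integer with $|\mathbb{F}|\geq nd$. Then: (a) The irreducible optimal trivial spectrum subspaces of $\mathrm{M}_n(\mathbb{D})$ are exactly the spaces of the form $P^{-1}\mathcal{SH}_n(\mathbb{D})$ where $P\in\mathrm{GL}_n(\mathbb{D})$ is $e$-nonisotropic. (b) Given $e$-nonisotropic matrices $P_1$ and $P_2$ in $\mathrm{GL}_n(\mathbb{D})$, the spaces $P_1^{-1}\mathcal{SH}_n(\mathbb{D})$ and $P_2^{-1}\mathcal{SH}_n(\mathbb{D})$ are similar if and only if $P_2$ is homo-star-congruent to $P_1$.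
   Context: A central subfield of $\mathbb{D}$ is a subfield contained in the center of $\mathbb{D}$. An $\mathbb{F}$-linear subspace $S$ of $\mathrm{M}_n(\mathbb{D})$ has trivial spectrum if $I_n-M$ is invertible for all $M\in S$; it is optimal if it has the greatest possible dimension over $\mathbb{F}$ among all trivial spectrum $\mathbb{F}$-linear subspaces of $\mathrm{M}_n(\mathbb{D})$. Matrices act on the right $\mathbb{D}$-vector space $\mathbb{D}^n$ of columns by left multiplication; a subset of $\mathrm{M}_n(\mathbb{D})$ is irreducible if the only $\mathbb{D}$-linear subspaces of $\mathbb{D}^n$ invariant under all its elements are $\{0\}$ and $\mathbb{D}^n$. Two subsets $\mathcal{S},\mathcal{T}$ of $\mathrm{M}_n(\mathbb{D})$ are similar if $\mathcal{T}=Q\mathcal{S}Q^{-1}$ for some $Q\in\mathrm{GL}_n(\mathbb{D})$. $\mathbb{D}$ is of quadratic type over $\mathbb{F}$ if one of the following holds: (i) $d=1$; (ii) $d=2$ and $\mathbb{D}$ is a separable field extension of $\mathbb{F}$; (iii) $d=4$ and $\mathbb{D}$ is a quaternion algebra over $\mathbb{F}$; (iv) $d=2^m$ for some $m\geq 1$, $\operatorname{char}(\mathbb{F})=2$, $\mathbb{D}$ is a field and $x^2\in\mathbb{F}$ for all $x\in\mathbb{D}$. The standard involution $\sigma$ of $\mathbb{D}$ is the identity of $\mathbb{D}$ in cases (i) and (iv), the non-identity $\mathbb{F}$-automorphism in case (ii), and the quaternionic conjugation in case (iii). An associated pair $(\sigma,e)$ for $\mathbb{D}$ over $\mathbb{F}$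 consists of the standard involution $\sigma$ and of an $\mathbb{F}$-linear form $e:\mathbb{D}\to\mathbb{F}$ which is the Galois trace of $\mathbb{D}$ over $\mathbb{F}$ in cases (i) and (ii) (so $e=\operatorname{id}$ if $d=1$), the reduced trace $x\mapsto x+\sigma(x)$ in case (iii), and an arbitrary nonzero $\mathbb{F}$-linear form on $\mathbb{D}$ in case (iv). For a matrix $A$ over $\mathbb{D}$, $A^\star$ is the transpose of the matrix obtained by applying $\sigma$ to all entries of $A$. $\mathcal{SH}_n(\mathbb{D})$ is the set of all $M=(m_{i,j})\in\mathrm{M}_n(\mathbb{D})$ such that $M^\star=-M$ and $e(m_{i,i})=0$ for all $i$. A matrix $P\in\mathrm{M}_n(\mathbb{D})$ is $e$-nonisotropic if $e(X^\star PX)\neq 0$ for all $X\in\mathbb{D}^n\setminus\{0\}$. Matrices $A,B\in\mathrm{M}_n(\mathbb{D})$ are homo-star-congruent if $B=\alpha\,PAP^\star$ for some $\alpha\in\mathbb{F}^\times$ and some $P\in\mathrm{GL}_n(\mathbb{D})$. *)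

theory Defs
  imports "HOL-Analysis.Analysis" "HOL-Computational_Algebra.Polynomial"
begin

text \<open>
  The division ring is the type \<open>'a\<close>.  A central subfield of \<open>'a\<close> is given as a field \<open>'f\<close>
  together with a (necessarily injective) unital ring homomorphism \<open>\<iota> :: 'f \<Rightarrow> 'a\<close> with central
  image; the subfield itself is \<open>range \<iota>\<close>.  In this way the vector space notions of the library
  apply to \<open>'a\<close> and to the matrices over \<open>'a\<close>.
\<close>

definition central_embedding :: "('f::field \<Rightarrow> 'a::division_ring) \<Rightarrow> bool" where
  "central_embedding \<iota> \<longleftrightarrow>
     \<iota> 1 = 1 \<and> (\<forall>a b. \<iota> (a + b) = \<iota> a + \<iota> b) \<and> (\<forall>a b. \<iota> (a * b) = \<iota> a * \<iota> b) \<and>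
     (\<forall>a x. \<iota> a * x = x * \<iota> a)"

definition fscale :: "('f::field \<Rightarrow> 'a::division_ring) \<Rightarrow> 'f \<Rightarrow> 'a \<Rightarrow> 'a" where
  "fscale \<iota> c x = \<iota> c * x"

definition fscale_mat ::
    "('f::field \<Rightarrow> 'a::division_ring) \<Rightarrow> 'f \<Rightarrow> 'a^'n^'m \<Rightarrow> 'a^'n^'m" where
  "fscale_mat \<iota> c M = map_matrix (fscale \<iota> c) M"

lemma vector_space_fscale:
  assumes "central_embedding \<iota>"
  shows "vector_space (fscale \<iota>)"
proof -
  have "\<iota> 1 = 1" "\<And>a b. \<iota> (a + b) = \<iota> a + \<iota> b" "\<And>a b. \<iota> (a * b) = \<iota> a * \<iota> b"
    using assms unfolding central_embedding_def by blast+
  then show ?thesis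
    by unfold_locales (simp_all add: fscale_def distrib_left distrib_right mult.assoc)
qed

lemma vector_space_fscale_mat:
  assumes "central_embedding \<iota>"
  shows "vector_space (fscale_mat \<iota>)"
proof -
  have "\<iota> 1 = 1" "\<And>a b. \<iota> (a + b) = \<iota> a + \<iota> b" "\<And>a b. \<iota> (a * b) = \<iota> a * \<iota> b"
    using assms unfolding central_embedding_def by blast+
  then show ?thesis
    by unfold_locales
      (simp_all add: fscale_mat_def fscale_def vec_eq_iff distrib_left distrib_right mult.assoc)
qed

text \<open>\<open>'a\<close> has finite dimension \<open>d\<close> over \<open>'f\<close>.\<close>

definition has_degree :: "('f::field \<Rightarrow> 'a::division_ring) \<Rightarrow> nat \<Rightarrow> bool" where
  "has_degree \<iota> d \<longleftrightarrow> (\<exists>B. finite_dimensional_vector_space (fscale \<iota>) B \<and> card B = d)"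

definition commutative :: "'a::division_ring itself \<Rightarrow> bool" where
  "commutative _ \<longleftrightarrow> (\<forall>x y :: 'a. x * y = y * x)"


subsection \<open>Division rings of quadratic type\<close>

text \<open>The library function \<open>poly\<close> needs commutative coefficients, so the value at \<open>x\<close> of a
  polynomial over \<open>'f\<close> is written out.  The polynomial \<open>p\<close> below is, up to a nonzero factor, the
  minimal polynomial of \<open>x\<close>.\<close>

definition separable_element :: "('f::field \<Rightarrow> 'a::division_ring) \<Rightarrow> 'a \<Rightarrow> bool" where
  "separable_element \<iota> x \<longleftrightarrow>
     (\<exists>p :: 'f poly. irreducible p \<and> (\<Sum>i\<le>degree p. \<iota> (coeff p i) * x ^ i) = 0 \<and>
        coprime p (pderiv p))"

definition separable_field_extension :: "('f::field \<Rightarrow> 'a::division_ring) \<Rightarrow> bool" where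
  "separable_field_extension \<iota> \<longleftrightarrow> commutative TYPE('a) \<and> (\<forall>x. separable_element \<iota> x)"

text \<open>A quaternion algebra is a central simple algebra of dimension 4; a division ring is
  always simple.\<close>

definition quaternion_algebra :: "('f::field \<Rightarrow> 'a::division_ring) \<Rightarrow> bool" where
  "quaternion_algebra \<iota> \<longleftrightarrow> has_degree \<iota> 4 \<and> {z. \<forall>x. z * x = x * z} = range \<iota>"

definition quadratic_type_i :: "('f::field \<Rightarrow> 'a::division_ring) \<Rightarrow> bool" where
  "quadratic_type_i \<iota> \<longleftrightarrow> has_degree \<iota> 1"

definition quadratic_type_ii :: "('f::field \<Rightarrow> 'a::division_ring) \<Rightarrow> bool" where
  "quadratic_type_ii \<iota> \<longleftrightarrow> has_degree \<iota> 2 \<and> separable_field_extension \<iota>"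

definition quadratic_type_iii :: "('f::field \<Rightarrow> 'a::division_ring) \<Rightarrow> bool" where
  "quadratic_type_iii \<iota> \<longleftrightarrow> has_degree \<iota> 4 \<and> quaternion_algebra \<iota>"

definition quadratic_type_iv :: "('f::field \<Rightarrow> 'a::division_ring) \<Rightarrow> bool" where
  "quadratic_type_iv \<iota> \<longleftrightarrow>
     (\<exists>m\<ge>1. has_degree \<iota> (2 ^ m)) \<and> CHAR('f) = 2 \<and> commutative TYPE('a) \<and>
     (\<forall>x. x ^ 2 \<in> range \<iota>)"

definition quadratic_type :: "('f::field \<Rightarrow> 'a::division_ring) \<Rightarrow> bool" where
  "quadratic_type \<iota> \<longleftrightarrow>
     quadratic_type_i \<iota> \<or> quadratic_type_ii \<iota> \<or> quadratic_type_iii \<iota> \<or> quadratic_type_iv \<iota>"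


subsection \<open>Associated pairs\<close>

definition F_automorphisms :: "('f::field \<Rightarrow> 'a::division_ring) \<Rightarrow> ('a \<Rightarrow> 'a) set" where
  "F_automorphisms \<iota> =
     {\<tau>. bij \<tau> \<and> (\<forall>x y. \<tau> (x + y) = \<tau> x + \<tau> y) \<and> (\<forall>x y. \<tau> (x * y) = \<tau> x * \<tau> y) \<and>
         (\<forall>c. \<tau> (\<iota> c) = \<iota> c)}"

text \<open>Quaternionic conjugation is the unique \<open>'f\<close>-linear involutive anti-automorphism of a
  quaternion algebra for which \<open>x + \<sigma> x\<close> (the reduced trace) and \<open>x * \<sigma> x\<close> (the reduced norm)
  always lie in the base field; this covers every characteristic.\<close>

definition quaternionic_conjugation ::
    "('f::field \<Rightarrow> 'a::division_ring) \<Rightarrow> ('a \<Rightarrow> 'a) \<Rightarrow> bool" where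
  "quaternionic_conjugation \<iota> \<sigma> \<longleftrightarrow>
     Vector_Spaces.linear (fscale \<iota>) (fscale \<iota>) \<sigma> \<and>
     (\<forall>x. \<sigma> (\<sigma> x) = x) \<and> (\<forall>x y. \<sigma> (x * y) = \<sigma> y * \<sigma> x) \<and>
     (\<forall>x. x + \<sigma> x \<in> range \<iota>) \<and> (\<forall>x. x * \<sigma> x \<in> range \<iota>)"

text \<open>The four cases of \<open>quadratic_type\<close> exclude one another, so that at most one clause applies
  here and in \<open>associated_pair\<close>.\<close>

definition standard_involution ::
    "('f::field \<Rightarrow> 'a::division_ring) \<Rightarrow> ('a \<Rightarrow> 'a) \<Rightarrow> bool" where
  "standard_involution \<iota> \<sigma> \<longleftrightarrow>
     (quadratic_type_i \<iota> \<or> quadratic_type_iv \<iota> \<longrightarrow> \<sigma> = id) \<and>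
     (quadratic_type_ii \<iota> \<longrightarrow> \<sigma> \<in> F_automorphisms \<iota> \<and> \<sigma> \<noteq> id) \<and>
     (quadratic_type_iii \<iota> \<longrightarrow> quaternionic_conjugation \<iota> \<sigma>)"

definition associated_pair ::
    "('f::field \<Rightarrow> 'a::division_ring) \<Rightarrow> ('a \<Rightarrow> 'a) \<Rightarrow> ('a \<Rightarrow> 'f) \<Rightarrow> bool" where
  "associated_pair \<iota> \<sigma> e \<longleftrightarrow>
     standard_involution \<iota> \<sigma> \<and> Vector_Spaces.linear (fscale \<iota>) (*) e \<and>
     (quadratic_type_i \<iota> \<or> quadratic_type_ii \<iota> \<longrightarrow>
        (\<forall>x. \<iota> (e x) = (\<Sum>\<tau>\<in>F_automorphisms \<iota>. \<tau> x))) \<and>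
     (quadratic_type_iii \<iota> \<longrightarrow> (\<forall>x. \<iota> (e x) = x + \<sigma> x)) \<and>
     (quadratic_type_iv \<iota> \<longrightarrow> (\<exists>x. e x \<noteq> 0))"


subsection \<open>Spaces of matrices\<close>

definition trivial_spectrum_subspace ::
    "('f::field \<Rightarrow> 'a::division_ring) \<Rightarrow> ('a^'n^'n) set \<Rightarrow> bool" where
  "trivial_spectrum_subspace \<iota> S \<longleftrightarrow>
     module.subspace (fscale_mat \<iota>) S \<and> (\<forall>M\<in>S. invertible (mat 1 - M))"

definition optimal ::
    "('f::field \<Rightarrow> 'a::division_ring) \<Rightarrow> ('a^'n^'n) set \<Rightarrow> bool" where
  "optimal \<iota> S \<longleftrightarrow>
     trivial_spectrum_subspace \<iota> S \<and>
     (\<forall>T :: ('a^'n^'n) set. trivial_spectrum_subspace \<iota> T \<longrightarrow>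
        vector_space.dim (fscale_mat \<iota>) T \<le> vector_space.dim (fscale_mat \<iota>) S)"

text \<open>Columns form a right vector space over \<open>'a\<close>, so scalars act on the right.\<close>

definition right_subspace :: "('a::division_ring^'n) set \<Rightarrow> bool" where
  "right_subspace W \<longleftrightarrow>
     0 \<in> W \<and> (\<forall>x\<in>W. \<forall>y\<in>W. x + y \<in> W) \<and> (\<forall>x\<in>W. \<forall>c. (\<chi> i. x $ i * c) \<in> W)"

definition irreducible_set :: "('a::division_ring^'n^'n) set \<Rightarrow> bool" where
  "irreducible_set S \<longleftrightarrow>
     (\<forall>W. right_subspace W \<and> (\<forall>M\<in>S. \<forall>x\<in>W. M *v x \<in> W) \<longrightarrow> W = {0} \<or> W = UNIV)"

definition similar_sets ::
    "('a::division_ring^'n^'n) set \<Rightarrow> ('a^'n^'n) set \<Rightarrow> bool" where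
  "similar_sets S T \<longleftrightarrow>
     (\<exists>Q. invertible Q \<and> T = (\<lambda>M. Q ** M ** matrix_inv Q) ` S)"

definition star :: "('a \<Rightarrow> 'a) \<Rightarrow> 'a^'n^'m \<Rightarrow> 'a^'m^'n" where
  "star \<sigma> A = transpose (map_matrix \<sigma> A)"

definition SH :: "('a::division_ring \<Rightarrow> 'a) \<Rightarrow> ('a \<Rightarrow> 'f::field) \<Rightarrow> ('a^'n^'n) set" where
  "SH \<sigma> e = {M. star \<sigma> M = - M \<and> (\<forall>i. e (M $ i $ i) = 0)}"

text \<open>The sum is the single entry of the product of the row \<open>star \<sigma> X\<close>, \<open>P\<close> and the column
  \<open>X\<close>.\<close>

definition e_nonisotropic ::
    "('a::division_ring \<Rightarrow> 'a) \<Rightarrow> ('a \<Rightarrow> 'f::field) \<Rightarrow> 'a^'n^'n \<Rightarrow> bool" where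
  "e_nonisotropic \<sigma> e P \<longleftrightarrow>
     (\<forall>X. X \<noteq> 0 \<longrightarrow> e (\<Sum>i\<in>UNIV. \<sigma> (X $ i) * (P *v X) $ i) \<noteq> 0)"

definition homo_star_congruent ::
    "('f::field \<Rightarrow> 'a::division_ring) \<Rightarrow> ('a \<Rightarrow> 'a) \<Rightarrow> 'a^'n^'n \<Rightarrow> 'a^'n^'n \<Rightarrow> bool" where
  "homo_star_congruent \<iota> \<sigma> A B \<longleftrightarrow>
     (\<exists>\<alpha> P. \<alpha> \<noteq> 0 \<and> invertible P \<and> B = fscale_mat \<iota> \<alpha> (P ** A ** star \<sigma> P))"

end

theory Submission
  imports Defs
begin

text \<open>
  Let \<open>V\<close> be a trivial spectrum space of operators of a right vector space \<open>E\<close>.  If the orbit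
  \<open>V x\<close> has the greatest possible dimension over \<open>F\<close>, then perturbing \<open>x\<close> along the lines
  \<open>x + t y\<close> shows that every element of \<open>V\<close> that kills \<open>x\<close> maps \<open>E\<close> into \<open>V x\<close>, which does not
  contain \<open>x\<close>; this is where the cardinality of \<open>F\<close> matters.  Hence the stabilizer of \<open>x\<close> acts
  faithfully on \<open>E / x D\<close>, and induction bounds the dimension of \<open>V\<close> by the sum of \<open>j d - 1\<close>
  for \<open>j \<le> dim E\<close>.  If \<open>V\<close> attains the bound, then \<open>V x\<close> is a hyperplane over \<open>F\<close>, and
  the largest \<open>D\<close>-subspace \<open>L\<close> of \<open>V x\<close> is a complement of \<open>x D\<close> on which the stabilizer of \<open>x\<close> is
  optimal, and irreducible if \<open>V\<close> is.  By induction the stabilizer consists of the \<open>M\<close> with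
  \<open>e (b X (M X)) = 0\<close> for a nonisotropic sesquilinear form \<open>b\<close> on \<open>L\<close>, and the trivial spectrum
  condition, read off from Schur complements, forces \<open>b\<close> to extend to a form on \<open>E\<close> that describes
  \<open>V\<close>.  Since \<open>V x\<close> is the kernel of \<open>e (b x _)\<close> for every \<open>x\<close>, the space \<open>V\<close> determines \<open>b\<close> up to a
  factor in \<open>F\<close>, and this gives the classification up to similarity.
\<close>

subsection \<open>Linear algebra over the base field\<close>

text \<open>The dimension of a column type cannot vary, so the induction runs over subspaces
  \<open>E\<close> and \<open>U\<close> of one fixed column space. Matrices matter only through
  their action there, and the bounds carry a term for those that act as zero. Optimality travels
  through the induction as a lower bound by \<open>opt_dim\<close>; equality with a space of
  alternating operators is reached only at the end. The size of F enters through a finite set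
  \<open>T\<close> of scalars, which covers infinite fields too. In the tight case the affine points
  of a pencil are one short of a contradiction, and the point at infinity supplies it. All
  characteristics and all four types are treated at once because conditions are phrased with the
  F-valued \<open>e\<close>: no symmetry of \<open>b\<close> and no halving occurs, and identities
  in D are recovered from \<open>e (x * y)\<close> for all \<open>y\<close>. The form on
  \<open>E\<close> is not simply an orthogonal sum: its first argument may be sheared by a map
  \<open>\<nu>\<close>, and the additivity of \<open>\<nu>\<close> is a delicate point.\<close>

context finite_dimensional_vector_space
begin

lemma independent_family:
  assumes T: "finite T" and c: "\<And>c. (\<Sum>t\<in>T. scale (c t) (v t)) = 0 \<Longrightarrow> \<forall>t\<in>T. c t = 0"
  shows "inj_on v T" "independent (v ` T)"
proof -
  show inj: "inj_on v T"
  proof (rule inj_onI, rule ccontr)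
    fix s t assume st: "s \<in> T" "t \<in> T" "v s = v t" "s \<noteq> t"
    \<comment> \<open>Difference of the indicators of \<open>s\<close> and \<open>t\<close>: a
      repeated vector would satisfy a nontrivial relation.\<close>
    define c where "c = (\<lambda>x. (if x = s then 1 else 0) - (if x = t then 1 else 0) :: 'a)"
    have "(\<Sum>x\<in>T. scale (c x) (v x)) = (\<Sum>x\<in>T. if x = s then v x else 0) - (\<Sum>x\<in>T. if x = t then v x else 0)"
      unfolding sum_subtractf[symmetric]
      by (rule sum.cong) (auto simp: c_def scale_left_diff_distrib)
    also have "\<dots> = 0" using st T by (simp add: sum.delta)
    finally have "c s = 0" using c st by blast
    then show False using st by (simp add: c_def)
  qed
  show "independent (v ` T)"
  proof (rule independent_if_scalars_zero)
    show "finite (v ` T)" using T by simp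
    fix f x assume "(\<Sum>x\<in>v ` T. scale (f x) x) = 0" "x \<in> v ` T"
    then have "(\<Sum>t\<in>T. scale (f (v t)) (v t)) = 0" by (simp add: sum.reindex[OF inj])
    from c[OF this] \<open>x \<in> v ` T\<close> show "f x = 0" by auto
  qed
qed

lemma independent_family_card_le_dim:
  assumes "finite T" "\<And>c. (\<Sum>t\<in>T. scale (c t) (v t)) = 0 \<Longrightarrow> \<forall>t\<in>T. c t = 0" "v ` T \<subseteq> Y"
  shows "card T \<le> dim Y"
  using independent_card_le_dim[OF assms(3) independent_family(2)[OF assms(1,2)]]
    card_image[OF independent_family(1)[OF assms(1,2)]] by simp

text \<open>Applying \<open>R - m\<close> to a relation removes the term at \<open>m\<close> and
  multiplies every other coefficient by the nonzero \<open>t - m\<close>. Scalars serve as indices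
  and as eigenvalues at once.\<close>

lemma eigenvectors_independent:
  assumes R: "Vector_Spaces.linear scale scale R" and T: "finite T"
    and v: "\<And>t. t \<in> T \<Longrightarrow> v t \<noteq> 0 \<and> R (v t) = scale t (v t)"
    and c: "(\<Sum>t\<in>T. scale (c t) (v t)) = 0"
  shows "\<forall>t\<in>T. c t = 0"
  using T v c
proof (induction T arbitrary: c)
  case (insert m T)
  interpret R: Vector_Spaces.linear scale scale R by (rule R)
  have m: "scale (c m) (v m) = - (\<Sum>t\<in>T. scale (c t) (v t))"
    using insert.prems(2) insert.hyps by (simp add: eq_neg_iff_add_eq_0)
  have "0 = R (\<Sum>t\<in>insert m T. scale (c t) (v t)) - scale m (\<Sum>t\<in>insert m T. scale (c t) (v t))"
    by (simp only: insert.prems(2)) (simp add: R.zero)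
  also have "\<dots> = (\<Sum>t\<in>insert m T. scale (c t * (t - m)) (v t))"
    unfolding R.sum scale_sum_right sum_subtractf[symmetric]
    by (rule sum.cong) (use insert.prems in \<open>auto simp: R.scale algebra_simps\<close>)
  also have "\<dots> = (\<Sum>t\<in>T. scale (c t * (t - m)) (v t))"
    using insert.hyps by simp
  finally have "\<forall>t\<in>T. c t * (t - m) = 0"
    using insert.IH[of "\<lambda>t. c t * (t - m)"] insert.prems by simp
  then have T0: "\<forall>t\<in>T. c t = 0" using insert.hyps by auto
  with m have "scale (c m) (v m) = 0" by simp
  then show ?case using T0 insert.prems(1) by auto
qed simp

lemma not_injective_on_if_dim_less:
  assumes f: "Vector_Spaces.linear scale scale f" and S: "subspace S" "f ` S \<subseteq> U" "dim U < dim S"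
  shows "\<exists>x\<in>S. x \<noteq> 0 \<and> f x = 0"
proof (rule ccontr)
  interpret f: Vector_Spaces.linear scale scale f by (rule f)
  interpret p: finite_dimensional_vector_space_pair scale Basis scale Basis by unfold_locales
  assume "\<not> ?thesis"
  then have "inj_on f (span S)"
    using S(1) by (intro inj_onI) (metis f.diff right_minus_eq span_eq_iff subspace_diff)
  then have "dim (f ` S) = dim S" by (rule p.dim_image_eq[OF f])
  then show False using dim_subset[OF S(2)] S(3) by simp
qed

lemma linear_injective_on_imp_surjective:
  assumes f: "Vector_Spaces.linear scale scale f" and S: "subspace S" "f ` S \<subseteq> S"
    and inj: "\<And>x. x \<in> S \<Longrightarrow> f x = 0 \<Longrightarrow> x = 0"
  shows "f ` S = S"
proof (rule subspace_dim_equal[OF _ S])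
  show "subspace (f ` S)"
    using module_hom.subspace_image[OF _ S(1)] f unfolding module_hom_iff_linear .
  show "dim S \<le> dim (f ` S)"
    using not_injective_on_if_dim_less[OF f S(1) order_refl] inj by (meson not_le)
qed

text \<open>Replaces the projection onto a quotient: calculations modulo \<open>U\<close> become
  calculations with \<open>Q\<close>, inside the same type.\<close>

lemma linear_exists_kernel:
  assumes "subspace U"
  shows "\<exists>Q. Vector_Spaces.linear scale scale Q \<and> (\<forall>x. Q x = 0 \<longleftrightarrow> x \<in> U)"
proof -
  interpret p: vector_space_pair scale scale by unfold_locales
  obtain B where B: "B \<subseteq> U" "independent B" "span B = U"
    using basis_subspace_exists[OF assms] by metis
  obtain C where C: "B \<subseteq> C" "independent C" "UNIV \<subseteq> span C"
    using maximal_independent_subset_extend[of B UNIV] B(2) by auto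
  define Q where "Q = p.construct C (\<lambda>b. if b \<in> B then 0 else b)"
  have Q: "Vector_Spaces.linear scale scale Q" unfolding Q_def by (rule p.linear_construct[OF C(2)])
  interpret Q: Vector_Spaces.linear scale scale Q by (rule Q)
  have Qb: "Q b = (if b \<in> B then 0 else b)" if "b \<in> C" for b
    unfolding Q_def by (rule p.construct_basis[OF C(2) that])
  have 1: "x - Q x \<in> U" for x
  proof -
    have "x \<in> span C" using C(3) by auto
    then show ?thesis
    proof (induction rule: span_induct)
      case base
      show ?case unfolding mem_Collect_eq
      proof (rule subspaceI)
        fix c x assume "x \<in> {x. x - Q x \<in> U}"
        then show "scale c x \<in> {x. x - Q x \<in> U}"
          using subspace_scale[OF assms] by (auto simp: Q.scale scale_right_diff_distrib[symmetric])
      next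
        fix x y assume "x \<in> {x. x - Q x \<in> U}" "y \<in> {x. x - Q x \<in> U}"
        then show "x + y \<in> {x. x - Q x \<in> U}"
          using subspace_add[OF assms] by (auto simp: Q.add add_diff_add)
      qed (use subspace_0[OF assms] in \<open>simp add: Q.zero\<close>)
    next
      case (step b)
      then show ?case using B subspace_0[OF assms] by (auto simp: Qb)
    qed
  qed
  have 2: "Q x = 0" if "x \<in> U" for x
    proof (rule Q.eq_0_on_span[of B])
    show "Q u = 0" if "u \<in> B" for u using that C(1) by (auto simp: Qb)
  qed (use that B(3) in blast)
  have 3: "x \<in> U" if "Q x = 0" for x using 1[of x] that by simp
  show ?thesis using Q 2 3 by blast
qed

lemma linear_functional_exists:
  assumes "subspace H" "x \<notin> H"
  shows "\<exists>\<phi>. Vector_Spaces.linear scale (*) \<phi> \<and> (\<forall>y\<in>H. \<phi> y = 0) \<and> \<phi> x = 1"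
proof -
  interpret p: vector_space_pair scale "(*)" by unfold_locales
  obtain B where B: "B \<subseteq> H" "independent B" "span B = H"
    using basis_subspace_exists[OF assms(1)] by metis
  have ind: "independent (insert x B)" using B assms(2) by (intro independent_insertI) auto
  define \<phi> where "\<phi> = p.construct (insert x B) (\<lambda>b. if b = x then 1 else 0)"
  have l: "Vector_Spaces.linear scale (*) \<phi>" unfolding \<phi>_def by (rule p.linear_construct[OF ind])
  interpret \<phi>: Vector_Spaces.linear scale "(*)" \<phi> by (rule l)
  have b: "\<phi> b = (if b = x then 1 else 0)" if "b \<in> insert x B" for b
    unfolding \<phi>_def by (rule p.construct_basis[OF ind that])
  have "\<phi> y = 0" if "y \<in> H" for y
  proof (rule \<phi>.eq_0_on_span[of B])
    show "\<phi> u = 0" if "u \<in> B" for u using that b[of u] subsetD[OF B(1), of u] assms(2) by (cases "u = x") simp_all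
  qed (use that B(3) in blast)
  have "\<phi> x = 1" using b by simp
  then show ?thesis using l \<open>\<And>y. y \<in> H \<Longrightarrow> \<phi> y = 0\<close> by metis
qed

lemma dim_insert_subspace:
  assumes "subspace S" "x \<notin> S"
  shows "dim (span (insert x S)) = dim S + 1"
  using assms by (metis dim_insert dim_span span_eq_iff)

lemma dim_less_if_not_in:
  assumes "subspace S" "S \<subseteq> E" "x \<in> E" "x \<notin> S"
  shows "dim S + 1 \<le> dim E"
  using dim_insert_subspace[OF assms(1,4)] dim_subset[of "insert x S" E] assms by simp

text \<open>If \<open>M u\<close> were outside the span \<open>K\<close> of the \<open>y t\<close>, applying \<open>M\<close> to a linear relation among
  \<open>u\<close> and the \<open>y t\<close> would show that \<open>u\<close> has coefficient zero, and these vectors would be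
  independent.\<close>

lemma resolvent_orbit:
  fixes T :: "'a set"
  assumes M: "Vector_Spaces.linear scale scale M" and Z: "subspace Z"
    and u: "u \<in> Z" "u \<noteq> 0"
    and y: "\<And>t. y t \<in> Z" "\<And>t. y t - scale t (M (y t)) = u"
    and T: "finite T" "dim Z < card T"
  shows "M u \<in> Z" "M (M u) \<in> Z"
proof -
  interpret M: Vector_Spaces.linear scale scale M by (rule M)
  define K where "K = span (insert u (range y))"
  have K: "subspace K" by (simp add: K_def)
  have KZ: "K \<subseteq> Z" unfolding K_def using u y Z by (intro span_minimal) auto
  have uK: "u \<in> K" and yK: "y t \<in> K" for t by (auto simp: K_def intro: span_base)
  have My: "M (y t) = scale (inverse t) (y t - u)" if "t \<noteq> 0" for t
  proof -
    have "y t - u = scale t (M (y t))" using y(2)[of t] by (simp add: algebra_simps)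
    then show ?thesis using that by simp
  qed
  have MyK: "M (y t) \<in> K" if "t \<noteq> 0" for t
    unfolding My[OF that] by (intro subspace_scale[OF K] subspace_diff[OF K] uK yK)
  have "y 0 = u" using y(2)[of 0] by simp
  have MuK: "M u \<in> K"
  proof (rule ccontr)
    assume nK: "M u \<notin> K"
    \<comment> \<open>For \<open>t \<noteq> 0\<close> the vector \<open>M (y t)\<close> lies in
      \<open>K\<close>, so applying \<open>M\<close> to the relation puts \<open>c0\<close> times
      \<open>M u\<close> into \<open>K\<close>.\<close>
    have c0: "c0 = 0" if "finite A" "0 \<notin> A" "scale c0 u + (\<Sum>t\<in>A. scale (c t) (y t)) = 0" for A c0 c
    proof (rule ccontr)
      assume "c0 \<noteq> 0"
      have "M (scale c0 u + (\<Sum>t\<in>A. scale (c t) (y t))) = 0" by (simp only: that(3) M.zero)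
      then have "scale c0 (M u) = - (\<Sum>t\<in>A. scale (c t) (M (y t)))"
        by (simp add: M.add M.sum M.scale eq_neg_iff_add_eq_0)
      also have "\<dots> \<in> K"
        using that(2) by (intro subspace_neg[OF K] subspace_sum[OF K] subspace_scale[OF K] MyK) auto
      finally have "scale (inverse c0) (scale c0 (M u)) \<in> K" by (rule subspace_scale[OF K])
      then show False using nK \<open>c0 \<noteq> 0\<close> by simp
    qed
    have ind: "\<forall>t\<in>A. c t = 0" if "finite A" "0 \<notin> A" "(\<Sum>t\<in>A. scale (c t) (y t)) = 0" for A c
      using that
    proof (induction A arbitrary: c)
      case (insert s A)
      let ?A = "insert s A"
      have fin: "finite ?A" and s: "s \<noteq> 0" using insert by auto
      have "0 = M (\<Sum>t\<in>?A. scale (c t) (y t))" by (simp only: insert.prems M.zero)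
      also have "\<dots> = (\<Sum>t\<in>?A. scale (c t * inverse t) (y t) - scale (c t * inverse t) u)"
        unfolding M.sum
        proof (intro sum.cong refl)
        fix t assume "t \<in> ?A"
        then have "t \<noteq> 0" using insert.prems(1) by metis
        then show "M (scale (c t) (y t)) = scale (c t * inverse t) (y t) - scale (c t * inverse t) u"
          by (simp add: M.scale My scale_right_diff_distrib)
      qed
      also have "\<dots> = scale (- (\<Sum>t\<in>?A. c t * inverse t)) u + (\<Sum>t\<in>?A. scale (c t * inverse t) (y t))"
        by (simp add: sum_subtractf scale_sum_left[symmetric] scale_minus_left algebra_simps del: sum.insert)
      finally have eq: "scale (- (\<Sum>t\<in>?A. c t * inverse t)) u + (\<Sum>t\<in>?A. scale (c t * inverse t) (y t)) = 0"
        by simp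
      with c0[OF fin insert.prems(1) eq] have eq2: "(\<Sum>t\<in>?A. scale (c t * inverse t) (y t)) = 0"
        by simp
      \<comment> \<open>There are now two relations, with coefficients \<open>c t\<close> and
        \<open>c t / t\<close>. Subtracting \<open>s\<close> times the second removes the term at
        \<open>s\<close>; the factor \<open>1 - s / t\<close> is nonzero at the other
        indices.\<close>
      have "(\<Sum>t\<in>?A. scale (c t) (y t)) - scale s (\<Sum>t\<in>?A. scale (c t * inverse t) (y t))
          = (\<Sum>t\<in>?A. scale (c t * (1 - s * inverse t)) (y t))"
        unfolding scale_sum_right sum_subtractf[symmetric]
        by (rule sum.cong) (auto simp: algebra_simps)
      then have "(\<Sum>t\<in>A. scale (c t * (1 - s * inverse t)) (y t)) = 0"
        unfolding insert.prems(2) eq2 using insert.hyps s by simp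
      then have A1: "\<forall>t\<in>A. c t * (1 - s * inverse t) = 0"
        using insert.IH[of "\<lambda>t. c t * (1 - s * inverse t)"] insert.prems(1) by simp
      have A0: "\<forall>t\<in>A. c t = 0"
      proof
        fix t assume t: "t \<in> A"
        then have "t \<noteq> s" "t \<noteq> 0" using insert.hyps insert.prems(1) by auto
        then have "1 - s * inverse t \<noteq> 0" by (simp add: field_simps)
        then show "c t = 0" using A1 t by (metis mult_eq_0_iff)
      qed
      then have "scale (c s) (y s) = 0" using insert.prems(2) insert.hyps by simp
      moreover have "y s \<noteq> 0" using y(2)[of s] u(2) by (auto simp: M.zero)
      ultimately show ?case using A0 by simp
    qed simp
    \<comment> \<open>Whether or not 0 lies in \<open>T\<close>, at least \<open>dim Z\<close>
      nonzero scalars remain, and \<open>y 0 = u\<close> supplies one more independent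
      vector.\<close>
    define A where "A = T - {0}"
    have A: "finite A" "0 \<notin> A" "dim Z \<le> card A" using T by (auto simp: A_def card_Diff_singleton_if)
    have "card (insert 0 A) \<le> dim Z"
    proof (rule independent_family_card_le_dim)
      show "y ` insert 0 A \<subseteq> Z" using y by auto
      fix c assume "(\<Sum>t\<in>insert 0 A. scale (c t) (y t)) = 0"
      then have eq: "scale (c 0) u + (\<Sum>t\<in>A. scale (c t) (y t)) = 0" using A \<open>y 0 = u\<close> by simp
      have "c 0 = 0" by (rule c0[OF A(1,2) eq])
      with eq ind[OF A(1,2), of c] show "\<forall>t\<in>insert 0 A. c t = 0" by simp
    qed (use A in simp)
    then show False using A by simp
  qed
  have MK: "M x \<in> K" if "x \<in> K" for x
    using that unfolding K_def
  proof (induction rule: span_induct)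
    case base
    show ?case using M.subspace_linear_preimage[OF K] unfolding K_def by simp
  next
    case (step x)
    then show ?case
    proof
      assume "x = u" then show ?thesis using MuK by (simp add: K_def)
    next
      assume "x \<in> range y"
      then obtain t where t: "x = y t" by auto
      show ?thesis using MyK[of t] MuK \<open>y 0 = u\<close> unfolding t K_def by (cases "t = 0") auto
    qed
  qed
  show "M u \<in> Z" "M (M u) \<in> Z" using MuK MK KZ by auto
qed

end

definition (in vector_space) bilinear_on :: "'b set \<Rightarrow> ('b \<Rightarrow> 'b \<Rightarrow> 'a) \<Rightarrow> bool" where
  "bilinear_on S B \<longleftrightarrow> (\<forall>x\<in>S. \<forall>y\<in>S. \<forall>z\<in>S. \<forall>c.
     B (x + y) z = B x z + B y z \<and> B z (x + y) = B z x + B z y \<and>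
     B (scale c x) z = c * B x z \<and> B z (scale c x) = c * B z x)"

text \<open>For fixed \<open>y\<close> the forms \<open>B1 _ y\<close> and \<open>B2 _ y\<close> are
  proportional because one kernel contains the other, and likewise for fixed \<open>x\<close>. The
  factor is carried from \<open>(x0, y0)\<close> to \<open>(x, y)\<close> through a vector
  \<open>w\<close> that pairs nontrivially with both \<open>y0\<close> and \<open>y\<close>.\<close>

lemma (in vector_space) proportional_bilinear_forms:
  assumes S: "subspace S" and bilinear: "bilinear_on S B1" "bilinear_on S B2"
    and ker: "\<And>x y. x \<in> S \<Longrightarrow> y \<in> S \<Longrightarrow> B1 x y = 0 \<Longrightarrow> B2 x y = 0"
    and nondeg: "\<And>y. y \<in> S \<Longrightarrow> y \<noteq> 0 \<Longrightarrow> \<exists>x\<in>S. B1 x y \<noteq> 0"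
  shows "\<exists>l. \<forall>x\<in>S. \<forall>y\<in>S. B2 x y = l * B1 x y"
proof -
  have B: "B (x + y) z = B x z + B y z" "B z (x + y) = B z x + B z y"
    "B (scale c x) z = c * B x z" "B z (scale c x) = c * B z x"
    if "x \<in> S" "y \<in> S" "z \<in> S" "B = B1 \<or> B = B2" for B x y z c
    using bilinear that unfolding bilinear_on_def by blast+
  have B0: "B1 x 0 = 0" "B2 x 0 = 0" if "x \<in> S" for x
    using B(4)[of 0 0 x _ 0] that subspace_0[OF S] by auto
  have left: "B2 x y * B1 x0 y = B2 x0 y * B1 x y" if s: "x \<in> S" "x0 \<in> S" "y \<in> S" for x x0 y
  proof -
    let ?u = "scale (B1 x0 y) x" and ?v = "scale (- B1 x y) x0"
    have uv: "?u \<in> S" "?v \<in> S" by (intro subspace_scale[OF S] s)+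
    have "B1 (?u + ?v) y = 0" using s uv by (simp add: B del: scale_minus_left)
    then have "B2 (?u + ?v) y = 0" using ker subspace_add[OF S] uv s by blast
    then show ?thesis using s uv by (simp add: B algebra_simps del: scale_minus_left)
  qed
  have right: "B2 x y * B1 x y0 = B2 x y0 * B1 x y" if s: "x \<in> S" "y0 \<in> S" "y \<in> S" for x y0 y
  proof -
    let ?u = "scale (B1 x y0) y" and ?v = "scale (- B1 x y) y0"
    have uv: "?u \<in> S" "?v \<in> S" by (intro subspace_scale[OF S] s)+
    have "B1 x (?u + ?v) = 0" using s uv by (simp add: B del: scale_minus_left)
    then have "B2 x (?u + ?v) = 0" using ker subspace_add[OF S] uv s by blast
    then show ?thesis using s uv by (simp add: B algebra_simps del: scale_minus_left)
  qed
  show ?thesis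
  proof (cases "S \<subseteq> {0}")
    case True
    have "\<forall>x\<in>S. \<forall>y\<in>S. B2 x y = 0 * B1 x y" using B0 True by (auto dest: subsetD)
    then show ?thesis by blast
  next
    case False
    then obtain y0 where y0: "y0 \<in> S" "y0 \<noteq> 0" by auto
    then obtain x0 where x0: "x0 \<in> S" "B1 x0 y0 \<noteq> 0" using nondeg by blast
    have "B2 x y * B1 x0 y0 = B2 x0 y0 * B1 x y" if s: "x \<in> S" "y \<in> S" for x y
    proof (cases "y = 0")
      case True
      then show ?thesis using B0 s by simp
    next
      case False
      then obtain x1 where x1: "x1 \<in> S" "B1 x1 y \<noteq> 0" using nondeg s by blast
      \<comment> \<open>If neither \<open>x0\<close> nor \<open>x1\<close> serves both vectors, the
        cross terms vanish and the sum serves both.\<close>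
      have "\<exists>w\<in>S. B1 w y0 \<noteq> 0 \<and> B1 w y \<noteq> 0"
      proof (cases "B1 x0 y = 0 \<and> B1 x1 y0 = 0")
        case True
        then have "B1 (x0 + x1) y0 \<noteq> 0" "B1 (x0 + x1) y \<noteq> 0" using x0 x1 y0 s by (auto simp: B)
        then show ?thesis using subspace_add[OF S x0(1) x1(1)] by blast
      qed (use x0 x1 in blast)
      then obtain w where w: "w \<in> S" "B1 w y0 \<noteq> 0" "B1 w y \<noteq> 0" by blast
      have 1: "B2 x y = B2 w y / B1 w y * B1 x y" using left[OF s(1) w(1) s(2)] w by (simp add: field_simps)
      have 2: "B2 w y / B1 w y = B2 w y0 / B1 w y0" using right[OF w(1) y0(1) s(2)] w by (simp add: field_simps)
      have 3: "B2 x0 y0 = B2 w y0 / B1 w y0 * B1 x0 y0" using left[OF x0(1) w(1) y0(1)] w by (simp add: field_simps)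
      show ?thesis unfolding 1 2 3 by simp
    qed
    then have "\<forall>x\<in>S. \<forall>y\<in>S. B2 x y = (B2 x0 y0 / B1 x0 y0) * B1 x y"
      using x0 by (simp add: field_simps)
    then show ?thesis by blast
  qed
qed

section \<open>Rank and nullity on a subspace, and pencils of linear maps\<close>

context finite_dimensional_vector_space_pair
begin

lemma rank_nullity:
  assumes f: "Vector_Spaces.linear s1 s2 f" and S: "vs1.subspace S"
  shows "vs1.dim S = vs2.dim (f ` S) + vs1.dim {x \<in> S. f x = 0}"
proof -
  interpret f: Vector_Spaces.linear s1 s2 f by (rule f)
  interpret p: finite_dimensional_vector_space_pair s2 B2 s1 B1 by unfold_locales
  obtain h where h: "range h \<subseteq> S" "Vector_Spaces.linear s2 s1 h" "\<forall>v\<in>f ` S. f (h v) = v"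
    using linear_exists_right_inverse_on[OF f S] by auto
  interpret h: Vector_Spaces.linear s2 s1 h by (rule h)
  let ?K = "{x \<in> S. f x = 0}" and ?H = "h ` f ` S"
  have fS: "vs2.subspace (f ` S)" by (rule f.subspace_image[OF S])
  have K: "vs1.subspace ?K"
    using vs1.subspace_inter[OF S f.subspace_kernel] by (simp add: Int_def)
  have H: "vs1.subspace ?H" by (rule h.subspace_image[OF fS])
  have "inj_on h (vs2.span (f ` S))"
    using h(3) fS by (intro inj_onI) (metis vs2.span_eq_iff)
  then have dH: "vs1.dim ?H = vs2.dim (f ` S)" by (rule p.dim_image_eq[OF h(2)])
  have "?K \<inter> ?H = {0}"
    using h(3) vs1.subspace_0[OF K] vs1.subspace_0[OF H] by (auto simp: h.zero)
  moreover have "{x + y |x y. x \<in> ?K \<and> y \<in> ?H} = S"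
  proof
    show "S \<subseteq> {x + y |x y. x \<in> ?K \<and> y \<in> ?H}"
    proof
      fix x assume x: "x \<in> S"
      then have "x - h (f x) \<in> ?K"
        using h vs1.subspace_diff[OF S] by (auto simp: f.diff)
      moreover have "x = (x - h (f x)) + h (f x)" by simp
      ultimately show "x \<in> {x + y |x y. x \<in> ?K \<and> y \<in> ?H}" using x by blast
    qed
  qed (use h(1) vs1.subspace_add[OF S] in auto)
  ultimately show ?thesis
    using vs1.dim_sums_Int[OF K H] dH by simp
qed

text \<open>The operator \<open>R\<close> of the proof inverts \<open>f\<close> and then applies \<open>g\<close>; singularity of the pencil
  at \<open>t\<close> gives it the eigenvalue \<open>- 1 / t\<close> on the space spanned by \<open>f ` S\<close> and \<open>z\<close>, and
  \<open>z\<close> is an eigenvector for \<open>0\<close>.  The point at infinity of the pencil matters only when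
  the scalars form a field with exactly \<open>vs2.dim (f ` S) + 1\<close> elements.\<close>

lemma pencil_image_closed:
  fixes T :: "'a set"
  assumes f: "Vector_Spaces.linear s1 s2 f" and g: "Vector_Spaces.linear s1 s2 g" and S: "vs1.subspace S"
    and le: "\<And>t. vs2.dim ((\<lambda>x. f x + s2 t (g x)) ` S) \<le> vs2.dim (f ` S)"
    and le_inf: "vs2.dim (g ` S) \<le> vs2.dim (f ` S)"
    and T: "finite T" "vs2.dim (f ` S) < card T"
    and z: "\<And>t. t \<noteq> 0 \<Longrightarrow> z \<in> (\<lambda>x. f x + s2 t (g x)) ` S"
    and z_inf: "z \<in> g ` S"
  shows "z \<in> f ` S"
proof (rule ccontr)
  assume nz: "z \<notin> f ` S"
  interpret f: Vector_Spaces.linear s1 s2 f by (rule f)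
  interpret g: Vector_Spaces.linear s1 s2 g by (rule g)
  interpret p: finite_dimensional_vector_space_pair s2 B2 s2 B2 by unfold_locales
  have fS: "vs2.subspace (f ` S)" by (rule f.subspace_image[OF S])
  have z0: "z \<noteq> 0" using nz vs2.subspace_0[OF fS] by auto
  obtain h where h: "range h \<subseteq> S" "Vector_Spaces.linear s2 s1 h" "\<forall>v\<in>f ` S. f (h v) = v"
    using linear_exists_right_inverse_on[OF f S] by auto
  interpret h: Vector_Spaces.linear s2 s1 h by (rule h)
  obtain \<phi> where \<phi>: "Vector_Spaces.linear s2 (*) \<phi>" "\<forall>y\<in>f ` S. \<phi> y = 0" "\<phi> z = 1"
    using vs2.linear_functional_exists[OF fS nz] by auto
  interpret \<phi>: Vector_Spaces.linear s2 "(*)" \<phi> by (rule \<phi>)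
  \<comment> \<open>On \<open>Y\<close> this is the projection onto the image of \<open>f\<close>
    along \<open>z\<close>, so that \<open>f (h (p y)) = p y\<close> there.\<close>
  define p where "p = (\<lambda>y. y - s2 (\<phi> y) z)"
  define R where "R = (\<lambda>y. g (h (p y)))"
  have lp: "Vector_Spaces.linear s2 s2 p"
    unfolding p_def Vector_Spaces.linear_iff using vs2.vector_space_axioms
    by (auto simp: \<phi>.add \<phi>.scale vs2.scale_left_distrib vs2.scale_right_diff_distrib)
  interpret p': Vector_Spaces.linear s2 s2 p by (rule lp)
  have lR: "Vector_Spaces.linear s2 s2 R"
    unfolding R_def Vector_Spaces.linear_iff using vs2.vector_space_axioms
    by (auto simp: p'.add p'.scale h.add h.scale g.add g.scale)
  interpret R: Vector_Spaces.linear s2 s2 R by (rule lR)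
  define Y where "Y = vs2.span (insert z (f ` S))"
  have Y: "vs2.subspace Y" unfolding Y_def by simp
  have dY: "vs2.dim Y = vs2.dim (f ` S) + 1"
    unfolding Y_def by (rule vs2.dim_insert_subspace[OF fS nz])
  have zY: "z \<in> Y" unfolding Y_def by (intro vs2.span_base) simp
  have pY: "p y \<in> f ` S" if yY: "y \<in> Y" for y
  proof -
    obtain k where "y - s2 k z \<in> vs2.span (f ` S)"
      using yY unfolding Y_def vs2.span_breakdown_eq by blast
    then have k: "y - s2 k z \<in> f ` S" using vs2.span_eq_iff[THEN iffD2, OF fS] by blast
    have "0 = \<phi> (y - s2 k z)" using \<phi>(2) k by metis
    also have "\<dots> = \<phi> y - k" by (simp add: \<phi>.diff \<phi>.scale \<phi>(3))
    finally show ?thesis using k by (simp add: p_def)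
  qed
  have Rz: "R z = 0" by (simp add: R_def p_def \<phi>(3) h.zero g.zero)
  have eig: "\<exists>y\<in>Y. y \<noteq> 0 \<and> R y = s2 l y" for l
  proof (cases "l = 0")
    case True
    then show ?thesis using zY z0 Rz by auto
  next
    case False
    define t where "t = - inverse l"
    have t: "t \<noteq> 0" "l * t = - 1" using False by (auto simp: t_def)
    let ?U = "(\<lambda>x. f x + s2 t (g x)) ` S"
    have lft: "Vector_Spaces.linear s1 s2 (\<lambda>x. f x + s2 t (g x))"
      unfolding Vector_Spaces.linear_iff using vs2.vector_space_axioms vs1.vector_space_axioms
      by (auto simp: f.add f.scale g.add g.scale vs2.scale_right_distrib mult.commute)
    interpret ft: Vector_Spaces.linear s1 s2 "\<lambda>x. f x + s2 t (g x)" by (rule lft)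
    have U: "vs2.subspace ?U" by (rule ft.subspace_image[OF S])
    have "Vector_Spaces.linear s2 s2 (\<lambda>y. y + s2 t (R y))"
      unfolding Vector_Spaces.linear_iff using vs2.vector_space_axioms
      by (auto simp: R.add R.scale vs2.scale_right_distrib mult.commute)
    \<comment> \<open>Indeed \<open>y + t R y\<close> is the value of \<open>f + t g\<close> at
      \<open>h (p y)\<close> plus a multiple of \<open>z\<close>, which the pencil attains by
      assumption.\<close>
    moreover have "(\<lambda>y. y + s2 t (R y)) ` Y \<subseteq> ?U"
    proof clarify
      fix y assume y: "y \<in> Y"
      have "y + s2 t (R y) = (f (h (p y)) + s2 t (g (h (p y)))) + s2 (\<phi> y) z"
      proof -
        have "f (h (p y)) = p y" using pY[OF y] h(3) by blast
        then show ?thesis by (simp add: R_def) (simp add: p_def)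
      qed
      also have "\<dots> \<in> ?U"
        by (rule vs2.subspace_add[OF U _ vs2.subspace_scale[OF U z[OF t(1)]]]) (use h(1) in auto)
      finally show "y + s2 t (R y) \<in> ?U" .
    qed
    moreover have "vs2.dim ?U < vs2.dim Y" using le[of t] dY by simp
    ultimately obtain y where y: "y \<in> Y" "y \<noteq> 0" "y + s2 t (R y) = 0"
      using vs2.not_injective_on_if_dim_less[OF _ Y] by blast
    have "s2 l (y + s2 t (R y)) = 0" using y by simp
    then have "s2 l y - R y = 0" using t by (simp add: vs2.scale_right_distrib)
    then show ?thesis using y by auto
  qed
  then obtain v' where v': "\<And>l. v' l \<in> Y \<and> v' l \<noteq> 0 \<and> R (v' l) = s2 l (v' l)" by metis
  \<comment> \<open>The eigenvector for 0 is made \<open>z\<close> itself, so that the last step can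
    read off its coefficient with \<open>\<phi>\<close>.\<close>
  define v where "v = v'(0 := z)"
  have v: "v l \<in> Y \<and> v l \<noteq> 0 \<and> R (v l) = s2 l (v l)" for l
    using v' zY z0 Rz by (simp add: v_def)
  \<comment> \<open>With 0 included there are at least \<open>dim Y\<close> eigenvalues, so the
    independent eigenvectors form a basis of \<open>Y\<close>.\<close>
  define T' where "T' = insert 0 T"
  have T': "finite T'" "vs2.dim (f ` S) < card T'" "0 \<in> T'"
    using T by (auto simp: T'_def card_insert_if)
  have ind: "\<And>c. (\<Sum>t\<in>T'. s2 (c t) (v t)) = 0 \<Longrightarrow> \<forall>t\<in>T'. c t = 0"
    by (rule vs2.eigenvectors_independent[OF lR T'(1)]) (use v in auto)
  note fam = vs2.independent_family[OF T'(1) ind, simplified]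
  have vY: "v ` T' \<subseteq> Y" using v by auto
  have "card (v ` T') = vs2.dim Y"
    using vs2.independent_card_le_dim[OF vY fam(2)] card_image[OF fam(1)] T' dY by simp
  then have "Y \<subseteq> vs2.span (v ` T')"
    using vs2.card_eq_dim[OF vY] fam(2) T'(1) by simp
  moreover have "Vector_Spaces.linear s2 s2 (\<lambda>y. R y + y - p y)"
    unfolding Vector_Spaces.linear_iff using vs2.vector_space_axioms
    by (auto simp: R.add R.scale p'.add p'.scale vs2.scale_right_distrib vs2.scale_right_diff_distrib)
  \<comment> \<open>The pencil at infinity: the value is \<open>g (h (p y))\<close> plus a multiple
    of \<open>z\<close>. A vector \<open>y\<close> of the kernel has \<open>R y\<close> proportional
    to \<open>z\<close>, hence \<open>R (R y) = 0\<close>, which leaves only a multiple of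
    \<open>z\<close> in the eigenbasis.\<close>
  moreover have "(\<lambda>y. R y + y - p y) ` Y \<subseteq> g ` S"
  proof clarify
    fix y assume "y \<in> Y"
    have "R y + y - p y = g (h (p y)) + s2 (\<phi> y) z" by (simp add: R_def) (simp add: p_def)
    also have "\<dots> \<in> g ` S"
      using h(1) z_inf by (intro vs2.subspace_add[OF g.subspace_image[OF S]]
        vs2.subspace_scale[OF g.subspace_image[OF S]]) auto
    finally show "R y + y - p y \<in> g ` S" .
  qed
  moreover have "vs2.dim (g ` S) < vs2.dim Y" using le_inf dY by simp
  ultimately have span: "Y \<subseteq> vs2.span (v ` T')" and ex: "\<exists>y\<in>Y. y \<noteq> 0 \<and> R y + y - p y = 0"
    using vs2.not_injective_on_if_dim_less[OF _ Y, of "\<lambda>y. R y + y - p y" "g ` S"] by blast+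
  obtain y where y: "y \<in> Y" "y \<noteq> 0" "R y + y - p y = 0" using ex by blast
  have yT: "y \<in> vs2.span (v ` T')" using span y by blast
  have Ry: "R y = s2 (- \<phi> y) z" using y(3) by (simp add: p_def eq_neg_iff_add_eq_0)
  obtain c where c: "y = (\<Sum>t\<in>T'. s2 (c t) (v t))"
  proof -
    obtain u where "y = (\<Sum>x\<in>v ` T'. s2 (u x) x)"
      using yT T'(1) by (auto simp: vs2.span_finite)
    then have "y = (\<Sum>t\<in>T'. s2 (u (v t)) (v t))" by (simp add: sum.reindex[OF fam(1)])
    then show ?thesis using that[of "\<lambda>t. u (v t)"] by blast
  qed
  have "0 = R (R y)" unfolding Ry by (simp add: R.scale Rz R.neg)
  also have "\<dots> = (\<Sum>t\<in>T'. s2 (c t * t * t) (v t))"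
    using v by (simp add: c R.sum R.scale mult.assoc)
  finally have "\<forall>t\<in>T'. c t * t * t = 0" using ind[of "\<lambda>t. c t * t * t"] by simp
  then have c0: "\<forall>t\<in>T' - {0}. c t = 0" by auto
  have "(\<Sum>t\<in>T' - {0}. s2 (c t) (v t)) = 0" using c0 by (intro sum.neutral) auto
  then have "y = s2 (c 0) (v 0)"
    unfolding c by (subst sum.remove[OF T'(1,3)]) simp
  then have "\<phi> y = c 0" by (simp add: v_def \<phi>.scale \<phi>(3))
  moreover have "s2 (\<phi> y) z = 0"
    using Ry v[of 0] \<open>y = s2 (c 0) (v 0)\<close> by (simp add: R.scale)
  ultimately show False using \<open>y = s2 (c 0) (v 0)\<close> y(2) z0 by simp
qed

end

subsection \<open>The dimension bound\<close>

lemmas mv_distrib = matrix_vector_right_distrib matrix_vector_mult_add_rdistrib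
lemmas mv_diff_distrib = matrix_vector_mult_diff_distrib matrix_vector_mult_diff_rdistrib

definition rscale :: "'a::division_ring^'n \<Rightarrow> 'a \<Rightarrow> 'a^'n" (infixl \<open>\<star>\<close> 75) where
  "X \<star> c = (\<chi> i. X $ i * c)"

text \<open>The action of F on columns from the left; it agrees with the right action of
  \<open>\<iota> c\<close> because the subfield is central (\<open>vscale_eq\<close>).\<close>

definition vscale :: "('f::field \<Rightarrow> 'a::division_ring) \<Rightarrow> 'f \<Rightarrow> 'a^'n \<Rightarrow> 'a^'n" where
  "vscale \<iota> c X = (\<chi> i. \<iota> c * X $ i)"

lemma rscale_simps [simp]:
  fixes X Y :: "'a::division_ring^'n"
  shows "(X + Y) \<star> a = X \<star> a + Y \<star> a" "(X - Y) \<star> a = X \<star> a - Y \<star> a" "(- X) \<star> a = - (X \<star> a)"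
    "X \<star> a \<star> b = X \<star> (a * b)" "X \<star> 1 = X" "0 \<star> a = 0" "X \<star> 0 = 0" "(X \<star> a) $ i = X $ i * a"
  by (simp_all add: rscale_def vec_eq_iff algebra_simps)

lemma rscale_add_right: "X \<star> (a + b) = X \<star> a + X \<star> b"
  and rscale_diff_right: "X \<star> (a - b) = X \<star> a - X \<star> b"
  and rscale_minus_right [simp]: "X \<star> (- a) = - (X \<star> a)"
  by (simp_all add: rscale_def vec_eq_iff algebra_simps)

lemma rscale_eq_0_iff [simp]: "X \<star> a = 0 \<longleftrightarrow> X = 0 \<or> a = 0"
  by (auto simp: rscale_def vec_eq_iff)

lemma matrix_vector_mult_rscale [simp]:
  fixes M :: "'a::division_ring^'n^'m"
  shows "M *v (X \<star> a) = (M *v X) \<star> a"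
  by (simp add: matrix_vector_mult_def rscale_def vec_eq_iff sum_distrib_right mult.assoc)

lemma right_subspace_iff:
  "right_subspace W \<longleftrightarrow> 0 \<in> W \<and> (\<forall>x\<in>W. \<forall>y\<in>W. x + y \<in> W) \<and> (\<forall>x\<in>W. \<forall>c. x \<star> c \<in> W)"
  by (simp add: right_subspace_def rscale_def)

lemma right_subspaceD:
  assumes "right_subspace W"
  shows "0 \<in> W" "x \<in> W \<Longrightarrow> y \<in> W \<Longrightarrow> x + y \<in> W" "x \<in> W \<Longrightarrow> x \<star> c \<in> W"
    "x \<in> W \<Longrightarrow> - x \<in> W" "x \<in> W \<Longrightarrow> y \<in> W \<Longrightarrow> x - y \<in> W"
proof -
  show *: "0 \<in> W" "x \<in> W \<Longrightarrow> y \<in> W \<Longrightarrow> x + y \<in> W" "x \<in> W \<Longrightarrow> x \<star> c \<in> W" for x y c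
    using assms by (simp_all add: right_subspace_iff)
  show neg: "- x \<in> W" if "x \<in> W" for x using *(3)[OF that, of "- 1"] by simp
  show "x \<in> W \<Longrightarrow> y \<in> W \<Longrightarrow> x - y \<in> W" using *(2)[of x "- y"] neg by simp
qed

lemma right_subspace_UNIV: "right_subspace UNIV" by (simp add: right_subspace_iff)

lemma right_subspace_0: "right_subspace {0}" by (simp add: right_subspace_iff)

abbreviation stab :: "('a::division_ring^'n^'m) set \<Rightarrow> 'a^'n \<Rightarrow> ('a^'n^'m) set" where
  "stab V x \<equiv> {M \<in> V. M *v x = 0}"

abbreviation ann :: "('a::division_ring^'n^'m) set \<Rightarrow> ('a^'n) set \<Rightarrow> ('a^'n^'m) set" where
  "ann V E \<equiv> {M \<in> V. \<forall>X\<in>E. M *v X = 0}"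

definition radjoin :: "('a::division_ring^'n) set \<Rightarrow> 'a^'n \<Rightarrow> ('a^'n) set" where
  "radjoin U x = {u + x \<star> a |u a. u \<in> U}"

lemma radjoinI: "u \<in> U \<Longrightarrow> u + x \<star> a \<in> radjoin U x"
  by (auto simp: radjoin_def)

lemma radjoinE:
  assumes "y \<in> radjoin U x"
  obtains u a where "u \<in> U" "y = u + x \<star> a"
  using assms by (auto simp: radjoin_def)

lemma right_subspace_radjoin:
  assumes "right_subspace U"
  shows "right_subspace (radjoin U x)"
  unfolding right_subspace_iff
proof (intro conjI ballI allI)
  note U = right_subspaceD[OF assms]
  show "0 \<in> radjoin U x" using radjoinI[of 0 U x 0] U by simp
  fix y assume "y \<in> radjoin U x"
  then obtain u a where y: "u \<in> U" "y = u + x \<star> a" by (rule radjoinE)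
  show "y \<star> c \<in> radjoin U x" for c using radjoinI[of "u \<star> c" U x "a * c"] y U by simp
  fix z assume "z \<in> radjoin U x"
  then obtain v b where z: "v \<in> U" "z = v + x \<star> b" by (rule radjoinE)
  show "y + z \<in> radjoin U x"
    using radjoinI[of "u + v" U x "a + b"] y z U by (simp add: rscale_add_right algebra_simps)
qed

lemma subset_radjoin: "U \<subseteq> radjoin U x"
  using radjoinI[of _ U x 0] by auto

lemma mem_radjoin: "right_subspace U \<Longrightarrow> x \<in> radjoin U x"
  using radjoinI[of 0 U x 1] by (simp add: right_subspace_iff)

lemma radjoin_subset:
  "right_subspace E \<Longrightarrow> U \<subseteq> E \<Longrightarrow> x \<in> E \<Longrightarrow> radjoin U x \<subseteq> E"
  by (auto simp: radjoin_def intro!: right_subspaceD)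

lemma radjoin_kernel:
  assumes E: "right_subspace E" and x: "x \<in> E" "\<beta> x \<noteq> (0 :: 'a::division_ring)"
    and \<beta>: "\<And>Z a. Z \<in> E \<Longrightarrow> \<beta> (Z - x \<star> a) = \<beta> Z - \<beta> x * a"
  shows "E = radjoin {Z \<in> E. \<beta> Z = 0} x"
proof
  show "radjoin {Z \<in> E. \<beta> Z = 0} x \<subseteq> E" by (rule radjoin_subset[OF E _ x(1)]) auto
  show "E \<subseteq> radjoin {Z \<in> E. \<beta> Z = 0} x"
  proof
    fix Z assume Z: "Z \<in> E"
    let ?a = "inverse (\<beta> x) * \<beta> Z"
    have "Z - x \<star> ?a \<in> {Z \<in> E. \<beta> Z = 0}"
      using Z x right_subspaceD[OF E] by (simp add: \<beta> mult.assoc[symmetric])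
    from radjoinI[OF this, of x ?a] show "Z \<in> radjoin {Z \<in> E. \<beta> Z = 0} x" by simp
  qed
qed

lemma vec_eq_sum_axis: "X = (\<Sum>i\<in>UNIV. axis i 1 \<star> (X $ i))"
  by (simp add: vec_eq_iff axis_def if_distrib[of "\<lambda>x. x * _"] cong: if_cong)

lemma right_linear_matrix:
  fixes f :: "'a::division_ring^'n \<Rightarrow> 'a^'m"
  assumes add: "\<And>X Y. f (X + Y) = f X + f Y" and sc: "\<And>X a. f (X \<star> a) = f X \<star> a"
  shows "\<exists>M. \<forall>X. M *v X = f X"
proof (intro exI allI)
  fix X :: "'a^'n"
  have f0: "f 0 = 0" using add[of 0 0] by simp
  have fsum: "f (\<Sum>j\<in>A. g j) = (\<Sum>j\<in>A. f (g j))" if "finite A" for g :: "'n \<Rightarrow> _" and A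
    using that by (induction A) (auto simp: f0 add)
  have "f X = (\<Sum>j\<in>UNIV. f (axis j 1) \<star> (X $ j))"
    by (subst vec_eq_sum_axis[of X]) (simp add: fsum sc)
  then show "(\<chi> i j. f (axis j 1) $ i) *v X = f X"
    by (simp add: matrix_vector_mult_def vec_eq_iff)
qed

text \<open>The sum of \<open>j * d - 1\<close> for \<open>j\<close> from 1 to \<open>k\<close>: an
  orbit inside a quotient of F-dimension \<open>j * d\<close> misses its own vector and so has
  dimension at most \<open>j * d - 1\<close>.\<close>

primrec opt_dim :: "nat \<Rightarrow> nat \<Rightarrow> nat" where
  "opt_dim d 0 = 0"
| "opt_dim d (Suc k) = opt_dim d k + (Suc k * d - 1)"

text \<open>Dimension count for block triangular operators: \<open>p * d * q\<close> is the
  F-dimension of the homomorphisms between right spaces of dimensions \<open>q\<close> and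
  \<open>p\<close>.\<close>

lemma opt_dim_add:
  assumes "d > 0"
  shows "opt_dim d (p + q) = opt_dim d p + opt_dim d q + p * d * q"
proof (induction q)
  case (Suc q)
  have "Suc (p + q) * d - 1 = (Suc q * d - 1) + p * d" using assms by (simp add: algebra_simps)
  then show ?case using Suc by (simp add: algebra_simps)
qed simp

locale central_algebra =
  fixes \<iota> :: "'f::field \<Rightarrow> 'a::division_ring" and d :: nat and Bd :: "'a set"
  assumes central: "central_embedding \<iota>"
    and fd_D: "finite_dimensional_vector_space (fscale \<iota>) Bd" "card Bd = d"
begin

lemma iota [simp]:
  "\<iota> 1 = 1" "\<iota> (a + b) = \<iota> a + \<iota> b" "\<iota> (a * b) = \<iota> a * \<iota> b"
  and iota_central: "\<iota> a * x = x * \<iota> a"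
  using central unfolding central_embedding_def by blast+

lemma iota_0 [simp]: "\<iota> 0 = 0"
  using iota(2)[of 0 0] by simp

lemma iota_diff [simp]: "\<iota> (a - b) = \<iota> a - \<iota> b"
  using iota(2)[of "a - b" b] by simp

lemma iota_eq_0_iff [simp]: "\<iota> a = 0 \<longleftrightarrow> a = 0"
  using iota(3)[of a "inverse a"] by (cases "a = 0") auto

lemma iota_eq_iff [simp]: "\<iota> a = \<iota> b \<longleftrightarrow> a = b"
  using iota_eq_0_iff[of "a - b"] by (simp del: iota_eq_0_iff)

lemma iota_inverse [simp]: "\<iota> (inverse a) = inverse (\<iota> a)"
proof (cases "a = 0")
  case False
  have "\<iota> a * \<iota> (inverse a) = 1" by (metis iota(1,3) right_inverse False)
  then show ?thesis by (simp add: inverse_unique)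
qed simp

sublocale ds: finite_dimensional_vector_space "fscale \<iota>" Bd by (rule fd_D)
lemma d_pos: "d > 0"
proof (rule ccontr)
  assume "\<not> d > 0"
  then have "(UNIV :: 'a set) = {0}"
    using ds.dim_UNIV fd_D(2) ds.dim_eq_0[of UNIV] by auto
  then have "(1 :: 'a) = 0" by blast
  then show False by simp
qed

end

text \<open>The bases \<open>Bv\<close> and \<open>Bm\<close> are parameters because the
  finite-dimensional locale carries a basis; their existence is
  \<open>finite_dimensional_vscale\<close>.\<close>

locale division_algebra = central_algebra \<iota> d Bd
  for \<iota> :: "'f::field \<Rightarrow> 'a::division_ring" and d :: nat and Bd :: "'a set" +
  fixes Bv :: "('a^'n) set" and Bm :: "('a^'n^'n) set"
  assumes fd_vec: "finite_dimensional_vector_space (vscale \<iota>) Bv"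
    and fd_mat: "finite_dimensional_vector_space (fscale_mat \<iota>) Bm"
begin

sublocale vs: finite_dimensional_vector_space "vscale \<iota>" Bv by (rule fd_vec)
sublocale ms: finite_dimensional_vector_space "fscale_mat \<iota>" Bm by (rule fd_mat)
sublocale mv: finite_dimensional_vector_space_pair "fscale_mat \<iota>" Bm "vscale \<iota>" Bv by unfold_locales
sublocale dv: finite_dimensional_vector_space_pair "fscale \<iota>" Bd "vscale \<iota>" Bv by unfold_locales
sublocale vv: finite_dimensional_vector_space_pair "vscale \<iota>" Bv "vscale \<iota>" Bv by unfold_locales

lemma vscale_eq: "vscale \<iota> c X = X \<star> \<iota> c"
  by (simp add: vscale_def rscale_def iota_central)

lemma fscale_mat_mult_vec [simp]: "fscale_mat \<iota> c M *v X = (M *v X) \<star> \<iota> c"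
  by (simp add: fscale_mat_def fscale_def map_matrix_def matrix_vector_mult_def vec_eq_iff
      sum_distrib_left iota_central[symmetric] mult.assoc)

lemma linear_mult_vec: "Vector_Spaces.linear (vscale \<iota>) (vscale \<iota>) ((*v) (M :: 'a^'n^'n))"
  unfolding Vector_Spaces.linear_iff using vs.vector_space_axioms
  by (simp add: vscale_eq mv_distrib)

lemma linear_eval: "Vector_Spaces.linear (fscale_mat \<iota>) (vscale \<iota>) (\<lambda>M :: 'a^'n^'n. M *v X)"
  unfolding Vector_Spaces.linear_iff using vs.vector_space_axioms ms.vector_space_axioms
  by (simp add: vscale_eq mv_distrib)

lemma linear_rscale: "Vector_Spaces.linear (fscale \<iota>) (vscale \<iota>) ((\<star>) (X :: 'a^'n))"
  unfolding Vector_Spaces.linear_iff using vs.vector_space_axioms ds.vector_space_axioms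
  by (simp add: vscale_eq rscale_add_right fscale_def iota_central)

lemma subspace_right: "right_subspace W \<Longrightarrow> vs.subspace W"
  by (rule vs.subspaceI) (auto simp: vscale_eq right_subspaceD)

lemma dim_radjoin:
  assumes U: "right_subspace U" "x \<notin> U"
  shows "vs.dim (radjoin U x) = vs.dim U + d"
proof -
  interpret r: Vector_Spaces.linear "fscale \<iota>" "vscale \<iota>" "(\<star>) x" by (rule linear_rscale)
  have x: "x \<noteq> 0" using U right_subspaceD(1) by auto
  have "inj_on ((\<star>) x) (ds.span UNIV)"
    using x by (intro inj_onI) (metis r.diff right_minus_eq rscale_eq_0_iff)
  then have dx: "vs.dim (range ((\<star>) x)) = d"
    using dv.dim_image_eq[OF linear_rscale, of x UNIV] fd_D(2) by simp
  have "U \<inter> range ((\<star>) x) = {0}"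
  proof -
    have "a = 0" if "x \<star> a \<in> U" for a
      using right_subspaceD(3)[OF U(1) that, of "inverse a"] U(2) by (cases "a = 0") auto
    then show ?thesis using right_subspaceD(1)[OF U(1)] by (auto intro: image_eqI[where x = 0])
  qed
  moreover have "radjoin U x = {u + y |u y. u \<in> U \<and> y \<in> range ((\<star>) x)}"
    by (auto simp: radjoin_def)
  ultimately show ?thesis
    using vs.dim_sums_Int[OF subspace_right[OF U(1)] r.subspace_image[OF ds.subspace_UNIV]] dx
    by simp
qed

lemma dim_right_subspace_diff:
  assumes "right_subspace U" "right_subspace E" "U \<subseteq> E"
  shows "\<exists>k. vs.dim E = vs.dim U + k * d"
  using assms
proof (induction "vs.dim E - vs.dim U" arbitrary: U rule: less_induct)
  case less
  show ?case
  proof (cases "U = E")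
    case False
    then obtain x where x: "x \<in> E" "x \<notin> U" using less.prems by auto
    let ?U = "radjoin U x"
    have U: "right_subspace ?U" "?U \<subseteq> E"
      using less.prems x by (simp_all add: right_subspace_radjoin radjoin_subset)
    have dU: "vs.dim ?U = vs.dim U + d" by (rule dim_radjoin) (use less.prems x in auto)
    have "vs.dim ?U \<le> vs.dim E" by (rule vs.dim_subset[OF U(2)])
    then have "\<exists>k. vs.dim E = vs.dim ?U + k * d"
      using less.hyps[of ?U] U less.prems dU d_pos by auto
    then obtain k where "vs.dim E = vs.dim ?U + k * d" by blast
    then have "vs.dim E = vs.dim U + Suc k * d" using dU by simp
    then show ?thesis by blast
  qed (auto intro: exI[of _ 0])
qed

lemma subspace_matrices:
  assumes "ms.subspace V" "\<And>i. i \<in> I \<Longrightarrow> vs.subspace (W i)"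
  shows "ms.subspace {M \<in> V. \<forall>i\<in>I. M *v x i \<in> W i}"
proof (rule ms.subspaceI)
  show "0 \<in> {M \<in> V. \<forall>i\<in>I. M *v x i \<in> W i}"
    using ms.subspace_0[OF assms(1)] vs.subspace_0[OF assms(2)] by simp
qed (use ms.subspace_add[OF assms(1)] ms.subspace_scale[OF assms(1)] vs.subspace_add[OF assms(2)]
    vs.subspace_scale[OF assms(2)] in \<open>auto simp: mv_distrib vscale_eq\<close>)

lemma subspace_matrices_into:
  assumes "ms.subspace V" "right_subspace W"
  shows "ms.subspace {M \<in> V. \<forall>X\<in>E. M *v X \<in> W}"
  using subspace_matrices[OF assms(1), of E "\<lambda>_. W" "\<lambda>X. X"] subspace_right[OF assms(2)] by simp

lemma subspace_matrices_at:
  assumes "ms.subspace V" "right_subspace W"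
  shows "ms.subspace {M \<in> V. M *v x \<in> W}"
  using subspace_matrices[OF assms(1), of "{x}" "\<lambda>_. W" "\<lambda>X. X"] subspace_right[OF assms(2)] by simp

lemma subspace_matrices_kill:
  assumes "ms.subspace V"
  shows "ms.subspace (stab V x)"
  using subspace_matrices_at[OF assms right_subspace_0, of x] by simp

lemma eval_rank_nullity:
  assumes "ms.subspace V"
  shows "ms.dim V = vs.dim ((\<lambda>M. M *v x) ` V) + ms.dim (stab V x)"
  by (rule mv.rank_nullity[OF linear_eval assms])

lemma subspace_eval: "ms.subspace V \<Longrightarrow> vs.subspace ((\<lambda>M. M *v x) ` V)"
  using module_hom.subspace_image[of "fscale_mat \<iota>" "vscale \<iota>" "\<lambda>M. M *v x" V] linear_eval
  by (simp add: module_hom_iff_linear)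

text \<open>Evaluation at each of \<open>q\<close> vectors that complete \<open>Z\<close> to
  \<open>L\<close> costs at most \<open>vs.dim W\<close>. What survives vanishes on \<open>L\<close>
  but may be nonzero elsewhere, hence the last term.\<close>

lemma hom_dim_le:
  assumes "right_subspace Z" "right_subspace L" "Z \<subseteq> L" "vs.dim L = vs.dim Z + q * d"
    and "right_subspace W" "ms.subspace K"
    and "\<And>M X. M \<in> K \<Longrightarrow> X \<in> Z \<Longrightarrow> M *v X = 0"
    and "\<And>M X. M \<in> K \<Longrightarrow> X \<in> L \<Longrightarrow> M *v X \<in> W"
  shows "ms.dim K \<le> vs.dim W * q + ms.dim (ann K L)"
  using assms
proof (induction q arbitrary: Z K)
  case 0
  then have "Z = L"
    by (intro vs.subspace_dim_equal) (auto simp: subspace_right)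
  then have "ann K L = K" using 0 by auto
  then show ?case by simp
next
  case (Suc q)
  have "Z \<noteq> L" using Suc.prems(4) d_pos by auto
  then obtain y where y: "y \<in> L" "y \<notin> Z" using Suc.prems by auto
  let ?Z = "radjoin Z y" and ?K = "stab K y"
  have "ms.dim ?K \<le> vs.dim W * q + ms.dim (ann ?K L)"
  proof (rule Suc.IH)
    show "vs.dim L = vs.dim ?Z + q * d" using dim_radjoin[of Z y] Suc.prems y by simp
    show "ms.subspace ?K" by (rule subspace_matrices_kill) fact
    show "M *v X = 0" if "M \<in> ?K" "X \<in> ?Z" for M X
      using that Suc.prems(7)[of M] by (auto simp: radjoin_def mv_distrib)
  qed (use Suc.prems y in \<open>simp_all add: right_subspace_radjoin radjoin_subset\<close>)
  moreover have "ann ?K L = ann K L" using y by auto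
  moreover have "vs.dim ((\<lambda>M. M *v y) ` K) \<le> vs.dim W"
    using Suc.prems y by (intro vs.dim_subset) auto
  ultimately show ?case using eval_rank_nullity[OF Suc.prems(6), of y] by simp
qed

section \<open>Trivial spectrum modulo a subspace, and generic vectors\<close>

definition acts_on :: "('a^'n^'n) set \<Rightarrow> ('a^'n) set \<Rightarrow> bool" where
  "acts_on V E \<longleftrightarrow> (\<forall>M\<in>V. \<forall>X\<in>E. M *v X \<in> E)"

text \<open>Eigenvalue 1 is excluded on the quotient of \<open>E\<close> by \<open>U\<close> without
  forming the quotient; \<open>U = {0}\<close> gives the original condition on
  \<open>E\<close>.\<close>

definition trivial_spectrum_mod :: "('a^'n^'n) set \<Rightarrow> ('a^'n) set \<Rightarrow> ('a^'n) set \<Rightarrow> bool" where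
  "trivial_spectrum_mod V U E \<longleftrightarrow> (\<forall>M\<in>V. \<forall>X\<in>E. M *v X - X \<in> U \<longrightarrow> X \<in> U)"

text \<open>The orbit of \<open>x\<close> modulo \<open>U\<close> is a subspace that misses
  \<open>x\<close> itself, hence is proper in the quotient.\<close>

lemma eval_mod_dim:
  fixes Q :: "'a^'n \<Rightarrow> 'a^'n"
  assumes U: "right_subspace U" "right_subspace E" "U \<subseteq> E" "vs.dim E = vs.dim U + k * d"
    and V: "ms.subspace V" "acts_on V E" "trivial_spectrum_mod V U E"
    and x: "x \<in> E" "x \<notin> U"
    and Q: "Vector_Spaces.linear (vscale \<iota>) (vscale \<iota>) Q" "\<And>x. Q x = 0 \<longleftrightarrow> x \<in> U"
  shows "vs.dim ((\<lambda>M. Q (M *v x)) ` V) + 1 \<le> k * d"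
proof -
  interpret Q: Vector_Spaces.linear "vscale \<iota>" "vscale \<iota>" Q by (rule Q)
  interpret ev: Vector_Spaces.linear "fscale_mat \<iota>" "vscale \<iota>" "\<lambda>M :: 'a^'n^'n. M *v x" by (rule linear_eval)
  have E: "vs.subspace E" by (rule subspace_right) fact
  have "{x \<in> E. Q x = 0} = U" using U(3) by (auto simp: Q(2))
  then have QE: "vs.dim (Q ` E) = k * d" using vv.rank_nullity[OF Q(1) E] U(4) by simp
  have im: "(\<lambda>M. Q (M *v x)) ` V = Q ` (\<lambda>M. M *v x) ` V" by auto
  have "vs.subspace ((\<lambda>M. Q (M *v x)) ` V)"
    unfolding im by (intro Q.subspace_image ev.subspace_image V)
  moreover have "(\<lambda>M. Q (M *v x)) ` V \<subseteq> Q ` E" using V(2) x by (auto simp: acts_on_def)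
  moreover have "Q x \<notin> (\<lambda>M. Q (M *v x)) ` V"
  proof
    assume "Q x \<in> (\<lambda>M. Q (M *v x)) ` V"
    then obtain M where "M \<in> V" "Q (M *v x - x) = 0" by (auto simp: Q.diff)
    then show False using V(3) x Q(2) by (auto simp: trivial_spectrum_mod_def)
  qed
  ultimately show ?thesis using vs.dim_less_if_not_in[of _ "Q ` E" "Q x"] x QE by auto
qed

text \<open>Records only the consequence of maximal rank that later arguments use: a value attained
  modulo \<open>U\<close> at \<open>x + y t\<close> for every nonzero \<open>t\<close>, and at the
  point \<open>y\<close> at infinity, is attained at \<open>x\<close>.\<close>

definition generic_vector :: "('a^'n^'n) set \<Rightarrow> ('a^'n) set \<Rightarrow> ('a^'n) set \<Rightarrow> 'a^'n \<Rightarrow> bool" where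
  "generic_vector V U E x \<longleftrightarrow> x \<in> E \<and> x \<notin> U \<and>
     (\<forall>y\<in>E. \<forall>z. (\<forall>t. t \<noteq> 0 \<longrightarrow> (\<exists>M\<in>V. z - M *v (x + y \<star> \<iota> t) \<in> U)) \<and> (\<exists>M\<in>V. z - M *v y \<in> U) \<longrightarrow>
        (\<exists>M\<in>V. z - M *v x \<in> U))"

text \<open>A vector whose orbit under \<open>V\<close> has the greatest dimension modulo \<open>U\<close> is generic.\<close>

lemma generic_vector_exists:
  fixes T :: "'f set"
  assumes U: "right_subspace U" "right_subspace E" "U \<subseteq> E" "U \<noteq> E" "vs.dim E = vs.dim U + k * d"
    and V: "ms.subspace V" "acts_on V E" "acts_on V U" "trivial_spectrum_mod V U E"
    and T: "finite T" "k * d \<le> card T"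
  shows "\<exists>x. generic_vector V U E x"
proof -
  obtain Q :: "'a^'n \<Rightarrow> 'a^'n" where Q: "Vector_Spaces.linear (vscale \<iota>) (vscale \<iota>) Q" "\<And>x. Q x = 0 \<longleftrightarrow> x \<in> U"
    using vs.linear_exists_kernel[OF subspace_right[OF U(1)]] by blast
  interpret Q: Vector_Spaces.linear "vscale \<iota>" "vscale \<iota>" Q by (rule Q)
  define r where "r = (\<lambda>x. vs.dim ((\<lambda>M. Q (M *v x)) ` V))"
  obtain x0 where "x0 \<in> E \<and> x0 \<notin> U" using U by auto
  moreover have "\<forall>y. y \<in> E \<and> y \<notin> U \<longrightarrow> r y < Suc vs.dimension"
    using vs.dim_subset_UNIV by (auto simp: r_def less_Suc_eq_le)
  ultimately obtain x where x: "x \<in> E" "x \<notin> U" and max: "\<And>y. y \<in> E \<Longrightarrow> y \<notin> U \<Longrightarrow> r y \<le> r x"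
    using ex_has_greatest_nat[of "\<lambda>y. y \<in> E \<and> y \<notin> U" x0 r "Suc vs.dimension"] by blast
  \<comment> \<open>Points of the line \<open>x + y t\<close> may fall into \<open>U\<close>; since
    their rank is 0, \<open>r x\<close> is maximal on all of \<open>E\<close>.\<close>
  have r0: "r y = 0" if "y \<in> U" for y
  proof -
    have "(\<lambda>M. Q (M *v y)) ` V \<subseteq> {0}" using V(3) that by (auto simp: Q(2) acts_on_def)
    then show ?thesis by (simp add: r_def)
  qed
  have max: "r y \<le> r x" if "y \<in> E" for y using max[OF that] r0[of y] by (cases "y \<in> U") auto
  \<comment> \<open>The rank is at most \<open>k * d - 1\<close> because the orbit misses
    \<open>x\<close>; this is the exact bound that the pencil lemma asks of
    \<open>T\<close>.\<close>
  have rk: "r x < card T" using eval_mod_dim[OF U(1-3,5) V(1,2,4) x Q] T by (simp add: r_def)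
  have "\<exists>M\<in>V. z - M *v x \<in> U"
    if y: "y \<in> E" and z: "\<And>t. t \<noteq> 0 \<Longrightarrow> \<exists>M\<in>V. z - M *v (x + y \<star> \<iota> t) \<in> U" "\<exists>M\<in>V. z - M *v y \<in> U" for y z
  proof -
    have lin: "Vector_Spaces.linear (fscale_mat \<iota>) (vscale \<iota>) (\<lambda>M :: 'a^'n^'n. Q (M *v w))" for w
      using Vector_Spaces.linear_compose[OF linear_eval Q(1), of w] by (simp add: comp_def)
    have eq: "Q (M *v x) + vscale \<iota> t (Q (M *v y)) = Q (M *v (x + y \<star> \<iota> t))" for M t
    proof -
      have "M *v (x + y \<star> \<iota> t) = M *v x + vscale \<iota> t (M *v y)"
        by (simp add: mv_distrib vscale_eq)
      then show ?thesis by (simp only: Q.add Q.scale)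
    qed
    have mem: "Q z \<in> (\<lambda>M. Q (M *v w)) ` V" if w: "\<exists>M\<in>V. z - M *v w \<in> U" for w
    proof -
      obtain M where "M \<in> V" "z - M *v w \<in> U" using w by blast
      then show ?thesis using Q(2)[of "z - M *v w"] by (auto simp: Q.diff intro!: image_eqI[where x = M])
    qed
    have "Q z \<in> (\<lambda>M. Q (M *v x)) ` V"
    proof (rule mv.pencil_image_closed[OF lin lin V(1)])
      show "vs.dim ((\<lambda>M. Q (M *v x) + vscale \<iota> t (Q (M *v y))) ` V) \<le> vs.dim ((\<lambda>M. Q (M *v x)) ` V)" for t
        unfolding eq using max[of "x + y \<star> \<iota> t"] x y right_subspaceD[OF U(2)] by (simp add: r_def)
      show "vs.dim ((\<lambda>M. Q (M *v y)) ` V) \<le> vs.dim ((\<lambda>M. Q (M *v x)) ` V)"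
        using max[OF y] by (simp add: r_def)
      show "vs.dim ((\<lambda>M. Q (M *v x)) ` V) < card T" using rk by (simp add: r_def)
      show "Q z \<in> (\<lambda>M. Q (M *v x) + vscale \<iota> t (Q (M *v y))) ` V" if "t \<noteq> 0" for t
        unfolding eq by (rule mem[OF z(1)[OF that]])
      show "Q z \<in> (\<lambda>M. Q (M *v y)) ` V" by (rule mem[OF z(2)])
    qed (rule T(1))
    then obtain M where "M \<in> V" "Q (z - M *v x) = 0" by (auto simp: Q.diff)
    then show ?thesis using Q(2) by blast
  qed
  then show ?thesis using x unfolding generic_vector_def by blast
qed

text \<open>Since \<open>N x\<close> vanishes modulo \<open>U\<close>, the element
  \<open>N / t\<close> attains \<open>N y\<close> at \<open>x + y t\<close>, and \<open>N\<close>
  itself attains it at \<open>y\<close>.\<close>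

lemma generic_vector_kernel:
  assumes U: "right_subspace U" and V: "ms.subspace V" and x: "generic_vector V U E x"
    and N: "N \<in> V" "N *v x \<in> U" and y: "y \<in> E"
  shows "\<exists>M\<in>V. N *v y - M *v x \<in> U"
proof -
  have "\<exists>M\<in>V. N *v y - M *v (x + y \<star> \<iota> t) \<in> U" if "t \<noteq> 0" for t
  proof
    show "fscale_mat \<iota> (inverse t) N \<in> V" by (rule ms.subspace_scale[OF V N(1)])
    show "N *v y - fscale_mat \<iota> (inverse t) N *v (x + y \<star> \<iota> t) \<in> U"
      using right_subspaceD(3,4)[OF U] N(2) that by (simp add: mv_distrib)
  qed
  moreover have "\<exists>M\<in>V. N *v y - M *v y \<in> U" using N right_subspaceD[OF U] by force
  ultimately show ?thesis using x y unfolding generic_vector_def by blast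
qed

lemma eval_mod_dim_le:
  assumes U: "right_subspace U" "right_subspace E" "U \<subseteq> E" "vs.dim E = vs.dim U + k * d"
    and V: "ms.subspace V" "acts_on V E" "trivial_spectrum_mod V U E"
    and x: "x \<in> E" "x \<notin> U"
  shows "ms.dim V \<le> k * d - 1 + ms.dim {M \<in> V. M *v x \<in> U}"
proof -
  obtain Q :: "'a^'n \<Rightarrow> 'a^'n" where Q: "Vector_Spaces.linear (vscale \<iota>) (vscale \<iota>) Q" "\<And>x. Q x = 0 \<longleftrightarrow> x \<in> U"
    using vs.linear_exists_kernel[OF subspace_right[OF U(1)]] by blast
  have "Vector_Spaces.linear (fscale_mat \<iota>) (vscale \<iota>) (\<lambda>M :: 'a^'n^'n. Q (M *v x))"
    using Vector_Spaces.linear_compose[OF linear_eval Q(1), of x] by (simp add: comp_def)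
  from mv.rank_nullity[OF this V(1)] show ?thesis
    using eval_mod_dim[OF U V x Q] by (simp add: Q(2))
qed

text \<open>What the induction needs to replace \<open>U\<close> by \<open>U + x D\<close>. A vector
  fixed modulo \<open>U + x D\<close> is corrected by a multiple of \<open>x\<close> to one fixed
  modulo \<open>U\<close>. If \<open>M X\<close> had a nonzero \<open>x\<close>-component, rescaling
  \<open>X\<close> and \<open>generic_vector_kernel\<close> would yield an element of
  \<open>V\<close> that fixes \<open>x\<close> modulo \<open>U\<close>.\<close>

lemma generic_vector_radjoin:
  assumes U: "right_subspace U" and E: "right_subspace E" and V: "ms.subspace V"
    and act: "acts_on V U" and ts: "trivial_spectrum_mod V U E" and gen: "generic_vector V U E x"
  shows "acts_on {M \<in> V. M *v x \<in> U} (radjoin U x)"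
    and "trivial_spectrum_mod {M \<in> V. M *v x \<in> U} (radjoin U x) E"
    and "{M \<in> V. M *v x \<in> U \<and> (\<forall>X\<in>E. M *v X \<in> radjoin U x)} \<subseteq> {M \<in> V. \<forall>X\<in>E. M *v X \<in> U}"
proof -
  let ?V = "{M \<in> V. M *v x \<in> U}" and ?U = "radjoin U x"
  have x: "x \<in> E" "x \<notin> U" using gen by (auto simp: generic_vector_def)
  have mul: "M *v (u + x \<star> a) \<in> U" if "M \<in> ?V" "u \<in> U" for M u a
    using that act right_subspaceD[OF U]
    by (auto simp: mv_distrib acts_on_def)
  show "acts_on ?V ?U"
    unfolding acts_on_def using mul subset_radjoin[of U x] by (auto elim!: radjoinE)
  show "trivial_spectrum_mod ?V ?U E"
    unfolding trivial_spectrum_mod_def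
  proof (intro ballI impI)
    fix M X assume M: "M \<in> ?V" and X: "X \<in> E" and "M *v X - X \<in> ?U"
    then obtain u a where u: "u \<in> U" "M *v X - X = u + x \<star> a" by (auto elim: radjoinE)
    let ?Y = "X + x \<star> a"
    have "M *v ?Y - ?Y = (M *v X - X - x \<star> a) + M *v (0 + x \<star> a)"
      by (simp add: mv_distrib del: matrix_vector_mult_rscale)
    also have "\<dots> = u + M *v (0 + x \<star> a)" using u by simp
    also have "\<dots> \<in> U" using mul[OF M, of 0 a] right_subspaceD[OF U] u by blast
    finally have "?Y \<in> U"
      using ts M X x right_subspaceD[OF E] unfolding trivial_spectrum_mod_def by blast
    then show "X \<in> ?U" using radjoinI[of ?Y U x "- a"] by simp
  qed
  show "{M \<in> V. M *v x \<in> U \<and> (\<forall>X\<in>E. M *v X \<in> ?U)} \<subseteq> {M \<in> V. \<forall>X\<in>E. M *v X \<in> U}"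
  proof clarify
    fix M X assume M: "M \<in> V" "M *v x \<in> U" "\<forall>X\<in>E. M *v X \<in> ?U" and X: "X \<in> E"
    have "M *v X \<in> ?U" using M(3) X by blast
    then obtain u a where u: "u \<in> U" "M *v X = u + x \<star> a" by (rule radjoinE)
    have "a = 0"
    proof (rule ccontr)
      assume a: "a \<noteq> 0"
      let ?Y = "X \<star> inverse a"
      have "M *v ?Y = u \<star> inverse a + x" using u a by simp
      moreover obtain M' where M': "M' \<in> V" "M *v ?Y - M' *v x \<in> U"
        using generic_vector_kernel[OF U V gen M(1,2), of ?Y] X right_subspaceD[OF E] by blast
      moreover have "u \<star> inverse a \<in> U" using u right_subspaceD[OF U] by blast
      moreover have "M' *v x - x = u \<star> inverse a - (u \<star> inverse a + x - M' *v x)" by simp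
      ultimately have "M' *v x - x \<in> U" using right_subspaceD(5)[OF U] by metis
      then show False using ts M'(1) x by (auto simp: trivial_spectrum_mod_def)
    qed
    then show "M *v X \<in> U" using u by simp
  qed
qed

text \<open>The flag grows from below: \<open>U\<close> absorbs a generic vector while
  \<open>E\<close> stays. The last term counts operators that are zero on the quotient, and the
  third part of \<open>generic_vector_radjoin\<close> keeps it from growing.\<close>

theorem trivial_spectrum_dim_le:
  fixes T :: "'f set"
  assumes "right_subspace U" "right_subspace E" "U \<subseteq> E" "vs.dim E = vs.dim U + k * d"
    and "ms.subspace V" "acts_on V E" "acts_on V U" "trivial_spectrum_mod V U E"
    and "finite T" "k * d \<le> card T"
  shows "ms.dim V \<le> opt_dim d k + ms.dim {M \<in> V. \<forall>X\<in>E. M *v X \<in> U}"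
  using assms
proof (induction k arbitrary: U V)
  case 0
  then have "U = E"
    by (intro vs.subspace_dim_equal) (auto simp: subspace_right)
  then have "{M \<in> V. \<forall>X\<in>E. M *v X \<in> U} = V" using 0 by (auto simp: acts_on_def)
  then show ?case by simp
next
  case (Suc k)
  note U = Suc.prems(1) and E = Suc.prems(2) and V = Suc.prems(5)
  have "U \<noteq> E" using Suc.prems(4) d_pos by auto
  then obtain x where gen: "generic_vector V U E x"
    using generic_vector_exists[OF Suc.prems(1-3) _ Suc.prems(4-10)] by blast
  then have x: "x \<in> E" "x \<notin> U" by (auto simp: generic_vector_def)
  let ?V = "{M \<in> V. M *v x \<in> U}" and ?U = "radjoin U x"
  note step = generic_vector_radjoin[OF U E V Suc.prems(7,8) gen]
  have "ms.dim ?V \<le> opt_dim d k + ms.dim {M \<in> ?V. \<forall>X\<in>E. M *v X \<in> ?U}"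
  proof (rule Suc.IH)
    show "right_subspace ?U" by (rule right_subspace_radjoin[OF U])
    show "?U \<subseteq> E" by (rule radjoin_subset) (use Suc.prems x in auto)
    show "vs.dim E = vs.dim ?U + k * d" using dim_radjoin[OF U x(2)] Suc.prems(4) by simp
    show "ms.subspace ?V" by (rule subspace_matrices_at[OF V U])
    show "acts_on ?V E" using Suc.prems by (auto simp: acts_on_def)
  qed (use Suc.prems step in auto)
  moreover have "ms.dim {M \<in> ?V. \<forall>X\<in>E. M *v X \<in> ?U} \<le> ms.dim {M \<in> V. \<forall>X\<in>E. M *v X \<in> U}"
    using step(3) by (intro ms.dim_subset) auto
  moreover have "ms.dim V \<le> Suc k * d - 1 + ms.dim ?V"
    by (rule eval_mod_dim_le[OF Suc.prems(1-6,8) x])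
  ultimately show ?case by simp
qed

end

subsection \<open>Optimal spaces\<close>

context division_algebra
begin

definition irreducible_on :: "('a^'n^'n) set \<Rightarrow> ('a^'n) set \<Rightarrow> bool" where
  "irreducible_on V E \<longleftrightarrow>
     (\<forall>W. right_subspace W \<and> W \<subseteq> E \<and> acts_on V W \<longrightarrow> W = {0} \<or> W = E)"

lemma acts_on_mono: "acts_on V E \<Longrightarrow> V' \<subseteq> V \<Longrightarrow> acts_on V' E"
  by (auto simp: acts_on_def)

lemma trivial_spectrum_mod_mono:
  "trivial_spectrum_mod V {0} E \<Longrightarrow> V' \<subseteq> V \<Longrightarrow> E' \<subseteq> E \<Longrightarrow> trivial_spectrum_mod V' {0} E'"
  by (auto simp: trivial_spectrum_mod_def)

lemma one_minus_bij:
  assumes E: "right_subspace E" and V: "acts_on V E" "trivial_spectrum_mod V {0} E" and M: "M \<in> V"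
  shows "(\<lambda>X. X - M *v X) ` E = E"
proof (rule vs.linear_injective_on_imp_surjective)
  show "Vector_Spaces.linear (vscale \<iota>) (vscale \<iota>) (\<lambda>X. X - M *v X)"
    unfolding Vector_Spaces.linear_iff using vs.vector_space_axioms
    by (simp add: vscale_eq mv_distrib algebra_simps)
  show "vs.subspace E" by (rule subspace_right[OF E])
  show "(\<lambda>X. X - M *v X) ` E \<subseteq> E" using V(1) M right_subspaceD[OF E] by (auto simp: acts_on_def)
  show "X = 0" if "X \<in> E" "X - M *v X = 0" for X
    using V(2) M that by (auto simp: trivial_spectrum_mod_def)
qed

text \<open>By surjectivity of \<open>1 - M\<close> on \<open>W\<close>, a vector fixed modulo
  \<open>W\<close> differs from a truly fixed vector, which is 0, by an element of
  \<open>W\<close>.\<close>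

lemma trivial_spectrum_mod_quotient:
  assumes W: "right_subspace W" "W \<subseteq> E" and E: "right_subspace E"
    and V: "acts_on V W" "trivial_spectrum_mod V {0} E"
  shows "trivial_spectrum_mod V W E"
  unfolding trivial_spectrum_mod_def
proof (intro ballI impI)
  fix M X assume M: "M \<in> V" and X: "X \<in> E" "M *v X - X \<in> W"
  have "trivial_spectrum_mod V {0} W" by (rule trivial_spectrum_mod_mono[OF V(2) order_refl W(2)])
  then have "(\<lambda>X. X - M *v X) ` W = W" by (rule one_minus_bij[OF W(1) V(1) _ M])
  moreover have "X - M *v X \<in> W" using right_subspaceD(4)[OF W(1) X(2)] by simp
  ultimately obtain Y where Y: "Y \<in> W" "X - M *v X = Y - M *v Y" by (auto simp: image_iff set_eq_iff)
  have "M *v (X - Y) - (X - Y) = 0" using Y(2) by (simp add: mv_diff_distrib algebra_simps)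
  moreover have "X - Y \<in> E" using X Y W right_subspaceD(5)[OF E] by blast
  ultimately have "X - Y = 0" using V(2) M unfolding trivial_spectrum_mod_def by blast
  then show "X \<in> W" using Y by simp
qed

text \<open>A proper invariant subspace \<open>W\<close> of \<open>L\<close> forces \<open>K\<close> below to contain all operators of \<open>L\<close>
  that vanish on \<open>W\<close> and map into \<open>W\<close>, so that \<open>(1 - M)\<inverse>\<close> maps \<open>W\<close> into \<open>W + x D\<close> for all \<open>M\<close>;
  comparing \<open>M u\<close> and \<open>M\<^sup>2 u\<close> then shows that \<open>W\<close> or \<open>W + x D\<close> is invariant under \<open>V\<close>.\<close>

lemma irreducible_on_complement:
  fixes T :: "'f set"
  assumes V: "ms.subspace V" "acts_on V E" "trivial_spectrum_mod V {0} E" "irreducible_on V E"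
    and E: "right_subspace E" "E = radjoin L x"
    and L: "right_subspace L" "x \<notin> L" "vs.dim L = k * d"
    and Vx: "Vx = stab V x" "acts_on Vx L"
    and dimVx: "opt_dim d k + ms.dim (ann Vx L) \<le> ms.dim Vx"
    and T: "finite T" "Suc k * d \<le> card T"
  shows "irreducible_on Vx L"
proof (rule ccontr)
  assume "\<not> irreducible_on Vx L"
  then obtain W where W: "right_subspace W" "W \<subseteq> L" "acts_on Vx W" "W \<noteq> {0}" "W \<noteq> L"
    by (auto simp: irreducible_on_def)
  have LE: "L \<subseteq> E" unfolding E by (rule subset_radjoin)
  have xE: "x \<in> E" unfolding E by (rule mem_radjoin[OF L(1)])
  have sVx: "ms.subspace Vx" unfolding Vx by (rule subspace_matrices_kill[OF V(1)])
  have VxV: "Vx \<subseteq> V" by (auto simp: Vx)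
  have tsL: "trivial_spectrum_mod Vx {0} L" by (rule trivial_spectrum_mod_mono[OF V(3) VxV LE])
  obtain p where p: "vs.dim W = p * d"
    using dim_right_subspace_diff[OF right_subspace_0 W(1)] right_subspaceD(1)[OF W(1)] by auto
  obtain q where q: "vs.dim L = vs.dim W + q * d"
    using dim_right_subspace_diff[OF W(1) L(1) W(2)] by auto
  have k: "k = p + q" using p q L(3) d_pos by (auto simp: add_mult_distrib[symmetric])
  have "q \<noteq> 0"
    using q W(5) vs.subspace_dim_equal[OF subspace_right[OF W(1)] subspace_right[OF L(1)] W(2)]
    by auto
  then obtain q' where q': "q = Suc q'" by (cases q) auto
  define K1 where "K1 = {M \<in> Vx. \<forall>X\<in>L. M *v X \<in> W}"
  define K where "K = ann K1 W"
  let ?K0 = "ann Vx L"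
  have "q * d \<le> card T" "p * d \<le> card T"
    using T(2) unfolding k by (auto simp: algebra_simps)
  note Tq = T(1) this
  have sK1: "ms.subspace K1" unfolding K1_def by (rule subspace_matrices_into[OF sVx W(1)])
  have sK: "ms.subspace K"
    unfolding K_def using subspace_matrices_into[OF sK1 right_subspace_0, of W] by simp
  have dK1: "ms.dim Vx \<le> opt_dim d q + ms.dim K1"
    unfolding K1_def
    by (rule trivial_spectrum_dim_le[OF W(1) L(1) W(2) q sVx Vx(2) W(3) _ Tq(1,2)])
      (rule trivial_spectrum_mod_quotient[OF W(1,2) L(1) W(3) tsL])
  have K1Vx: "K1 \<subseteq> Vx" by (auto simp: K1_def)
  have "ms.dim K1 \<le> opt_dim d p + ms.dim {M \<in> K1. \<forall>X\<in>W. M *v X \<in> {0}}"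
  proof (rule trivial_spectrum_dim_le[OF right_subspace_0 W(1) _ _ sK1 _ _ _ Tq(1,3)])
    show "acts_on K1 W" using W(3) K1Vx by (rule acts_on_mono)
    show "trivial_spectrum_mod K1 {0} W" by (rule trivial_spectrum_mod_mono[OF tsL K1Vx W(2)])
  qed (use right_subspaceD(1)[OF W(1)] p in \<open>auto simp: acts_on_def\<close>)
  \<comment> \<open>The actions on the quotient of \<open>L\<close> by \<open>W\<close> and on
    \<open>W\<close> account for at most \<open>opt_dim d q + opt_dim d p\<close>. The missing
    \<open>p * d * q\<close> must come from \<open>K\<close>; it is the dimension of all
    homomorphisms from that quotient to \<open>W\<close>.\<close>
  then have dK: "p * d * q + ms.dim ?K0 \<le> ms.dim K"
    using dK1 dimVx opt_dim_add[OF d_pos, of p q] by (simp add: K_def k)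
  \<comment> \<open>Elements of \<open>K\<close> that also kill \<open>y\<close> account for only
    \<open>q - 1\<close> copies of \<open>vs.dim W\<close>, so evaluation at \<open>y\<close> fills
    \<open>W\<close>.\<close>
  have onto: "\<exists>S\<in>K. S *v y = w" if y: "y \<in> L" "y \<notin> W" and w: "w \<in> W" for y w
  proof -
    let ?Ky = "stab K y" and ?I = "(\<lambda>M. M *v y) ` K"
    have "ms.dim ?Ky \<le> vs.dim W * q' + ms.dim (ann ?Ky L)"
    proof (rule hom_dim_le[OF right_subspace_radjoin[OF W(1)] L(1)])
      show "radjoin W y \<subseteq> L" by (rule radjoin_subset[OF L(1) W(2) y(1)])
      show "vs.dim L = vs.dim (radjoin W y) + q' * d" using dim_radjoin[OF W(1) y(2)] q q' by simp
      show "ms.subspace ?Ky" by (rule subspace_matrices_kill[OF sK])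
      show "M *v X = 0" if "M \<in> ?Ky" "X \<in> radjoin W y" for M X
        using that by (auto simp: radjoin_def mv_distrib K_def)
    qed (use W(1) in \<open>auto simp: K_def K1_def\<close>)
    moreover have "ms.dim (ann ?Ky L) \<le> ms.dim ?K0"
      by (rule ms.dim_subset) (auto simp: K_def K1_def)
    ultimately have "vs.dim W \<le> vs.dim ?I"
      using eval_rank_nullity[OF sK, of y] dK p q' by (simp add: algebra_simps)
    moreover have "?I \<subseteq> W" using y by (auto simp: K_def K1_def)
    ultimately have "?I = W"
      by (intro vs.subspace_dim_equal subspace_eval[OF sK] subspace_right[OF W(1)])
    then show ?thesis using w by auto
  qed
  let ?Z = "radjoin W x"
  have xW: "x \<notin> W" using W(2) L(2) by auto
  have Z: "right_subspace ?Z" by (rule right_subspace_radjoin[OF W(1)])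
  have WZ: "W \<subseteq> ?Z" by (rule subset_radjoin)
  have ZE: "?Z \<subseteq> E" by (rule radjoin_subset[OF E(1) _ xE]) (use W(2) LE in auto)
  have dE: "vs.dim E = Suc k * d" using dim_radjoin[OF L(1,2)] L(3) E(2) by simp
  have dZ: "vs.dim ?Z = Suc p * d" using dim_radjoin[OF W(1) xW] p by simp
  have dZT: "vs.dim ?Z < card T" using dZ T(2) k q' d_pos by (simp add: algebra_simps)
  have ZnE: "?Z \<noteq> E" using dZ dE k q' d_pos by (auto simp: algebra_simps)
  \<comment> \<open>Otherwise some \<open>S\<close> in \<open>K\<close> sends the
    \<open>L\<close>-component of \<open>Y\<close> to \<open>Y - M Y\<close> and kills
    \<open>x\<close>, so that \<open>M + S\<close> fixes \<open>Y\<close>.\<close>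
  have res: "Y \<in> ?Z" if M: "M \<in> V" and Y: "Y \<in> E" "Y - M *v Y \<in> W" for M Y
  proof (rule ccontr)
    assume nZ: "Y \<notin> ?Z"
    obtain y a where y: "y \<in> L" "Y = y + x \<star> a" using Y(1) E(2) by (auto elim: radjoinE)
    have "y \<notin> W" using nZ y radjoinI by auto
    then obtain S where S: "S \<in> K" "S *v y = Y - M *v Y" using onto y(1) Y(2) by blast
    then have "S \<in> V" "S *v x = 0" by (auto simp: K_def K1_def Vx)
    then have "(M + S) *v Y - Y = 0"
      using S(2) y(2) by (simp add: mv_distrib)
    moreover have "M + S \<in> V" by (rule ms.subspace_add[OF V(1) M \<open>S \<in> V\<close>])
    ultimately have "Y = 0" using V(3) Y(1) unfolding trivial_spectrum_mod_def by blast
    then show False using nZ right_subspaceD(1)[OF Z] by simp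
  qed
  \<comment> \<open>Applied to all multiples \<open>t M\<close>, \<open>res\<close> places the
    resolvent vectors of \<open>u\<close> in \<open>W + x D\<close>, as
    \<open>resolvent_orbit\<close> requires.\<close>
  have MW: "M *v u \<in> ?Z" "M *v (M *v u) \<in> ?Z" if M: "M \<in> V" and u: "u \<in> W" for M u
  proof -
    have "\<exists>Y\<in>E. Y - vscale \<iota> t (M *v Y) = u" for t
    proof -
      have "fscale_mat \<iota> t M \<in> V" by (rule ms.subspace_scale[OF V(1) M])
      then have "(\<lambda>Y. Y - fscale_mat \<iota> t M *v Y) ` E = E" by (rule one_minus_bij[OF E(1) V(2,3)])
      moreover have "u \<in> E" using u W(2) LE by auto
      ultimately have "u \<in> (\<lambda>Y. Y - fscale_mat \<iota> t M *v Y) ` E" by simp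
      then show ?thesis by (auto simp: vscale_eq)
    qed
    then obtain y where y: "\<And>t. y t \<in> E" "\<And>t. y t - vscale \<iota> t (M *v y t) = u" by metis
    have yZ: "y t \<in> ?Z" for t
    proof (rule res)
      show "fscale_mat \<iota> t M \<in> V" by (rule ms.subspace_scale[OF V(1) M])
    qed (use y[of t] u in \<open>auto simp: vscale_eq\<close>)
    have "M *v u \<in> ?Z \<and> M *v (M *v u) \<in> ?Z"
    proof (cases "u = 0")
      case True
      then show ?thesis using right_subspaceD(1)[OF Z] by simp
    next
      case False
      show ?thesis
        using vs.resolvent_orbit[OF linear_mult_vec subspace_right[OF Z] _ False yZ y(2) T(1) dZT]
          u WZ by blast
    qed
    then show "M *v u \<in> ?Z" "M *v (M *v u) \<in> ?Z" by auto
  qed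
  have "\<not> acts_on V W"
    using V(4) W L(2) xE LE unfolding irreducible_on_def by blast
  then obtain M0 w0 where M0: "M0 \<in> V" "w0 \<in> W" "M0 *v w0 \<notin> W" by (auto simp: acts_on_def)
  \<comment> \<open>If \<open>M w = w' + x a\<close> with \<open>a \<noteq> 0\<close>, then
    \<open>M x\<close> is recovered from \<open>M (M w)\<close> and \<open>M w'\<close>.\<close>
  have x1: "M *v x \<in> ?Z" if M: "M \<in> V" "w \<in> W" "M *v w \<notin> W" for M w
  proof -
    obtain w' a where w': "w' \<in> W" "M *v w = w' + x \<star> a" using MW(1)[OF M(1,2)] by (rule radjoinE)
    have a: "a \<noteq> 0" using w' M(3) by auto
    have "(M *v x) \<star> a = M *v (M *v w) - M *v w'"
      by (simp add: w'(2) mv_distrib)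
    also have "\<dots> \<in> ?Z" using MW M w' right_subspaceD(5)[OF Z] by blast
    finally show ?thesis using right_subspaceD(3)[OF Z, of "(M *v x) \<star> a" "inverse a"] a by simp
  qed
  \<comment> \<open>An \<open>M\<close> that keeps \<open>w0\<close> in \<open>W\<close> is compared
    with \<open>M + M0\<close>, which does not.\<close>
  have x2: "M *v x \<in> ?Z" if M: "M \<in> V" for M
  proof (cases "M *v w0 \<in> W")
    case True
    have "(M + M0) *v w0 \<notin> W"
    proof
      assume "(M + M0) *v w0 \<in> W"
      then have "(M + M0) *v w0 - M *v w0 \<in> W" using True right_subspaceD(5)[OF W(1)] by blast
      then show False using M0 by (simp add: mv_distrib)
    qed
    then have "(M + M0) *v x \<in> ?Z" using x1 M0 M ms.subspace_add[OF V(1)] by blast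
    then have "(M + M0) *v x - M0 *v x \<in> ?Z" using x1[OF M0] right_subspaceD(5)[OF Z] by blast
    then show ?thesis by (simp add: mv_distrib)
  qed (use x1 M M0 in blast)
  have "acts_on V ?Z"
    unfolding acts_on_def
  proof (intro ballI)
    fix M y assume M: "M \<in> V" and "y \<in> ?Z"
    then obtain w a where y: "w \<in> W" "y = w + x \<star> a" by (auto elim: radjoinE)
    show "M *v y \<in> ?Z"
      unfolding y(2) using MW(1)[OF M y(1)] x2[OF M] right_subspaceD[OF Z]
      by (simp add: mv_distrib)
  qed
  then have "?Z = {0}" using V(4) Z ZE ZnE unfolding irreducible_on_def by blast
  then show False using mem_radjoin[OF W(1), of x] xW right_subspaceD(1)[OF W(1)] by auto
qed

end

text \<open>The properties of an associated pair that are common to the four cases.\<close>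

locale standard_pair =
  fixes \<iota> :: "'f::field \<Rightarrow> 'a::division_ring" and \<sigma> :: "'a \<Rightarrow> 'a" and e :: "'a \<Rightarrow> 'f"
  assumes sigma_add: "\<sigma> (x + y) = \<sigma> x + \<sigma> y"
    and sigma_mult: "\<sigma> (x * y) = \<sigma> y * \<sigma> x"
    and sigma_sigma [simp]: "\<sigma> (\<sigma> x) = x"
    and sigma_iota [simp]: "\<sigma> (\<iota> c) = \<iota> c"
    and e_linear: "Vector_Spaces.linear (fscale \<iota>) (*) e"
    and e_sigma [simp]: "e (\<sigma> x) = e x"
    and e_commute: "e (x * y) = e (y * x)"
    and norm_ex: "\<exists>c. \<sigma> x * x = \<iota> c"
    and e_eq_0: "e x = 0 \<Longrightarrow> \<sigma> x = - x"
    and e_nonzero: "\<exists>x. e x \<noteq> 0"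

locale quadratic_algebra = division_algebra \<iota> d Bd Bv Bm + standard_pair \<iota> \<sigma> e
  for \<iota> :: "'f::field \<Rightarrow> 'a::division_ring" and d :: nat
    and Bd :: "'a set" and Bv :: "('a^'n) set" and Bm :: "('a^'n^'n) set"
    and \<sigma> :: "'a \<Rightarrow> 'a" and e :: "'a \<Rightarrow> 'f"
begin

section \<open>Trace form and norm of the division ring\<close>

lemma e_simps: "e (x + y) = e x + e y" "e (x - y) = e x - e y" "e (- x) = - e x" "e 0 = 0"
proof -
  interpret e: Vector_Spaces.linear "fscale \<iota>" "(*) :: 'f \<Rightarrow> 'f \<Rightarrow> 'f" e by (rule e_linear)
  show "e (x + y) = e x + e y" "e (x - y) = e x - e y" "e (- x) = - e x" "e 0 = 0"
    by (rule e.add e.diff e.neg e.zero)+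
qed

lemma e_scale [simp]: "e (\<iota> c * x) = c * e x" "e (x * \<iota> c) = c * e x" "e (x * (\<iota> c * y)) = c * e (x * y)"
proof -
  interpret e: Vector_Spaces.linear "fscale \<iota>" "(*) :: 'f \<Rightarrow> 'f \<Rightarrow> 'f" e by (rule e_linear)
  show *: "e (\<iota> c * x) = c * e x" for x using e.scale[of c x] by (simp add: fscale_def)
  show "e (x * \<iota> c) = c * e x" using *[of x] by (simp add: iota_central)
  have "x * (\<iota> c * y) = \<iota> c * (x * y)" using iota_central[of c x] by (metis mult.assoc)
  then show "e (x * (\<iota> c * y)) = c * e (x * y)" by (simp add: *)
qed

lemma sigma_0 [simp]: "\<sigma> 0 = 0" using sigma_iota[of 0] by simp

lemma sigma_1 [simp]: "\<sigma> 1 = 1" using sigma_iota[of 1] by simp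

lemma sigma_minus: "\<sigma> (- x) = - \<sigma> x"
  using sigma_add[of x "- x"] by (simp add: eq_neg_iff_add_eq_0 add.commute)

lemma sigma_diff: "\<sigma> (x - y) = \<sigma> x - \<sigma> y"
  using sigma_add[of x "- y"] by (simp add: sigma_minus)

lemma sigma_eq_0_iff [simp]: "\<sigma> x = 0 \<longleftrightarrow> x = 0"
  using sigma_sigma[of x] by (metis sigma_0)

text \<open>The square of \<open>x\<close> when the involution is trivial, otherwise the Galois norm
  or the reduced norm.\<close>

definition nrm :: "'a \<Rightarrow> 'f" where
  "nrm x = (THE c. \<sigma> x * x = \<iota> c)"

lemma nrm: "\<sigma> x * x = \<iota> (nrm x)"
proof -
  obtain c where c: "\<sigma> x * x = \<iota> c" using norm_ex by blast
  show ?thesis unfolding nrm_def by (rule theI2[of _ c]) (use c in auto)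
qed

lemma nrm_eq_0_iff [simp]: "nrm x = 0 \<longleftrightarrow> x = 0"
  using nrm[of x] by (metis iota_eq_0_iff mult_eq_0_iff sigma_eq_0_iff)

lemma nrm': "x * \<sigma> x = \<iota> (nrm x)"
proof (cases "x = 0")
  case False
  have "x * \<sigma> x * x = x * \<iota> (nrm x)" by (simp add: mult.assoc nrm)
  then have "x * \<sigma> x * x = \<iota> (nrm x) * x" by (simp add: iota_central)
  then show ?thesis using False by (metis mult_right_cancel)
qed simp

lemma nrm_eqI: "\<sigma> x * x = \<iota> c \<Longrightarrow> nrm x = c"
  by (simp add: nrm)

lemma nrm_mult: "nrm (x * y) = nrm x * nrm y"
proof (rule nrm_eqI)
  have "\<sigma> (x * y) * (x * y) = \<sigma> y * (\<sigma> x * x) * y" by (simp add: sigma_mult mult.assoc)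
  also have "\<dots> = \<iota> (nrm x) * (\<sigma> y * y)" unfolding nrm[of x] by (metis iota_central mult.assoc)
  finally show "\<sigma> (x * y) * (x * y) = \<iota> (nrm x * nrm y)" by (simp add: nrm)
qed

lemma nrm_iota: "nrm (\<iota> c) = c * c"
  and nrm_minus: "nrm (- x) = nrm x"
  and nrm_sigma: "nrm (\<sigma> x) = nrm x"
  by (rule nrm_eqI, simp add: sigma_minus nrm nrm')+

text \<open>Cyclic invariance of \<open>e\<close> brings \<open>x\<close> next to
  \<open>\<sigma> x\<close>, and their product is central.\<close>

lemma e_conj: "e (\<sigma> x * u * x) = nrm x * e u" "e (x * u * \<sigma> x) = nrm x * e u"
proof -
  have "e (\<sigma> x * u * x) = e (u * (x * \<sigma> x))" using e_commute[of "\<sigma> x" "u * x"] by (simp add: mult.assoc)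
  then show "e (\<sigma> x * u * x) = nrm x * e u" by (simp add: nrm')
  have "e (x * u * \<sigma> x) = e (u * (\<sigma> x * x))" using e_commute[of x "u * \<sigma> x"] by (simp add: mult.assoc)
  then show "e (x * u * \<sigma> x) = nrm x * e u" by (simp add: nrm)
qed

text \<open>A nonzero \<open>x\<close> is invertible, so \<open>x * y\<close> takes every value.
  Hence identities in D follow from identities between F-values with a free factor.\<close>

lemma e_nondeg:
  assumes "\<And>y. e (x * y) = 0"
  shows "x = 0"
proof (rule ccontr)
  assume "x \<noteq> 0"
  obtain z where "e z \<noteq> 0" using e_nonzero by blast
  then show False using assms[of "inverse x * z"] \<open>x \<noteq> 0\<close> by (simp add: mult.assoc[symmetric])
qed

lemma e_nondeg':
  assumes "\<And>y. e (y * x) = 0"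
  shows "x = 0"
  by (rule e_nondeg) (simp add: e_commute[of x] assms)

lemma e_eqI: "(\<And>y. e (x * y) = e (x' * y)) \<Longrightarrow> x = x'"
  using e_nondeg[of "x - x'"] by (simp add: left_diff_distrib e_simps)

lemma e_eqI': "(\<And>y. e (y * x) = e (y * x')) \<Longrightarrow> x = x'"
  using e_nondeg'[of "x - x'"] by (simp add: right_diff_distrib e_simps)

lemma linear_e_mult: "Vector_Spaces.linear (fscale \<iota>) (*) (\<lambda>m. e (b * m))"
  unfolding Vector_Spaces.linear_iff using ds.vector_space_axioms vector_space_over_itself.vector_space_axioms
  by (simp add: distrib_left e_simps fscale_def)

lemma dim_annihilator:
  assumes "finite B"
  shows "d \<le> ds.dim {m. \<forall>b\<in>B. e (b * m) = 0} + card B"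
  using assms
proof (induction B)
  case empty
  then show ?case using fd_D(2) by simp
next
  case (insert b B)
  interpret df: finite_dimensional_vector_space_pair "fscale \<iota>" Bd "(*) :: 'f \<Rightarrow> 'f \<Rightarrow> 'f" "{1}"
    by unfold_locales
  let ?A = "{m. \<forall>b\<in>B. e (b * m) = 0}"
  have A: "ds.subspace ?A"
    by (rule ds.subspaceI) (auto simp: e_simps distrib_left fscale_def)
  have "vector_space_over_itself.dim ((\<lambda>m. e (b * m)) ` ?A) \<le> 1" using vector_space_over_itself.dim_subset_UNIV by (simp add: vector_space_over_itself.dimension_def)
  moreover have "{m \<in> ?A. e (b * m) = 0} = {m. \<forall>b\<in>insert b B. e (b * m) = 0}" by auto
  ultimately show ?case using df.rank_nullity[OF linear_e_mult A, of b] insert by simp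
qed

text \<open>A basis of the kernel of a nonzero \<open>f\<close> has at most \<open>d - 1\<close>
  elements, each imposing one linear condition on \<open>m\<close>. A nonzero \<open>m\<close>
  survives, and \<open>e (x * m)\<close> is then a nonzero multiple of \<open>f x\<close>.\<close>

lemma functional_representation:
  assumes f: "Vector_Spaces.linear (fscale \<iota>) (*) f"
  shows "\<exists>m. \<forall>x. f x = e (x * m)"
proof (cases "\<forall>x. f x = 0")
  case True
  then show ?thesis by (intro exI[of _ 0]) (simp add: e_simps)
next
  case False
  interpret f: Vector_Spaces.linear "fscale \<iota>" "(*)" f by (rule f)
  obtain x0 where x0: "f x0 \<noteq> 0" using False by blast
  let ?H = "{x. f x = 0}"
  have H: "ds.subspace ?H" by (rule f.subspace_kernel)
  have "ds.dim ?H + 1 \<le> d"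
    using ds.dim_less_if_not_in[OF H, of UNIV x0] x0 fd_D(2) by simp
  obtain B where B: "B \<subseteq> ?H" "finite B" "card B = ds.dim ?H" "ds.span B = ?H"
    using ds.basis_subspace_exists[OF H] by metis
  let ?A = "{m. \<forall>b\<in>B. e (b * m) = 0}"
  have "ds.dim ?A \<noteq> 0" using dim_annihilator[OF B(2)] B(3) \<open>ds.dim ?H + 1 \<le> d\<close> by linarith
  then obtain m where m: "m \<noteq> 0" "\<forall>b\<in>B. e (b * m) = 0" by auto
  have lin: "Vector_Spaces.linear (fscale \<iota>) (*) (\<lambda>x. e (x * m))"
    unfolding Vector_Spaces.linear_iff using ds.vector_space_axioms vector_space_over_itself.vector_space_axioms
    by (simp add: distrib_right e_simps fscale_def mult.assoc)
  interpret em: Vector_Spaces.linear "fscale \<iota>" "(*)" "\<lambda>x. e (x * m)" by (rule lin)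
  have H0: "e (x * m) = 0" if "f x = 0" for x
    using em.eq_0_on_span[of B x] m(2) that unfolding B(4) by simp
  define g where "g = e (x0 * m) / f x0"
  have g: "e (x * m) = g * f x" for x
  proof -
    have "f (x - \<iota> (f x / f x0) * x0) = 0"
      using x0 f.scale[of "f x / f x0" x0] by (simp add: f.diff fscale_def)
    from H0[OF this] show ?thesis using x0
      by (simp add: left_diff_distrib e_simps mult.assoc g_def)
  qed
  have "g \<noteq> 0" using g e_nondeg'[of m] m(1) by auto
  then have "f x = e (x * (m * \<iota> (inverse g)))" for x
    using g[of x] by (simp add: mult.assoc[symmetric] del: iota_inverse)
  then show ?thesis by blast
qed

section \<open>Sesquilinear forms, and the hyperplane orbit of a generic vector\<close>

definition sesquilinear_on :: "('a^'n) set \<Rightarrow> ('a^'n \<Rightarrow> 'a^'n \<Rightarrow> 'a) \<Rightarrow> bool" where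
  "sesquilinear_on E b \<longleftrightarrow>
     (\<forall>X\<in>E. \<forall>X'\<in>E. \<forall>Y\<in>E. b (X + X') Y = b X Y + b X' Y) \<and>
     (\<forall>X\<in>E. \<forall>Y\<in>E. \<forall>Y'\<in>E. b X (Y + Y') = b X Y + b X Y') \<and>
     (\<forall>X\<in>E. \<forall>Y\<in>E. \<forall>a. b (X \<star> a) Y = \<sigma> a * b X Y \<and> b X (Y \<star> a) = b X Y * a)"

lemma sesquilinear_onD:
  assumes "sesquilinear_on E b"
  shows "X \<in> E \<Longrightarrow> X' \<in> E \<Longrightarrow> Y \<in> E \<Longrightarrow> b (X + X') Y = b X Y + b X' Y"
    and "X \<in> E \<Longrightarrow> Y \<in> E \<Longrightarrow> Y' \<in> E \<Longrightarrow> b X (Y + Y') = b X Y + b X Y'"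
    and "X \<in> E \<Longrightarrow> Y \<in> E \<Longrightarrow> b (X \<star> a) Y = \<sigma> a * b X Y"
    and "X \<in> E \<Longrightarrow> Y \<in> E \<Longrightarrow> b X (Y \<star> a) = b X Y * a"
  using assms unfolding sesquilinear_on_def by blast+

lemma sesquilinear_on_diff:
  assumes b: "sesquilinear_on E b" and E: "right_subspace E" and "X \<in> E" "Y \<in> E" "Y' \<in> E"
  shows "b X (Y - Y') = b X Y - b X Y'"
  using sesquilinear_onD(2)[OF b assms(3), of "Y - Y'" Y'] right_subspaceD(5)[OF E assms(4,5)] assms(5)
  by simp

lemma sesquilinear_on_0:
  assumes b: "sesquilinear_on E b" and E: "right_subspace E" and "X \<in> E"
  shows "b X 0 = 0" "b 0 X = 0"
  using sesquilinear_onD(3,4)[OF b, of 0 X 0] sesquilinear_onD(3,4)[OF b, of X 0 0] right_subspaceD(1)[OF E] assms(3)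
  by simp_all

definition nonisotropic_on :: "('a^'n) set \<Rightarrow> ('a^'n \<Rightarrow> 'a^'n \<Rightarrow> 'a) \<Rightarrow> bool" where
  "nonisotropic_on E b \<longleftrightarrow> (\<forall>X\<in>E. X \<noteq> 0 \<longrightarrow> e (b X X) \<noteq> 0)"

definition alternating_on :: "('a^'n) set \<Rightarrow> ('a^'n \<Rightarrow> 'a^'n \<Rightarrow> 'a) \<Rightarrow> ('a^'n^'n) set \<Rightarrow> bool" where
  "alternating_on E b V \<longleftrightarrow> (\<forall>M\<in>V. \<forall>X\<in>E. e (b X (M *v X)) = 0)"

lemma nonisotropic_onD:
  assumes "nonisotropic_on E b" "X \<in> E" "X \<noteq> 0"
  shows "e (b X X) \<noteq> 0" "b X X \<noteq> 0"
  using assms by (auto simp: nonisotropic_on_def e_simps)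

text \<open>The stabilizer of \<open>X\<close> maps \<open>E\<close> into the kernel
  \<open>L\<close> of \<open>b X\<close>, a complement of \<open>X D\<close>, so the dimension bound
  applies to it on \<open>L\<close>. By optimality the orbit of \<open>X\<close> fills the
  hyperplane where \<open>e (b X _)\<close> vanishes.\<close>

lemma alternating_transitive:
  fixes T :: "'f set"
  assumes V: "ms.subspace V" "acts_on V E" "trivial_spectrum_mod V {0} E"
    and E: "right_subspace E" "vs.dim E = k * d"
    and dimV: "opt_dim d k + ms.dim (ann V E) \<le> ms.dim V"
    and b: "sesquilinear_on E b" "nonisotropic_on E b" "alternating_on E b V"
    and T: "finite T" "k * d \<le> card T"
    and X: "X \<in> E" "X \<noteq> 0" and Y: "Y \<in> E" "e (b X Y) = 0"
  shows "\<exists>M\<in>V. M *v X = Y"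
proof -
  note bs = sesquilinear_onD[OF b(1)] and bXX = nonisotropic_onD[OF b(2) X] and rE = right_subspaceD[OF E(1)]
  define L where "L = {Z \<in> E. b X Z = 0}"
  have L: "right_subspace L" "L \<subseteq> E"
    unfolding right_subspace_iff L_def using rE X sesquilinear_on_0[OF b(1) E(1) X(1)] by (auto simp: bs)
  have XL: "X \<notin> L" using bXX by (simp add: L_def)
  have EL: "E = radjoin L X"
    unfolding L_def using X bXX rE
    by (intro radjoin_kernel[OF E(1)]) (simp_all add: sesquilinear_on_diff[OF b(1) E(1)] bs)
  have dL: "vs.dim E = vs.dim L + d" using dim_radjoin[OF L(1) XL] EL by simp
  then obtain k' where k: "k = Suc k'" using E(2) d_pos by (cases k) auto
  have dL: "vs.dim L = k' * d" using dL E(2) k by simp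
  let ?V = "stab V X"
  have into: "M *v Z \<in> L" if M: "M \<in> ?V" and Z: "Z \<in> E" for M Z
  proof -
    have MZ: "M *v Z \<in> E" using M Z V(2) by (auto simp: acts_on_def)
    have "e (y * b X (M *v Z)) = 0" for y
    proof -
      \<comment> \<open>The factor \<open>\<sigma> y\<close> becomes \<open>y\<close> in the
        semilinear argument, and \<open>M\<close> kills \<open>X\<close>: only the terms with
        \<open>b X (M Z)\<close> and \<open>b Z (M Z)\<close> remain.\<close>
      let ?W = "X \<star> \<sigma> y + Z"
      have W: "?W \<in> E" using X Z rE by blast
      have "0 = e (b ?W (M *v ?W))" using b(3) M W by (auto simp: alternating_on_def)
      also have "\<dots> = e (y * b X (M *v Z)) + e (b Z (M *v Z))"
        using M X Z MZ rE by (simp add: mv_distrib bs e_simps)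
      finally show ?thesis using b(3) M Z by (auto simp: alternating_on_def)
    qed
    then have "b X (M *v Z) = 0" by (rule e_nondeg')
    then show ?thesis using MZ by (simp add: L_def)
  qed
  have "ms.dim ?V \<le> opt_dim d k' + ms.dim {M \<in> ?V. \<forall>Z\<in>L. M *v Z \<in> {0}}"
  proof (rule trivial_spectrum_dim_le[OF right_subspace_0 L(1) _ _ subspace_matrices_kill[OF V(1)] _ _ _ T(1)])
    show "{0} \<subseteq> L" using right_subspaceD(1)[OF L(1)] by simp
    show "acts_on ?V L" using into L(2) by (auto simp: acts_on_def)
    show "trivial_spectrum_mod ?V {0} L" by (rule trivial_spectrum_mod_mono[OF V(3) _ L(2)]) auto
    show "k' * d \<le> card T" using T(2) k by simp
  qed (use dL in \<open>auto simp: acts_on_def\<close>)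
  moreover have "ms.dim {M \<in> ?V. \<forall>Z\<in>L. M *v Z \<in> {0}} \<le> ms.dim (ann V E)"
    by (rule ms.dim_subset) (auto simp: EL radjoin_def mv_distrib)
  ultimately have dim: "k * d - 1 \<le> vs.dim ((\<lambda>M. M *v X) ` V)"
    using eval_rank_nullity[OF V(1), of X] dimV k by simp
  let ?H = "{Z \<in> E. e (b X Z) = 0}"
  have H: "vs.subspace ?H"
    by (rule vs.subspaceI)
      (use X rE sesquilinear_on_0[OF b(1) E(1) X(1)] in \<open>auto simp: bs e_simps vscale_eq\<close>)
  have "vs.dim ?H + 1 \<le> k * d"
    using vs.dim_less_if_not_in[OF H, of E X] X bXX E(2) by auto
  then have "vs.dim ?H \<le> vs.dim ((\<lambda>M. M *v X) ` V)" using dim by linarith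
  moreover have "(\<lambda>M. M *v X) ` V \<subseteq> ?H" using b(3) X V(2) by (auto simp: alternating_on_def acts_on_def)
  ultimately have "(\<lambda>M. M *v X) ` V = ?H"
    by (intro vs.subspace_dim_equal subspace_eval[OF V(1)] H)
  moreover have "Y \<in> ?H" using Y by simp
  ultimately show ?thesis by (metis (no_types, lifting) imageE)
qed

text \<open>The data attached to a generic vector \<open>x\<close> of an optimal space: the orbit of \<open>x\<close> is the kernel
  of \<open>e \<circ> \<beta>\<close>, and the kernel of \<open>\<beta>\<close> is a complement of \<open>x D\<close>.\<close>

definition splitting :: "('a^'n^'n) set \<Rightarrow> ('a^'n) set \<Rightarrow> 'a^'n \<Rightarrow> ('a^'n \<Rightarrow> 'a) \<Rightarrow> bool" where
  "splitting V E x \<beta> \<longleftrightarrow> x \<in> E \<and> e (\<beta> x) \<noteq> 0 \<and>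
     (\<forall>X Y. \<beta> (X + Y) = \<beta> X + \<beta> Y) \<and> (\<forall>X a. \<beta> (X \<star> a) = \<beta> X * a) \<and>
     (\<forall>Y\<in>E. (\<exists>M\<in>V. M *v x = Y) \<longleftrightarrow> e (\<beta> Y) = 0) \<and>
     (\<forall>N\<in>V. N *v x = 0 \<longrightarrow> (\<forall>Y\<in>E. \<beta> (N *v Y) = 0 \<and>
        (\<forall>M\<in>V. N *v Y = M *v x \<longrightarrow> e (\<beta> (M *v Y)) = 0)))"

lemma splittingD:
  assumes "splitting V E x \<beta>"
  shows "x \<in> E" "e (\<beta> x) \<noteq> 0" "\<beta> (X + Y) = \<beta> X + \<beta> Y" "\<beta> (X \<star> a) = \<beta> X * a"
    and "Y \<in> E \<Longrightarrow> (\<exists>M\<in>V. M *v x = Y) \<longleftrightarrow> e (\<beta> Y) = 0"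
    and "N \<in> V \<Longrightarrow> N *v x = 0 \<Longrightarrow> Y \<in> E \<Longrightarrow> \<beta> (N *v Y) = 0"
    and "N \<in> V \<Longrightarrow> N *v x = 0 \<Longrightarrow> M \<in> V \<Longrightarrow> Y \<in> E \<Longrightarrow> N *v Y = M *v x \<Longrightarrow> e (\<beta> (M *v Y)) = 0"
  using assms unfolding splitting_def by blast+

lemma splitting_complement:
  assumes "splitting V E x \<beta>" and E: "right_subspace E"
  shows "right_subspace {Y \<in> E. \<beta> Y = 0}" "x \<notin> {Y \<in> E. \<beta> Y = 0}" "E = radjoin {Y \<in> E. \<beta> Y = 0} x"
proof -
  note D = splittingD[OF assms(1)]
  have \<beta>: "\<beta> 0 = 0" "\<beta> (X - Y) = \<beta> X - \<beta> Y" for X Y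
    using D(3)[of 0 0] D(3)[of "X - Y" Y] by simp_all
  have x0: "\<beta> x \<noteq> 0" using D(2) by (auto simp: e_simps)
  then show "x \<notin> {Y \<in> E. \<beta> Y = 0}" by simp
  show "right_subspace {Y \<in> E. \<beta> Y = 0}"
    unfolding right_subspace_iff using right_subspaceD[OF E] by (auto simp: D(3,4) \<beta>)
  show "E = radjoin {Y \<in> E. \<beta> Y = 0} x"
    by (rule radjoin_kernel[where \<beta> = \<beta>, OF E D(1) x0]) (simp add: \<beta> D(4))
qed

text \<open>The stabilizer of a generic \<open>x\<close> obeys the bound for \<open>k\<close>, so
  optimality gives \<open>x\<close> an orbit of codimension one, the kernel of a functional
  \<open>\<phi>\<close> on \<open>E\<close>. For each \<open>Y\<close> the F-linear form
  \<open>\<phi> (Y \<star> a)\<close> of \<open>a\<close> is \<open>e (\<beta> Y * a)\<close>, and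
  uniqueness of \<open>\<beta> Y\<close> makes \<open>\<beta>\<close> right linear.\<close>

lemma optimal_splitting_exists:
  fixes T :: "'f set"
  assumes V: "ms.subspace V" "acts_on V E" "trivial_spectrum_mod V {0} E"
    and E: "right_subspace E" "vs.dim E = Suc k * d"
    and dimV: "opt_dim d (Suc k) + ms.dim (ann V E) \<le> ms.dim V"
    and T: "finite T" "Suc k * d \<le> card T"
  shows "\<exists>x \<beta>. splitting V E x \<beta> \<and> vs.dim {Y \<in> E. \<beta> Y = 0} = k * d \<and>
    opt_dim d k + ms.dim (ann (stab V x) {Y \<in> E. \<beta> Y = 0})
       \<le> ms.dim (stab V x)"
proof -
  note rE = right_subspaceD[OF E(1)]
  have "{0} \<noteq> E" "{0} \<subseteq> E" using E(2) d_pos rE(1) by auto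
  have act0: "acts_on V {0}" by (simp add: acts_on_def)
  have dE: "vs.dim E = vs.dim {0} + Suc k * d" using E(2) by simp
  obtain x where gen: "generic_vector V {0} E x"
    using generic_vector_exists[OF right_subspace_0 E(1) \<open>{0} \<subseteq> E\<close> \<open>{0} \<noteq> E\<close> dE V(1,2) act0 V(3) T] by blast
  then have x: "x \<in> E" "x \<notin> {0}" by (auto simp: generic_vector_def)
  let ?V = "stab V x" and ?Vx = "(\<lambda>M. M *v x) ` V" and ?Vann = "ann V E"
  note step = generic_vector_radjoin[OF right_subspace_0 E(1) V(1) act0 V(3) gen, simplified]
  have U: "right_subspace (radjoin {0} x)" by (rule right_subspace_radjoin[OF right_subspace_0])
  have UE: "radjoin {0} x \<subseteq> E" by (rule radjoin_subset[OF E(1) \<open>{0} \<subseteq> E\<close> x(1)])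
  have "vs.dim E = vs.dim (radjoin {0} x) + k * d"
    using dim_radjoin[OF right_subspace_0 x(2)] E(2) by simp
  then have "ms.dim ?V \<le> opt_dim d k + ms.dim {M \<in> ?V. \<forall>X\<in>E. M *v X \<in> radjoin {0} x}"
    by (rule trivial_spectrum_dim_le[OF U E(1) UE _ subspace_matrices_kill[OF V(1), of x]
      acts_on_mono[OF V(2)] step(1,2) T(1)]) (use T(2) in auto)
  moreover have "ms.dim {M \<in> ?V. \<forall>X\<in>E. M *v X \<in> radjoin {0} x} \<le> ms.dim ?Vann"
    using step(3) by (intro ms.dim_subset) auto
  ultimately have low: "Suc k * d - 1 \<le> vs.dim ?Vx"
    using eval_rank_nullity[OF V(1), of x] dimV by simp
  have sVx: "vs.subspace ?Vx" by (rule subspace_eval[OF V(1)])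
  have VxE: "?Vx \<subseteq> E" using V(2) x by (auto simp: acts_on_def)
  have xVx: "x \<notin> ?Vx" using V(3) x by (force simp: trivial_spectrum_mod_def)
  have dVx: "vs.dim ?Vx + 1 = Suc k * d"
    using vs.dim_less_if_not_in[OF sVx VxE x(1) xVx] low E(2) d_pos by simp
  obtain \<phi> where \<phi>: "Vector_Spaces.linear (vscale \<iota>) (*) \<phi>" "\<And>y. y \<in> ?Vx \<Longrightarrow> \<phi> y = 0" "\<phi> x = 1"
    using vs.linear_functional_exists[OF sVx xVx] by blast
  interpret \<phi>: Vector_Spaces.linear "vscale \<iota>" "(*)" \<phi> by (rule \<phi>)
  have span: "vs.span (insert x ?Vx) = E"
  proof (rule vs.subspace_dim_equal)
    show sE: "vs.subspace E" by (rule subspace_right[OF E(1)])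
    show "vs.span (insert x ?Vx) \<subseteq> E" using VxE x(1) by (intro vs.span_minimal sE) auto
    show "vs.dim E \<le> vs.dim (vs.span (insert x ?Vx))"
      using vs.dim_insert_subspace[OF sVx xVx] dVx E(2) by linarith
  qed simp
  have \<phi>0: "Y \<in> ?Vx \<longleftrightarrow> \<phi> Y = 0" if Y: "Y \<in> E" for Y
  proof
    assume Y0: "\<phi> Y = 0"
    obtain c where "Y - vscale \<iota> c x \<in> vs.span ?Vx"
      using Y span[symmetric] vs.span_breakdown_eq[of Y x ?Vx] by auto
    then have c: "Y - vscale \<iota> c x \<in> ?Vx" using vs.span_eq_iff[THEN iffD2, OF sVx] by blast
    from \<phi>(2)[OF c] have "c = 0" using Y0 \<phi>(3) by (simp add: \<phi>.diff \<phi>.scale)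
    then show "Y \<in> ?Vx" using c by (simp add: vscale_eq)
  qed (rule \<phi>(2))
  have "\<exists>m. \<forall>a. \<phi> (Y \<star> a) = e (m * a)" for Y
  proof -
    have "Vector_Spaces.linear (fscale \<iota>) (*) (\<phi> \<circ> (\<star>) Y)"
      by (rule Vector_Spaces.linear_compose[OF linear_rscale \<phi>(1)])
    from functional_representation[OF this] show ?thesis by (simp add: e_commute)
  qed
  then obtain \<beta> where \<beta>: "\<And>Y a. \<phi> (Y \<star> a) = e (\<beta> Y * a)" by metis
  have \<phi>\<beta>: "\<phi> Y = e (\<beta> Y)" for Y using \<beta>[of Y 1] by simp
  have \<beta>_add: "\<beta> (X + Y) = \<beta> X + \<beta> Y" for X Y
    by (rule e_eqI) (simp add: \<beta>[symmetric] \<phi>.add distrib_right e_simps)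
  have \<beta>_scale: "\<beta> (X \<star> a) = \<beta> X * a" for X a
    by (rule e_eqI) (simp add: \<beta>[symmetric] mult.assoc)
  have range: "(\<exists>M\<in>V. M *v x = Y) \<longleftrightarrow> e (\<beta> Y) = 0" if "Y \<in> E" for Y
    using \<phi>0[OF that] \<phi>\<beta> by auto
  have \<beta>x: "e (\<beta> x) = 1" using \<phi>\<beta> \<phi>(3) by metis
  have ker: "\<beta> (N *v Y) = 0" if N: "N \<in> V" "N *v x = 0" and Y: "Y \<in> E" for N Y
  proof (rule e_nondeg)
    fix a
    have "\<exists>M\<in>V. N *v (Y \<star> a) - M *v x \<in> {0}"
      by (rule generic_vector_kernel[OF right_subspace_0 V(1) gen]) (use N Y rE in auto)
    then have "N *v (Y \<star> a) \<in> ?Vx" by auto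
    then have "\<phi> (N *v (Y \<star> a)) = 0" by (rule \<phi>(2))
    then show "e (\<beta> (N *v Y) * a) = 0" by (simp add: \<beta>)
  qed
  have chain: "e (\<beta> (M *v Y)) = 0"
    if N: "N \<in> V" "N *v x = 0" and M: "M \<in> V" and Y: "Y \<in> E" and NM: "N *v Y = M *v x" for N M Y
  proof -
    have "\<exists>M'\<in>V. M *v Y - M' *v (x + Y \<star> \<iota> t) \<in> {0}" if t: "t \<noteq> 0" for t
    proof
      \<comment> \<open>Chosen to cancel \<open>M x\<close> against \<open>N Y\<close> at
        \<open>x + Y t\<close>: its value there is exactly \<open>M Y\<close>.\<close>
      let ?M = "fscale_mat \<iota> (inverse t) (M - fscale_mat \<iota> (inverse t) N)"
      show "?M \<in> V" by (intro ms.subspace_scale[OF V(1)] ms.subspace_diff[OF V(1)] M N)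
      have "(M - fscale_mat \<iota> (inverse t) N) *v (x + Y \<star> \<iota> t) = (M *v Y) \<star> \<iota> t"
        using N NM t by (simp add: mv_diff_distrib mv_distrib)
      then show "M *v Y - ?M *v (x + Y \<star> \<iota> t) \<in> {0}" using t by simp
    qed
    moreover have "\<exists>M'\<in>V. M *v Y - M' *v Y \<in> {0}" using M by auto
    ultimately have "\<exists>M'\<in>V. M *v Y - M' *v x \<in> {0}"
      using gen Y unfolding generic_vector_def by blast
    then have "M *v Y \<in> ?Vx" by auto
    then show ?thesis using \<phi>(2) \<phi>\<beta> by metis
  qed
  have split: "splitting V E x \<beta>"
    unfolding splitting_def using x(1) \<beta>x \<beta>_add \<beta>_scale range ker chain by auto
  let ?L = "{Y \<in> E. \<beta> Y = 0}"
  note xL = splitting_complement(2)[OF split E(1)] and EL = splitting_complement(3)[OF split E(1)]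
  have dL: "vs.dim ?L = k * d" using dim_radjoin[OF splitting_complement(1,2)[OF split E(1)]] EL E(2) by simp
  have "ms.dim (ann ?V ?L) \<le> ms.dim ?Vann"
  proof (rule ms.dim_subset, clarify)
    fix M X assume M: "M \<in> V" "M *v x = 0" "\<forall>X\<in>?L. M *v X = 0" and "X \<in> E"
    then have "X \<in> radjoin ?L x" using EL by blast
    then obtain u a where "u \<in> ?L" "X = u + x \<star> a" by (rule radjoinE)
    then show "M *v X = 0" using M by (simp add: mv_distrib)
  qed
  moreover have "ms.dim V = vs.dim ?Vx + ms.dim ?V" by (rule eval_rank_nullity[OF V(1)])
  ultimately have dim: "opt_dim d k + ms.dim (ann ?V ?L) \<le> ms.dim ?V"
    using dimV dVx by simp
  show ?thesis using split dL dim by blast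
qed

end

subsection \<open>Extension of forms\<close>

text \<open>The inductive step of the classification: \<open>b\<close> is a form for the stabilizer of the generic
  vector \<open>x\<close> in \<open>V\<close>, which acts on the complement \<open>L\<close> of \<open>x D\<close>.  An element \<open>M\<close> of \<open>V\<close> is a
  block matrix with entries \<open>cf M\<close>, \<open>ro M\<close> (first row), \<open>cv M\<close>, \<open>op M\<close> (second row).\<close>

locale extension_step = quadratic_algebra \<iota> d Bd Bv Bm \<sigma> e
  for \<iota> :: "'f::field \<Rightarrow> 'a::division_ring" and d :: nat
    and Bd :: "'a set" and Bv :: "('a^'n) set" and Bm :: "('a^'n^'n) set"
    and \<sigma> :: "'a \<Rightarrow> 'a" and e :: "'a \<Rightarrow> 'f" +
  fixes V :: "('a^'n^'n) set" and E L :: "('a^'n) set" and x :: "'a^'n" and \<beta> :: "'a^'n \<Rightarrow> 'a"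
    and b :: "'a^'n \<Rightarrow> 'a^'n \<Rightarrow> 'a"
  assumes V: "ms.subspace V" "acts_on V E" "trivial_spectrum_mod V {0} E"
    and E: "right_subspace E" and split: "splitting V E x \<beta>"
    and L_def: "L = {Y \<in> E. \<beta> Y = 0}"
    and sesq: "sesquilinear_on L b" and noniso: "nonisotropic_on L b"
    and alt: "N \<in> V \<Longrightarrow> N *v x = 0 \<Longrightarrow> X \<in> L \<Longrightarrow> e (b X (N *v X)) = 0"
    and trans: "X \<in> L \<Longrightarrow> X \<noteq> 0 \<Longrightarrow> Y \<in> L \<Longrightarrow> e (b X Y) = 0 \<Longrightarrow> \<exists>N\<in>V. N *v x = 0 \<and> N *v X = Y"
    and scalar_ex: "X \<in> L \<Longrightarrow> Y \<in> L \<Longrightarrow> X \<noteq> 0 \<Longrightarrow> Y \<notin> range ((\<star>) X) \<Longrightarrow> \<exists>t :: 'f. t \<noteq> 0 \<and> t \<noteq> 1"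
begin

lemmas x = splittingD(1)[OF split]
  and e_beta_x = splittingD(2)[OF split]
  and beta_add = splittingD(3)[OF split]
  and beta_rscale = splittingD(4)[OF split]
  and eval_x = splittingD(5)[OF split]
  and kernel_beta = splittingD(6)[OF split]
  and chain = splittingD(7)[OF split]

lemmas rE = right_subspaceD[OF E]

lemma beta_0 [simp]: "\<beta> 0 = 0" using beta_add[of 0 0] by simp

lemma beta_diff: "\<beta> (X - Y) = \<beta> X - \<beta> Y" using beta_add[of "X - Y" Y] by simp

lemma right_subspace_L: "right_subspace L"
  unfolding L_def by (rule splitting_complement(1)[OF split E])

lemmas rL = right_subspaceD[OF right_subspace_L]

lemma L_E: "X \<in> L \<Longrightarrow> X \<in> E" and L_beta: "X \<in> L \<Longrightarrow> \<beta> X = 0" by (auto simp: L_def)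

lemmas b_simps = sesquilinear_onD[OF sesq]

lemmas b_diff = sesquilinear_on_diff[OF sesq right_subspace_L]

lemmas b_0 = sesquilinear_on_0[OF sesq right_subspace_L]

lemma b_nz: "X \<in> L \<Longrightarrow> X \<noteq> 0 \<Longrightarrow> b X X \<noteq> 0" "X \<in> L \<Longrightarrow> X \<noteq> 0 \<Longrightarrow> e (b X X) \<noteq> 0"
  using nonisotropic_onD[OF noniso] by auto

section \<open>Block entries relative to \<open>x D\<close> and \<open>L\<close>\<close>

definition p where "p = \<beta> x"
definition cf :: "'a^'n^'n \<Rightarrow> 'a" where "cf M = inverse p * \<beta> (M *v x)"
definition cv :: "'a^'n^'n \<Rightarrow> 'a^'n" where "cv M = M *v x - x \<star> cf M"
definition ro :: "'a^'n^'n \<Rightarrow> 'a^'n \<Rightarrow> 'a" where "ro M X = inverse p * \<beta> (M *v X)"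
definition op :: "'a^'n^'n \<Rightarrow> 'a^'n \<Rightarrow> 'a^'n" where "op M X = M *v X - x \<star> ro M X"

lemma p_nz: "p \<noteq> 0" "e p \<noteq> 0" using e_beta_x by (auto simp: p_def e_simps)

lemma beta_x: "\<beta> (x \<star> a) = p * a" by (simp add: p_def beta_rscale)

lemma V_E: "M \<in> V \<Longrightarrow> X \<in> E \<Longrightarrow> M *v X \<in> E" using V(2) by (auto simp: acts_on_def)

lemma p_cf: "p * cf M = \<beta> (M *v x)"
  using p_nz by (simp add: cf_def mult.assoc[symmetric])

lemma e_p_cf: "M \<in> V \<Longrightarrow> e (p * cf M) = 0"
  using eval_x[of "M *v x"] V_E[OF _ x, of M] by (auto simp: p_cf)

lemma cv_L: "M \<in> V \<Longrightarrow> cv M \<in> L"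
  using V_E[OF _ x, of M] rE x by (auto simp: L_def cv_def beta_diff beta_x p_cf)

lemma op_L: "M \<in> V \<Longrightarrow> X \<in> E \<Longrightarrow> op M X \<in> L"
  using V_E[of M X] rE x p_nz by (auto simp: L_def op_def beta_diff beta_x ro_def mult.assoc[symmetric])

lemma eval_x_decomp: "M *v x = x \<star> cf M + cv M" by (simp add: cv_def)

lemma eval_decomp: "M *v X = x \<star> ro M X + op M X" by (simp add: op_def)

lemma entries_add:
  "cf (M + N) = cf M + cf N" "cv (M + N) = cv M + cv N"
  "ro (M + N) X = ro M X + ro N X" "op (M + N) X = op M X + op N X"
  by (simp_all add: cf_def cv_def ro_def op_def mv_distrib beta_add
      distrib_left rscale_add_right)

lemma entries_diff:
  "cf (M - N) = cf M - cf N" "cv (M - N) = cv M - cv N"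
  "ro (M - N) X = ro M X - ro N X" "op (M - N) X = op M X - op N X"
  by (simp_all add: cf_def cv_def ro_def op_def mv_diff_distrib beta_diff
      right_diff_distrib rscale_diff_right)

lemma entries_scale:
  "cf (fscale_mat \<iota> t M) = cf M * \<iota> t" "cv (fscale_mat \<iota> t M) = cv M \<star> \<iota> t"
  "ro (fscale_mat \<iota> t M) X = ro M X * \<iota> t" "op (fscale_mat \<iota> t M) X = op M X \<star> \<iota> t"
  by (simp_all add: cf_def cv_def ro_def op_def beta_rscale mult.assoc)

lemma op_vec:
  "op M (X + Y) = op M X + op M Y" "op M (X \<star> a) = op M X \<star> a" "op M 0 = 0"
  by (simp_all add: op_def ro_def mv_distrib beta_add beta_rscale distrib_left
      rscale_add_right mult.assoc)

lemma ro_0 [simp]: "ro M 0 = 0" by (simp add: ro_def)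

text \<open>\<open>cf M = 1\<close> would give \<open>e p = e (p * cf M) = 0\<close>.\<close>

lemma one_minus_cf: "M \<in> V \<Longrightarrow> 1 - cf M \<noteq> 0"
  using e_p_cf[of M] p_nz by auto

lemma eval_x_L:
  assumes "c \<in> L"
  obtains M where "M \<in> V" "M *v x = c" "cf M = 0" "cv M = c"
proof -
  obtain M where "M \<in> V" "M *v x = c" using eval_x[OF L_E[OF assms]] L_beta[OF assms] by (auto simp: e_simps)
  then show ?thesis using that L_beta[OF assms] by (simp add: cf_def cv_def)
qed

text \<open>Schur complement of the upper left entry of \<open>1 - M - N\<close>, where \<open>N\<close> ranges over the
  stabilizer of \<open>x\<close>.\<close>

lemma schur:
  assumes M: "M \<in> V" and X: "X \<in> L" "X \<noteq> 0"
  shows "e (b X X) - e (b X (op M X)) - e (b X (cv M) * inverse (1 - cf M) * ro M X) \<noteq> 0"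
proof
  assume eq: "e (b X X) - e (b X (op M X)) - e (b X (cv M) * inverse (1 - cf M) * ro M X) = 0"
  \<comment> \<open>The coordinate \<open>h\<close> for which \<open>x \<star> h + X\<close> can be
    fixed by \<open>M + N\<close>, read off from the first block row.\<close>
  define h where "h = inverse (1 - cf M) * ro M X"
  have h: "cf M * h + ro M X = h"
  proof -
    have "(1 - cf M) * h = ro M X" using one_minus_cf[OF M] by (simp add: h_def mult.assoc[symmetric])
    then show ?thesis by (simp add: left_diff_distrib diff_eq_eq add.commute)
  qed
  \<comment> \<open>The value that \<open>N X\<close> must take for \<open>x \<star> h + X\<close>
    to be fixed. The assumption \<open>eq\<close> says precisely that \<open>e (b X ?Y) = 0\<close>,
    the condition for such an \<open>N\<close> to exist.\<close>
  let ?Y = "X - op M X - cv M \<star> h"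
  have mem: "op M X \<in> L" "cv M \<in> L" using op_L[OF M L_E[OF X(1)]] cv_L[OF M] by auto
  have "b X ?Y = b X X - b X (op M X) - b X (cv M) * h"
    using X mem rL by (simp add: b_diff b_simps)
  then have "e (b X ?Y) = 0" using eq by (simp add: e_simps h_def mult.assoc)
  moreover have "?Y \<in> L" by (intro rL X mem)
  ultimately obtain N where N: "N \<in> V" "N *v x = 0" "N *v X = ?Y" using trans[OF X] by blast
  let ?z = "x \<star> h + X"
  have "(M + N) *v ?z = (x \<star> cf M + cv M) \<star> h + (x \<star> ro M X + op M X) + ?Y"
    using N unfolding eval_x_decomp[symmetric] eval_decomp[symmetric]
    by (simp add: mv_distrib)
  also have "\<dots> = x \<star> (cf M * h + ro M X) + X" by (simp add: rscale_add_right)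
  finally have "(M + N) *v ?z - ?z = 0" by (simp add: h)
  moreover have "M + N \<in> V" by (rule ms.subspace_add[OF V(1) M N(1)])
  moreover have "?z \<in> E" using x L_E[OF X(1)] rE by blast
  ultimately have z: "?z = 0" using V(3) unfolding trivial_spectrum_mod_def by blast
  have "p * h = \<beta> ?z" using L_beta[OF X(1)] by (simp add: beta_add beta_x)
  then have "h = 0" using z p_nz by simp
  then show False using z X by simp
qed

section \<open>The lower right block and the map \<open>\<nu>\<close>\<close>

lemma op_form_eq_0:
  assumes M: "M \<in> V" and X: "X \<in> L" and c: "b X (cv M) = 0"
  shows "e (b X (op M X)) = 0"
proof (rule ccontr)
  assume q: "e (b X (op M X)) \<noteq> 0"
  have mem: "op M X \<in> L" "cv M \<in> L" using op_L[OF M L_E[OF X]] cv_L[OF M] by auto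
  then have "X \<noteq> 0" using q b_0 by (auto simp: e_simps)
  \<comment> \<open>The scalar makes the first two terms of the Schur inequality cancel; the third
    contains \<open>b X (cv M) = 0\<close>.\<close>
  from schur[OF ms.subspace_scale[OF V(1) M] X this, of "e (b X X) / e (b X (op M X))"] q c X mem
  show False by (simp add: entries_scale b_simps e_simps)
qed

lemma op_form_cong:
  assumes M: "M \<in> V" "M' \<in> V" and X: "X \<in> L" and c: "b X (cv M) = b X (cv M')"
  shows "e (b X (op M X)) = e (b X (op M' X))"
proof -
  have mem: "op M X \<in> L" "cv M \<in> L" "op M' X \<in> L" "cv M' \<in> L"
    using op_L[OF _ L_E[OF X]] cv_L M by auto
  have "e (b X (op (M - M') X)) = 0"
    by (rule op_form_eq_0[OF ms.subspace_diff[OF V(1) M] X]) (use X mem c in \<open>simp add: entries_diff b_diff\<close>)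
  then show ?thesis using X mem by (simp add: entries_diff b_diff e_simps)
qed

lemma b_onto:
  assumes X: "X \<in> L" "X \<noteq> 0"
  obtains M where "M \<in> V" "cf M = 0" "b X (cv M) = v"
proof -
  let ?c = "X \<star> (inverse (b X X) * v)"
  obtain M where "M \<in> V" "cf M = 0" "cv M = ?c" by (rule eval_x_L[of ?c]) (use X rL in auto)
  then show ?thesis using that X b_nz by (simp add: b_simps mult.assoc[symmetric])
qed

text \<open>By \<open>op_form_cong\<close> the value \<open>e (b X (op M X))\<close> depends on
  \<open>M\<close> only through \<open>b X (cv M)\<close>, and linearly; \<open>m\<close> represents
  this linear form through \<open>e\<close>.\<close>

definition represents :: "'a^'n \<Rightarrow> 'a \<Rightarrow> bool" where
  "represents X m \<longleftrightarrow> (\<forall>M\<in>V. e (b X (op M X)) = e (b X (cv M) * m))"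

lemma represents_exists:
  assumes X: "X \<in> L" "X \<noteq> 0"
  shows "\<exists>m. represents X m"
proof -
  have "\<forall>v. \<exists>M. M \<in> V \<and> b X (cv M) = v" by (metis b_onto[OF X])
  then obtain G where G: "\<And>v. G v \<in> V" "\<And>v. b X (cv (G v)) = v" by metis
  define f where "f = (\<lambda>v. e (b X (op (G v) X)))"
  have f: "f (b X (cv M)) = e (b X (op M X))" if "M \<in> V" for M
    unfolding f_def by (rule op_form_cong[OF G(1) that X(1)]) (simp add: G(2))
  have mem: "op M X \<in> L" "cv M \<in> L" if "M \<in> V" for M using op_L[OF that L_E[OF X(1)]] cv_L[OF that] by auto
  have "Vector_Spaces.linear (fscale \<iota>) (*) f"
    unfolding Vector_Spaces.linear_iff
  proof (intro conjI allI)
    fix v w c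
    have "f (b X (cv (G v + G w))) = f v + f w"
      using f[OF ms.subspace_add[OF V(1) G(1) G(1)], of v w] X mem G
      by (simp add: entries_add b_simps e_simps f_def)
    then show "f (v + w) = f v + f w" using X mem G by (simp add: entries_add b_simps)
    have "f (b X (cv (fscale_mat \<iota> c (G v)))) = c * f v"
      using f[OF ms.subspace_scale[OF V(1) G(1)], of c v] X mem G
      by (simp add: entries_scale b_simps f_def)
    then show "f (fscale \<iota> c v) = c * f v"
      using X mem G by (simp add: entries_scale b_simps fscale_def iota_central)
  qed (rule ds.vector_space_axioms vector_space_over_itself.vector_space_axioms)+
  then obtain m where m: "\<And>v. f v = e (v * m)" using functional_representation by blast
  then have "represents X m" unfolding represents_def using f by simp
  then show ?thesis by blast
qed

lemma represents_unique:
  assumes X: "X \<in> L" "X \<noteq> 0" and m: "represents X m" "represents X m'"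
  shows "m = m'"
proof (rule e_eqI')
  fix y
  obtain M where "M \<in> V" "b X (cv M) = y" by (metis b_onto[OF X])
  then show "e (y * m) = e (y * m')" using m unfolding represents_def by metis
qed

text \<open>Every \<open>m\<close> represents the zero vector; the default 0 there is the choice
  that keeps \<open>\<nu>\<close> homogeneous.\<close>

definition \<nu> :: "'a^'n \<Rightarrow> 'a" where
  "\<nu> X = (if X = 0 then 0 else SOME m. represents X m)"

lemma nu_0 [simp]: "\<nu> 0 = 0" by (simp add: \<nu>_def)

lemma represents_nu:
  assumes X: "X \<in> L"
  shows "represents X (\<nu> X)"
proof (cases "X = 0")
  case True
  show ?thesis unfolding represents_def True
    using b_0 rL(1) cv_L by (simp add: op_vec e_simps)
next
  case False
  then show ?thesis using someI_ex[OF represents_exists[OF X False]] by (simp add: \<nu>_def)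
qed

lemma nu: "M \<in> V \<Longrightarrow> X \<in> L \<Longrightarrow> e (b X (op M X)) = e (b X (cv M) * \<nu> X)"
  using represents_nu by (auto simp: represents_def)

lemma nu_rscale:
  assumes X: "X \<in> L"
  shows "\<nu> (X \<star> a) = \<nu> X * a"
proof (cases "X = 0 \<or> a = 0")
  case False
  have "represents (X \<star> a) (\<nu> X * a)"
    unfolding represents_def
  proof
    fix M assume M: "M \<in> V"
    have mem: "op M X \<in> L" "cv M \<in> L" using op_L[OF M L_E[OF X]] cv_L[OF M] by auto
    have "e (b (X \<star> a) (op M (X \<star> a))) = nrm a * e (b X (op M X))"
      using X mem rL e_conj(1)[of a "b X (op M X)"] by (simp add: op_vec b_simps mult.assoc)
    also have "\<dots> = e (b (X \<star> a) (cv M) * (\<nu> X * a))"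
      using X mem e_conj(1)[of a "b X (cv M) * \<nu> X"] nu[OF M X] by (simp add: b_simps mult.assoc)
    finally show "e (b (X \<star> a) (op M (X \<star> a))) = e (b (X \<star> a) (cv M) * (\<nu> X * a))" .
  qed
  moreover have "X \<star> a \<in> L" "X \<star> a \<noteq> 0" using rL X False by auto
  ultimately show ?thesis using represents_unique represents_nu by blast
qed auto

text \<open>Test with an \<open>M\<close> for which \<open>b X (cv M) = 0\<close> while
  \<open>b Y (cv M)\<close> is arbitrary. Expanding \<open>e (b Z (op M Z))\<close> at
  \<open>Z = X + Y s\<close> and dividing by \<open>s\<close> leaves a quantity \<open>P\<close>
  that does not depend on \<open>s\<close>.\<close>

lemma nu_translate:
  assumes X: "X \<in> L" "X \<noteq> 0" and Y: "Y \<in> L" "Y \<notin> range ((\<star>) X)" and t: "t \<noteq> 0"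
  shows "\<nu> (X + Y \<star> \<iota> t) - \<nu> Y * \<iota> t = \<nu> (X + Y) - \<nu> Y"
proof (rule e_eqI')
  fix v
  define Y' where "Y' = Y - X \<star> (inverse (b X X) * b X Y)"
  have Y'L: "Y' \<in> L" using X Y rL by (simp add: Y'_def)
  have "Y' \<noteq> 0" using Y(2) by (auto simp: Y'_def)
  have XY': "b X Y' = 0"
    using X Y rL b_nz by (simp add: Y'_def b_diff b_simps mult.assoc[symmetric])
  have "Y = Y' + X \<star> (inverse (b X X) * b X Y)" by (simp add: Y'_def)
  then have "b Y Y' = b Y' Y'" using X Y'L rL XY' by (metis b_simps(1,3) add.right_neutral mult_zero_right)
  then have YY': "b Y Y' \<noteq> 0" using b_nz Y'L \<open>Y' \<noteq> 0\<close> by simp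
  obtain M where M: "M \<in> V" "cv M = Y' \<star> (inverse (b Y Y') * v)"
    by (rule eval_x_L[of "Y' \<star> (inverse (b Y Y') * v)"]) (use Y'L rL in auto)
  have c: "b X (cv M) = 0" "b Y (cv M) = v" "cv M \<in> L"
    using X Y Y'L XY' YY' rL by (simp_all add: M(2) b_simps mult.assoc[symmetric])
  have op: "op M X \<in> L" "op M Y \<in> L" using op_L[OF M(1) L_E] X Y by auto
  define P where "P = e (b X (op M Y)) + e (b Y (op M X))"
  have key: "e (v * (\<nu> (X + Y \<star> \<iota> s) - \<nu> Y * \<iota> s)) = P" if s: "s \<noteq> 0" for s
  proof -
    let ?Z = "X + Y \<star> \<iota> s"
    have Z: "?Z \<in> L" "Y \<star> \<iota> s \<in> L" "op M Y \<star> \<iota> s \<in> L" using X Y op rL by auto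
    have "b ?Z (cv M) = \<iota> s * v" using X Y Z c by (simp add: b_simps)
    then have 1: "e (b ?Z (op M ?Z)) = s * e (v * \<nu> ?Z)"
      using nu[OF M(1) Z(1)] by (simp add: mult.assoc)
    have "b ?Z (op M ?Z) = (b X (op M X) + b X (op M Y) * \<iota> s) + (\<iota> s * b Y (op M X) + \<iota> s * (b Y (op M Y) * \<iota> s))"
      using X Y Z op rL by (simp add: op_vec b_simps distrib_left distrib_right mult.assoc)
    moreover have "e (b X (op M X)) = 0" using nu[OF M(1) X(1)] c by (simp add: e_simps)
    moreover have "e (b Y (op M Y)) = e (v * \<nu> Y)" using nu[OF M(1) Y(1)] c by simp
    ultimately have "e (b ?Z (op M ?Z)) = s * (P + s * e (v * \<nu> Y))"
      by (simp add: e_simps P_def distrib_left)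
    with 1 have "s * e (v * \<nu> ?Z) = s * (P + s * e (v * \<nu> Y))" by metis
    then have "e (v * \<nu> ?Z) = P + s * e (v * \<nu> Y)" using s by simp
    moreover have "e (v * (\<nu> Y * \<iota> s)) = s * e (v * \<nu> Y)" by (simp add: mult.assoc[symmetric])
    ultimately show ?thesis by (simp add: right_diff_distrib e_simps)
  qed
  show "e (v * (\<nu> (X + Y \<star> \<iota> t) - \<nu> Y * \<iota> t)) = e (v * (\<nu> (X + Y) - \<nu> Y))"
    using key[OF t] key[of 1] by simp
qed

text \<open>For independent \<open>X\<close> and \<open>Y\<close>, homogeneity and
  \<open>nu_translate\<close>, used for \<open>(X, Y, t)\<close> and \<open>(Y, X, 1 / t)\<close>,
  show that the defect of additivity is unchanged by multiplication by \<open>t\<close>. A scalar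
  other than 0 and 1 makes it zero.\<close>

lemma nu_add:
  assumes X: "X \<in> L" and Y: "Y \<in> L"
  shows "\<nu> (X + Y) = \<nu> X + \<nu> Y"
proof -
  consider "X = 0" | a where "X \<noteq> 0" "Y = X \<star> a" | "X \<noteq> 0" "Y \<notin> range ((\<star>) X)" by auto
  then show ?thesis
  proof cases
    case 2
    have "\<nu> (X + Y) = \<nu> (X \<star> (1 + a))" by (simp add: 2 rscale_add_right)
    also have "\<dots> = \<nu> X + \<nu> Y" unfolding 2 nu_rscale[OF X] by (simp add: distrib_left)
    finally show ?thesis .
  next
    case 3
    then obtain t :: 'f where t: "t \<noteq> 0" "t \<noteq> 1" using scalar_ex X Y by blast
    have Y0: "Y \<noteq> 0" using 3 by (metis rangeI rscale_simps(7))
    have YX: "X \<notin> range ((\<star>) Y)"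
    proof
      assume "X \<in> range ((\<star>) Y)"
      then obtain a where "X = Y \<star> a" by auto
      then have "Y = X \<star> inverse a" using 3 by auto
      then show False using 3 by auto
    qed
    have 1: "\<nu> (X + Y \<star> \<iota> t) - \<nu> Y * \<iota> t = \<nu> (X + Y) - \<nu> Y" by (rule nu_translate) (use X Y 3 t in auto)
    have 2: "\<nu> (Y + X \<star> \<iota> (inverse t)) - \<nu> X * \<iota> (inverse t) = \<nu> (Y + X) - \<nu> X"
      by (rule nu_translate) (use X Y Y0 YX t in auto)
    have "X + Y \<star> \<iota> t = (Y + X \<star> \<iota> (inverse t)) \<star> \<iota> t" using t by (simp add: add.commute)
    then have "\<nu> (X + Y \<star> \<iota> t) = \<nu> ((Y + X \<star> \<iota> (inverse t)) \<star> \<iota> t)" by (simp only:)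
    also have "\<dots> = \<nu> (Y + X \<star> \<iota> (inverse t)) * \<iota> t"
      by (rule nu_rscale) (use X Y rL in blast)
    also have "\<dots> = (\<nu> (X + Y) - \<nu> X + \<nu> X * \<iota> (inverse t)) * \<iota> t"
      using 2 by (simp add: diff_eq_eq add.commute)
    also have "\<dots> = (\<nu> (X + Y) - \<nu> X) * \<iota> t + \<nu> X" using t by (simp add: distrib_right mult.assoc)
    finally have 3: "\<nu> (X + Y \<star> \<iota> t) = (\<nu> (X + Y) - \<nu> X) * \<iota> t + \<nu> X" .
    have "(\<nu> (X + Y) - \<nu> X - \<nu> Y) * \<iota> t = \<nu> (X + Y \<star> \<iota> t) - \<nu> Y * \<iota> t - \<nu> X"
      unfolding 3 by (simp add: left_diff_distrib)
    also have "\<dots> = \<nu> (X + Y) - \<nu> X - \<nu> Y" unfolding 1 by simp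
    finally have "(\<nu> (X + Y) - \<nu> X - \<nu> Y) * \<iota> t = \<nu> (X + Y) - \<nu> X - \<nu> Y" .
    then have "(\<nu> (X + Y) - \<nu> X - \<nu> Y) * \<iota> (t - 1) = 0" by (simp add: algebra_simps)
    then have "\<nu> (X + Y) - \<nu> X - \<nu> Y = 0" using t by (simp del: iota_diff)
    then show ?thesis by (simp add: algebra_simps)
  qed simp
qed

section \<open>The first row of the block matrix\<close>

lemma beta_eval_cong:
  assumes "M \<in> V" "M' \<in> V" "M *v x = M' *v x" "X \<in> E"
  shows "\<beta> (M *v X) = \<beta> (M' *v X)"
  using kernel_beta[OF ms.subspace_diff[OF V(1) assms(1,2)], of X] assms
  by (simp add: mv_diff_distrib beta_diff)

text \<open>For given \<open>X\<close> the left side depends only on \<open>M x\<close>. If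
  \<open>e (b X c) = 0\<close>, some stabilizing \<open>N\<close> has \<open>N X = c\<close>, and
  \<open>chain\<close> makes the \<open>e\<close>-value of the row vanish. Proportionality gives the
  factor \<open>l\<close> in F, and replacing \<open>X\<close> by \<open>X \<star> y\<close> removes
  \<open>e\<close>.\<close>

lemma row_proportional:
  "\<exists>l. \<forall>M\<in>V. \<forall>X\<in>L. M *v x \<in> L \<longrightarrow> \<beta> (M *v X) = \<iota> l * \<sigma> (b X (M *v x))"
proof -
  have "\<forall>c. \<exists>M. c \<in> L \<longrightarrow> M \<in> V \<and> M *v x = c" by (metis eval_x_L)
  then obtain G where G: "\<And>c. c \<in> L \<Longrightarrow> G c \<in> V" "\<And>c. c \<in> L \<Longrightarrow> G c *v x = c" by metis
  have "\<exists>l. \<forall>X\<in>L. \<forall>c\<in>L. e (\<beta> (G c *v X)) = l * e (b X c)"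
  proof (rule vs.proportional_bilinear_forms[OF subspace_right[OF right_subspace_L]])
    have add: "e (\<beta> (G (c + c') *v X)) = e (\<beta> (G c *v X)) + e (\<beta> (G c' *v X))"
      if "X \<in> L" "c \<in> L" "c' \<in> L" for X c c'
    proof -
      have "\<beta> (G (c + c') *v X) = \<beta> ((G c + G c') *v X)"
        by (rule beta_eval_cong)
          (use that G rL L_E ms.subspace_add[OF V(1)] in \<open>auto simp: mv_distrib\<close>)
      then show ?thesis by (simp add: mv_distrib beta_add e_simps)
    qed
    have scale: "e (\<beta> (G (vscale \<iota> a c) *v X)) = a * e (\<beta> (G c *v X))" if "X \<in> L" "c \<in> L" for X c a
    proof -
      have "\<beta> (G (vscale \<iota> a c) *v X) = \<beta> (fscale_mat \<iota> a (G c) *v X)"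
        by (rule beta_eval_cong)
          (use that G rL L_E ms.subspace_scale[OF V(1)] in \<open>auto simp: vscale_eq\<close>)
      then show ?thesis by (simp add: beta_rscale)
    qed
    show "vs.bilinear_on L (\<lambda>X c. e (\<beta> (G c *v X)))"
      unfolding vs.bilinear_on_def using add scale
      by (simp add: e_simps vscale_eq mv_distrib beta_add beta_rscale)
    show "vs.bilinear_on L (\<lambda>X c. e (b X c))"
      unfolding vs.bilinear_on_def using rL by (simp add: b_simps e_simps vscale_eq)
    show "e (\<beta> (G c *v X)) = 0" if X: "X \<in> L" and c: "c \<in> L" "e (b X c) = 0" for X c
    proof (cases "X = 0")
      case False
      obtain N where "N \<in> V" "N *v x = 0" "N *v X = c" using trans[OF X False c] by blast
      then show ?thesis using chain[of N "G c" X] G[OF c(1)] L_E[OF X] by simp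
    qed (simp add: e_simps)
    show "\<exists>X\<in>L. e (b X c) \<noteq> 0" if "c \<in> L" "c \<noteq> 0" for c using b_nz that by blast
  qed
  then obtain l where l: "\<And>X c. X \<in> L \<Longrightarrow> c \<in> L \<Longrightarrow> e (\<beta> (G c *v X)) = l * e (b X c)" by blast
  have "\<beta> (M *v X) = \<iota> l * \<sigma> (b X (M *v x))" if M: "M \<in> V" "M *v x \<in> L" and X: "X \<in> L" for M X
  proof (rule e_eqI)
    fix y
    let ?c = "M *v x"
    have "e (\<beta> (M *v X) * y) = e (\<beta> (M *v (X \<star> y)))" by (simp add: beta_rscale)
    also have "\<beta> (M *v (X \<star> y)) = \<beta> (G ?c *v (X \<star> y))"
      by (rule beta_eval_cong) (use M G X rL L_E in auto)
    also have "e \<dots> = l * e (\<sigma> y * b X ?c)" using l[of "X \<star> y" ?c] M X rL by (simp add: b_simps)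
    also have "\<sigma> y * b X ?c = \<sigma> (\<sigma> (b X ?c) * y)" by (simp add: sigma_mult)
    finally show "e (\<beta> (M *v X) * y) = e (\<iota> l * \<sigma> (b X ?c) * y)" by (simp add: mult.assoc)
  qed
  then show ?thesis by blast
qed

lemma e_inverse_p: "e (inverse p) = e p / nrm p"
proof -
  have "\<iota> (inverse (nrm p)) * \<sigma> p * p = 1" using p_nz by (simp add: mult.assoc nrm)
  then have "inverse p = \<iota> (inverse (nrm p)) * \<sigma> p"
    using p_nz by (metis inverse_unique inverse_inverse_eq mult_eq_0_iff zero_neq_one)
  then show ?thesis by (simp add: divide_inverse mult.commute del: iota_inverse)
qed

text \<open>Since \<open>p * cf M\<close> is skew under \<open>\<sigma>\<close>, the product in
  question is an F-multiple of \<open>cf M * p\<close>, and cyclic invariance applies.\<close>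

lemma e_inverse_p_sigma_cf:
  assumes M: "M \<in> V"
  shows "e (inverse p * \<sigma> (cf M)) = 0"
proof -
  have inv: "inverse (\<sigma> p) = p * \<iota> (inverse (nrm p))"
    using p_nz by (intro inverse_unique) (simp add: mult.assoc[symmetric] nrm del: iota_inverse, simp)
  have "\<sigma> (cf M) * \<sigma> p = - (p * cf M)"
    using e_eq_0[OF e_p_cf[OF M]] by (simp add: sigma_mult)
  then have "\<sigma> (cf M) * \<sigma> p * inverse (\<sigma> p) = - (p * cf M) * inverse (\<sigma> p)" by simp
  then have "\<sigma> (cf M) = - (p * cf M) * inverse (\<sigma> p)" using p_nz by (simp add: mult.assoc)
  then have "inverse p * \<sigma> (cf M) = - (cf M * p * \<iota> (inverse (nrm p)))"
    using p_nz unfolding inv by (simp add: mult.assoc[symmetric])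
  then show ?thesis using e_p_cf[OF M] e_commute[of "cf M" p] by (simp add: e_simps del: iota_inverse)
qed

text \<open>The Schur inequality for \<open>M + N\<close>, where \<open>N\<close> moves
  \<open>x\<close> to the multiple of \<open>X\<close> that makes
  \<open>b X (cv N) * inverse (1 - cf M)\<close> equal to the free parameter
  \<open>z\<close>.\<close>

lemma schur_point:
  assumes l: "\<forall>M\<in>V. \<forall>X\<in>L. M *v x \<in> L \<longrightarrow> \<beta> (M *v X) = \<iota> l * \<sigma> (b X (M *v x))"
    and X: "X \<in> L" "X \<noteq> 0" and M: "M \<in> V" "cv M = 0"
  shows "e (b X X) - e (z * \<nu> X) + e (z * (cf M * \<nu> X - ro M X)) - l * (e p / nrm p) * nrm z \<noteq> 0"
proof -
  let ?c = "X \<star> (inverse (b X X) * (z * (1 - cf M)))"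
  have cL: "?c \<in> L" using X rL by blast
  obtain N where N: "N \<in> V" "N *v x = ?c" "cf N = 0" "cv N = ?c" using eval_x_L[OF cL] by blast
  have bc: "b X ?c = z * (1 - cf M)" using X b_nz by (simp add: b_simps mult.assoc[symmetric])
  have MN: "M + N \<in> V" by (rule ms.subspace_add[OF V(1) M(1) N(1)])
  have ent: "cf (M + N) = cf M" "cv (M + N) = ?c" using M N by (simp_all add: entries_add)
  have roN: "ro N X = inverse p * (\<iota> l * \<sigma> (z * (1 - cf M)))"
    using l N(1) X(1) cL N(2) bc by (simp add: ro_def)
  have "e (b X (cv (M + N)) * inverse (1 - cf (M + N)) * ro (M + N) X) = e (z * ro M X) + e (z * ro N X)"
    unfolding ent bc using one_minus_cf[OF M(1)] by (simp add: mult.assoc entries_add distrib_left e_simps)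
  also have "e (z * ro N X) = l * e (z * (inverse p * (1 - \<sigma> (cf M))) * \<sigma> z)"
  proof -
    have "z * ro N X = \<iota> l * (z * (inverse p * (1 - \<sigma> (cf M))) * \<sigma> z)"
      unfolding roN by (simp add: sigma_mult sigma_diff mult.assoc) (metis iota_central mult.assoc)
    then show ?thesis by simp
  qed
  also have "\<dots> = l * (e p / nrm p) * nrm z"
    unfolding e_conj by (simp add: right_diff_distrib e_simps e_inverse_p_sigma_cf[OF M(1)] e_inverse_p)
  finally have "e (b X (cv (M + N)) * inverse (1 - cf (M + N)) * ro (M + N) X)
      = e (z * ro M X) + l * (e p / nrm p) * nrm z" .
  moreover have "e (b X (op (M + N) X)) = e (z * (1 - cf M) * \<nu> X)"
    using nu[OF MN X(1)] bc ent by simp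
  moreover have "e (z * (1 - cf M) * \<nu> X) = e (z * \<nu> X) - e (z * (cf M * \<nu> X))"
    by (simp add: left_diff_distrib right_diff_distrib e_simps mult.assoc)
  moreover have "e (z * (cf M * \<nu> X - ro M X)) = e (z * (cf M * \<nu> X)) - e (z * ro M X)"
    by (simp add: right_diff_distrib e_simps)
  moreover have "u - (v - v') - (w + y) = u - v + (v' - w) - y" for u v v' w y :: 'f by simp
  ultimately show ?thesis using schur[OF MN X] by metis
qed

lemma row_formula:
  assumes l: "\<forall>M\<in>V. \<forall>X\<in>L. M *v x \<in> L \<longrightarrow> \<beta> (M *v X) = \<iota> l * \<sigma> (b X (M *v x))"
    and M: "M \<in> V" and X: "X \<in> L"
  shows "ro M X = cf M * \<nu> X + inverse p * (\<iota> l * \<sigma> (b X (cv M)))"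
proof -
  have row0: "ro N X = cf N * \<nu> X" if N: "N \<in> V" "cv N = 0" for N
  proof (cases "X = 0")
    case False
    have "e (z * (cf N * \<nu> X - ro N X)) = 0" for z
    proof (rule ccontr)
      let ?w = "e (z * (cf N * \<nu> X - ro N X))"
      let ?r = "e (b X X) - e (z * \<nu> X) - l * (e p / nrm p) * nrm z"
      assume w: "?w \<noteq> 0"
      \<comment> \<open>Rescaling \<open>N\<close> multiplies one term of \<open>schur_point\<close>
        by \<open>t\<close> and leaves the others; this value would make the whole expression
        zero.\<close>
      define t where "t = - ?r / ?w"
      have "z * (cf N * \<iota> t * \<nu> X - ro N X * \<iota> t) = z * (cf N * \<nu> X - ro N X) * \<iota> t"
        by (simp only: mult.assoc iota_central[of t "\<nu> X"] right_diff_distrib left_diff_distrib)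
      then have "e (z * (cf (fscale_mat \<iota> t N) * \<nu> X - ro (fscale_mat \<iota> t N) X)) = t * ?w"
        by (simp add: entries_scale)
      moreover have "cv (fscale_mat \<iota> t N) = 0" using N(2) by (simp add: entries_scale)
      moreover have "u - v + w - y = u - v - y + w" for u v w y :: 'f by simp
      ultimately have "?r + t * ?w \<noteq> 0"
        using schur_point[OF l X False ms.subspace_scale[OF V(1) N(1)], of t z] by metis
      then show False using w by (simp add: t_def)
    qed
    then have "cf N * \<nu> X - ro N X = 0" by (rule e_nondeg')
    then show ?thesis by simp
  qed simp
  \<comment> \<open>Subtracting an element with the same \<open>cv\<close> and zero
    \<open>cf\<close> reduces to \<open>row0\<close>; the row of that element is given by
    \<open>l\<close>.\<close>
  obtain N where N: "N \<in> V" "N *v x = cv M" "cf N = 0" "cv N = cv M" using eval_x_L[OF cv_L[OF M]] by blast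
  have "ro (M - N) X = cf (M - N) * \<nu> X"
    by (rule row0) (use N M ms.subspace_diff[OF V(1)] in \<open>auto simp: entries_diff\<close>)
  moreover have "ro N X = inverse p * (\<iota> l * \<sigma> (b X (cv M)))"
    using l N(1) X N(2) cv_L[OF M] by (simp add: ro_def)
  ultimately show ?thesis using N by (simp add: entries_diff algebra_simps)
qed

lemma row_formula_exists:
  assumes irr: "irreducible_on V E"
  obtains l where "l \<noteq> 0"
    "\<And>M X. M \<in> V \<Longrightarrow> X \<in> L \<Longrightarrow> ro M X = cf M * \<nu> X + inverse p * (\<iota> l * \<sigma> (b X (cv M)))"
    "\<And>X z. X \<in> L \<Longrightarrow> X \<noteq> 0 \<Longrightarrow> e (b X X) - e (z * \<nu> X) - l * (e p / nrm p) * nrm z \<noteq> 0"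
proof -
  obtain l where l: "\<forall>M\<in>V. \<forall>X\<in>L. M *v x \<in> L \<longrightarrow> \<beta> (M *v X) = \<iota> l * \<sigma> (b X (M *v x))"
    using row_proportional by blast
  note row = row_formula[OF l]
  have pt: "e (b X X) - e (z * \<nu> X) - l * (e p / nrm p) * nrm z \<noteq> 0" if "X \<in> L" "X \<noteq> 0" for X z
    using schur_point[OF l that ms.subspace_0[OF V(1)], of z] by (simp add: cf_def cv_def ro_def e_simps)
  show ?thesis
  proof (cases "l = 0")
    case False
    then show ?thesis using that row pt by blast
  next
    \<comment> \<open>With \<open>l = 0\<close> an affine function of \<open>z\<close> would never
      vanish, which forces \<open>\<nu> = 0\<close>. The rows then vanish and \<open>L\<close> is
      invariant, so irreducibility leaves only \<open>L = {0}\<close>.\<close>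
    case True
    have om0: "\<nu> X = 0" if X: "X \<in> L" for X
    proof (cases "X = 0")
      case False
      have "e (z * \<nu> X) = 0" for z
      proof (rule ccontr)
        assume "e (z * \<nu> X) \<noteq> 0"
        then show False
          using pt[OF X False, of "\<iota> (e (b X X) / e (z * \<nu> X)) * z"] True by (simp add: mult.assoc)
      qed
      then show ?thesis by (rule e_nondeg')
    qed simp
    have "M *v X \<in> L" if "M \<in> V" "X \<in> L" for M X
      using row[OF that] True om0[OF that(2)] op_L[OF that(1) L_E[OF that(2)]]
      by (simp add: op_def)
    then have "acts_on V L" by (simp add: acts_on_def)
    moreover have "L \<noteq> E" using x e_beta_x L_beta[of x] by (auto simp: e_simps)
    ultimately have "L = {0}" using irr right_subspace_L L_E unfolding irreducible_on_def by blast
    \<comment> \<open>On \<open>L = {0}\<close> the conditions hold for every factor; -1 is just a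
      nonzero one.\<close>
    then show ?thesis
      using that[of "- 1"] b_0 rL(1) cv_L by simp
  qed
qed

lemma form_exists:
  assumes irr: "irreducible_on V E"
  shows "\<exists>B. sesquilinear_on E B \<and> nonisotropic_on E B \<and> alternating_on E B V"
proof -
  obtain l where l0: "l \<noteq> 0"
    and row: "\<And>M X. M \<in> V \<Longrightarrow> X \<in> L \<Longrightarrow> ro M X = cf M * \<nu> X + inverse p * (\<iota> l * \<sigma> (b X (cv M)))"
    and pt: "\<And>X z. X \<in> L \<Longrightarrow> X \<noteq> 0 \<Longrightarrow> e (b X X) - e (z * \<nu> X) - l * (e p / nrm p) * nrm z \<noteq> 0"
    using row_formula_exists[OF irr] by blast
  define f where "f = (\<lambda>Z. inverse p * \<beta> Z)"
  define g where "g = (\<lambda>Z. Z - x \<star> f Z)"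
  define h where "h = (\<lambda>Z. f Z + \<nu> (g Z))"
  \<comment> \<open>The orthogonal sum of \<open>p\<close> on \<open>x D\<close> and
    \<open>- l b\<close> on \<open>L\<close>, sheared by \<open>\<nu>\<close> in its first argument
    only; \<open>h\<close> is the sheared \<open>x\<close>-coordinate.\<close>
  define B where "B = (\<lambda>Z Z'. \<sigma> (h Z) * p * f Z' - \<iota> l * b (g Z) (g Z'))"
  have f: "f (Z + Z') = f Z + f Z'" "f (Z \<star> a) = f Z * a" for Z Z' a
    by (simp_all add: f_def beta_add beta_rscale distrib_left mult.assoc)
  have gL: "g Z \<in> L" if "Z \<in> E" for Z
    using that x rE p_nz by (auto simp: L_def g_def f_def beta_diff beta_x mult.assoc[symmetric])
  have g: "g (Z + Z') = g Z + g Z'" "g (Z \<star> a) = g Z \<star> a" for Z Z' a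
    by (simp_all add: g_def f rscale_add_right)
  have h: "h (Z + Z') = h Z + h Z'" if "Z \<in> E" "Z' \<in> E" for Z Z'
    using gL that by (simp add: h_def f g nu_add)
  have h': "h (Z \<star> a) = h Z * a" if "Z \<in> E" for Z a
    using gL that by (simp add: h_def f g nu_rscale distrib_right)
  have "sesquilinear_on E B"
    unfolding sesquilinear_on_def
  proof (intro conjI ballI allI)
    fix X Y Z a assume m: "X \<in> E" "Y \<in> E" "Z \<in> E"
    note m' = gL[OF m(1)] gL[OF m(2)] gL[OF m(3)]
    show "B (X + Y) Z = B X Z + B Y Z"
      using m m' by (simp add: B_def h g b_simps sigma_add algebra_simps)
    show "B X (Y + Z) = B X Y + B X Z"
      using m m' by (simp add: B_def f g b_simps algebra_simps)
    show "B (X \<star> a) Z = \<sigma> a * B X Z"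
      using m m' iota_central[of l "\<sigma> a"]
      by (simp add: B_def h' g b_simps sigma_mult right_diff_distrib mult.assoc[symmetric])
    show "B X (Y \<star> a) = B X Y * a"
      using m m' by (simp add: B_def f g b_simps left_diff_distrib mult.assoc)
  qed
  moreover have "nonisotropic_on E B"
    unfolding nonisotropic_on_def
  proof (intro ballI impI)
    fix Z assume Z: "Z \<in> E" "Z \<noteq> 0"
    have Zd: "Z = x \<star> f Z + g Z" by (simp add: g_def)
    have eB: "e (B Z Z) = nrm (h Z) * e p - e (\<sigma> (h Z) * p * \<nu> (g Z)) - l * e (b (g Z) (g Z))"
    proof -
      have "\<sigma> (h Z) * p * f Z = \<sigma> (h Z) * p * h Z - \<sigma> (h Z) * p * \<nu> (g Z)"
        by (simp add: h_def distrib_left)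
      then show ?thesis by (simp add: B_def e_simps e_conj(1))
    qed
    show "e (B Z Z) \<noteq> 0"
    proof (cases "g Z = 0")
      case True
      then have "f Z \<noteq> 0" using Zd Z by auto
      then show ?thesis using eB True p_nz b_0 rL(1) by (simp add: h_def e_simps)
    next
      case False
      \<comment> \<open>The parameter at which the expression in \<open>pt\<close>, multiplied by
        \<open>- l\<close>, becomes \<open>e (B Z Z)\<close>.\<close>
      define z where "z = - (\<iota> (inverse l) * (\<sigma> (h Z) * p))"
      have nz: "nrm z = inverse l * inverse l * (nrm (h Z) * nrm p)"
        by (simp add: z_def nrm_minus nrm_mult nrm_iota nrm_sigma del: iota_inverse)
      have "e (z * \<nu> (g Z)) = - (inverse l * e (\<sigma> (h Z) * p * \<nu> (g Z)))"
        by (simp add: z_def e_simps mult.assoc del: iota_inverse)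
      then have "- l * (e (b (g Z) (g Z)) - e (z * \<nu> (g Z)) - l * (e p / nrm p) * nrm z) = e (B Z Z)"
      proof -
        have *: "- l * (u - (- (inverse l * v)) - l * (r / q) * (inverse l * inverse l * (N * q))) = N * r - v - l * u"
          if "q \<noteq> 0" for u v r q N :: 'f
        proof -
          have "- l * (u - (- (i * v)) - l * s * (i * i * (N * q))) = (l * i) * (l * i) * (N * (s * q)) - (l * i) * v - l * u"
            for i s by (simp add: algebra_simps)
          from this[of "inverse l" "r / q"] show ?thesis using that l0 by simp
        qed
        show ?thesis unfolding eB nz \<open>e (z * \<nu> (g Z)) = _\<close> by (rule *) (use p_nz in simp)
      qed
      then show ?thesis using pt[OF gL[OF Z(1)] False, of z] l0 by (metis mult_eq_0_iff neg_equal_0_iff_equal)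
    qed
  qed
  moreover have "alternating_on E B V"
    unfolding alternating_on_def
  proof (intro ballI)
    fix M Z assume M: "M \<in> V" and Z: "Z \<in> E"
    let ?X = "g Z"
    have X: "?X \<in> L" "cv M \<in> L" "op M ?X \<in> L" using gL[OF Z] cv_L[OF M] op_L[OF M L_E[OF gL[OF Z]]] by auto
    have "M *v Z = M *v (x \<star> f Z + ?X)" by (simp add: g_def)
    also have "\<dots> = x \<star> (cf M * f Z + ro M ?X) + (cv M \<star> f Z + op M ?X)"
      unfolding mv_distrib matrix_vector_mult_rscale eval_x_decomp[of M] eval_decomp[of M ?X]
      by (simp add: rscale_add_right)
    finally have MZ: "M *v Z = x \<star> (cf M * f Z + ro M ?X) + (cv M \<star> f Z + op M ?X)" .
    have W: "cv M \<star> f Z + op M ?X \<in> L" using X rL by blast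
    have fM: "f (M *v Z) = cf M * f Z + ro M ?X"
    proof -
      have "f (x \<star> a) = a" for a using p_nz by (simp add: f_def beta_x mult.assoc[symmetric])
      moreover have "f (cv M \<star> f Z + op M ?X) = 0" using L_beta[OF W] by (simp add: f_def)
      ultimately show ?thesis unfolding MZ f(1)[of "x \<star> _"] by simp
    qed
    have gM: "g (M *v Z) = cv M \<star> f Z + op M ?X"
    proof -
      have "g (M *v Z) = M *v Z - x \<star> f (M *v Z)" by (simp add: g_def)
      then have "g (M *v Z) = M *v Z - x \<star> (cf M * f Z + ro M ?X)" by (simp only: fM)
      then show ?thesis by (simp add: MZ)
    qed
    \<comment> \<open>The shear collects the terms with \<open>cf M\<close> into
      \<open>p * cf M * h Z\<close>, which contributes nothing to \<open>e\<close> after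
      multiplication by \<open>\<sigma> (h Z)\<close>. What is left cancels against the contribution
      of \<open>b\<close> on \<open>L\<close>.\<close>
    have pf: "p * f (M *v Z) = p * cf M * h Z + \<iota> l * \<sigma> (b ?X (cv M))"
      unfolding fM row[OF M X(1)] h_def using p_nz by (simp add: distrib_left mult.assoc[symmetric])
    have "e (\<sigma> (h Z) * p * f (M *v Z)) = e (\<sigma> (h Z) * (p * cf M) * h Z) + l * e (\<sigma> (h Z) * \<sigma> (b ?X (cv M)))"
      unfolding mult.assoc[of _ p] pf by (simp add: distrib_left e_simps mult.assoc)
    also have "\<dots> = l * e (b ?X (cv M) * h Z)"
      unfolding e_conj(1) sigma_mult[symmetric] using e_p_cf[OF M] by simp
    finally have 1: "e (\<sigma> (h Z) * p * f (M *v Z)) = l * e (b ?X (cv M) * h Z)" .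
    have "b ?X (g (M *v Z)) = b ?X (cv M) * f Z + b ?X (op M ?X)"
      unfolding gM using X rL by (simp add: b_simps)
    then have "e (b ?X (g (M *v Z))) = e (b ?X (cv M) * h Z)"
      using nu[OF M X(1)] by (simp add: h_def distrib_left e_simps)
    with 1 show "e (B Z (M *v Z)) = 0" by (simp add: B_def e_simps)
  qed
  ultimately show ?thesis by blast
qed

end

context quadratic_algebra
begin

theorem irreducible_optimal_form_exists:
  fixes T :: "'f set"
  assumes "ms.subspace V" "acts_on V E" "trivial_spectrum_mod V {0} E"
    and "right_subspace E" "vs.dim E = k * d"
    and "opt_dim d k + ms.dim (ann V E) \<le> ms.dim V"
    and "irreducible_on V E"
    and T: "finite T" "k * d \<le> card T"
  shows "\<exists>b. sesquilinear_on E b \<and> nonisotropic_on E b \<and> alternating_on E b V"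
  using assms(1-7) T(2)
proof (induction k arbitrary: V E)
  case 0
  then have "E = {0}" using right_subspaceD(1)[of E] by auto
  then show ?case
    by (intro exI[of _ "\<lambda>_ _. 0"])
      (auto simp: sesquilinear_on_def nonisotropic_on_def alternating_on_def e_simps)
next
  case (Suc k)
  note V = Suc.prems(1-3) and E = Suc.prems(4,5) and T' = T(1) Suc.prems(8)
  obtain x \<beta> where split: "splitting V E x \<beta>" and dL: "vs.dim {Y \<in> E. \<beta> Y = 0} = k * d"
    and dim: "opt_dim d k + ms.dim (ann (stab V x) {Y \<in> E. \<beta> Y = 0})
       \<le> ms.dim (stab V x)"
    using optimal_splitting_exists[OF V E Suc.prems(6) T'] by blast
  define L' where "L' = {Y \<in> E. \<beta> Y = 0}"
  define Vx where "Vx = stab V x"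
  note L = splitting_complement[OF split E(1), folded L'_def] dL[folded L'_def] and dim = dim[folded L'_def Vx_def]
  have sVx: "ms.subspace Vx" unfolding Vx_def by (rule subspace_matrices_kill[OF V(1)])
  have actL: "acts_on Vx L'" using splittingD(6)[OF split] V(2) by (auto simp: acts_on_def Vx_def L'_def)
  have tsL: "trivial_spectrum_mod Vx {0} L'"
    by (rule trivial_spectrum_mod_mono[OF V(3)]) (auto simp: Vx_def L'_def)
  have irrL: "irreducible_on Vx L'"
    by (rule irreducible_on_complement[OF V Suc.prems(7) E(1) L(3,1,2,4) Vx_def actL dim T'])
  have Tk: "k * d \<le> card T" using T'(2) by simp
  obtain b where b: "sesquilinear_on L' b" "nonisotropic_on L' b" "alternating_on L' b Vx"
    using Suc.IH[OF sVx actL tsL L(1,4) dim irrL Tk] by blast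
  interpret extension_step \<iota> d Bd Bv Bm \<sigma> e V E L' x \<beta> b
  proof
    show "\<exists>N\<in>V. N *v x = 0 \<and> N *v X = Y" if "X \<in> L'" "X \<noteq> 0" "Y \<in> L'" "e (b X Y) = 0" for X Y
      using alternating_transitive[OF sVx actL tsL L(1,4) dim b T(1) Tk that] by (auto simp: Vx_def)
    show "e (b X (N *v X)) = 0" if "N \<in> V" "N *v x = 0" "X \<in> L'" for N X
      using b(3) that by (auto simp: alternating_on_def Vx_def)
    \<comment> \<open>If 0 and 1 were the only scalars, two independent vectors of \<open>L'\<close>
      would give \<open>2 * d \<le> k * d\<close>, against \<open>Suc k * d \<le> 2\<close>.\<close>
    show "\<exists>t :: 'f. t \<noteq> 0 \<and> t \<noteq> 1" if XY: "X \<in> L'" "Y \<in> L'" "X \<noteq> 0" "Y \<notin> range ((\<star>) X)" for X Y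
    proof (rule ccontr)
      assume "\<not> ?thesis"
      then have "T \<subseteq> {0, 1}" by blast
      then have "card T \<le> 2" using card_mono[of "{0, 1 :: 'f}" T] by simp
      let ?U = "radjoin {0} X"
      have U: "right_subspace ?U" "?U \<subseteq> L'" "Y \<notin> ?U"
        using XY right_subspaceD(1,3)[OF L(1)] right_subspace_radjoin[OF right_subspace_0, of X]
        by (auto elim!: radjoinE)
      have "vs.dim ?U = d" using dim_radjoin[OF right_subspace_0, of X] XY(3) by simp
      moreover have "vs.dim (radjoin ?U Y) \<le> vs.dim L'"
        by (rule vs.dim_subset[OF radjoin_subset[OF L(1) U(2) XY(2)]])
      ultimately have "2 * d \<le> k * d" using dim_radjoin[OF U(1,3)] L(4) by linarith
      then have "3 * d \<le> 2" using \<open>card T \<le> 2\<close> T'(2) unfolding mult_Suc by linarith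
      then show False using d_pos by simp
    qed
  qed (use V E split b in \<open>auto simp: L'_def\<close>)
  show ?case by (rule form_exists[OF Suc.prems(7)])
qed

end

subsection \<open>The four cases of quadratic type\<close>

context central_algebra
begin

lemma span_1: "ds.span {1} = range \<iota>"
  by (auto simp: ds.span_singleton fscale_def)

lemma dim_range_iota: "ds.dim (range \<iota>) = 1"
  unfolding span_1[symmetric] ds.dim_span by simp

lemma range_iota_eq_UNIV_iff: "range \<iota> = UNIV \<longleftrightarrow> d = 1"
proof
  assume "range \<iota> = UNIV"
  then show "d = 1" using dim_range_iota fd_D(2) by simp
next
  assume "d = 1"
  show "range \<iota> = UNIV"
    unfolding span_1[symmetric]
    by (rule ds.subspace_dim_equal) (simp_all add: fd_D(2) \<open>d = 1\<close>)
qed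

lemma has_degree_unique: "has_degree \<iota> d' \<Longrightarrow> d' = d"
proof -
  assume "has_degree \<iota> d'"
  then obtain B where B: "finite_dimensional_vector_space (fscale \<iota>) B" "card B = d'"
    unfolding has_degree_def by blast
  interpret B: finite_dimensional_vector_space "fscale \<iota>" B by (rule B(1))
  have "ds.dim UNIV = card B" using ds.dim_eq_card[of B UNIV] B.independent_Basis B.span_Basis by simp
  then show "d' = d" using B(2) fd_D(2) by simp
qed

lemma F_automorphismsD:
  assumes "\<tau> \<in> F_automorphisms \<iota>"
  shows "\<tau> (x + y) = \<tau> x + \<tau> y" "\<tau> (x * y) = \<tau> x * \<tau> y" "\<tau> (\<iota> c) = \<iota> c"
  using assms by (auto simp: F_automorphisms_def)

lemma id_F_automorphism: "id \<in> F_automorphisms \<iota>"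
  by (simp add: F_automorphisms_def)

lemma standard_pair_i:
  assumes q: "quadratic_type_i \<iota>" and pair: "associated_pair \<iota> \<sigma> e"
  shows "standard_pair \<iota> \<sigma> e"
proof -
  have "d = 1" using q has_degree_unique[of 1] by (simp add: quadratic_type_i_def)
  then have ran: "\<exists>c. x = \<iota> c" for x using range_iota_eq_UNIV_iff by blast
  have comm: "x * y = y * x" for x y :: 'a using ran[of x] iota_central by auto
  have \<sigma>: "\<sigma> = id" and lin: "Vector_Spaces.linear (fscale \<iota>) (*) e"
    and e: "\<And>x. \<iota> (e x) = (\<Sum>\<tau>\<in>F_automorphisms \<iota>. \<tau> x)"
    using pair q by (auto simp: associated_pair_def standard_involution_def)
  have "F_automorphisms \<iota> = {id}"
    using id_F_automorphism F_automorphismsD(3) ran by (auto simp: fun_eq_iff) metis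
  then have e: "\<iota> (e x) = x" for x using e by simp
  show ?thesis
  proof (rule standard_pair.intro)
    show "\<sigma> x = - x" if "e x = 0" for x using e[of x] that \<sigma> by simp
    show "\<exists>x. e x \<noteq> 0" using e[of 1] by (metis iota_0 zero_neq_one)
    show "e (x * y) = e (y * x)" for x y by (simp add: comm[of x])
    show "\<exists>c. \<sigma> x * x = \<iota> c" for x by (rule ran)
  qed (use lin in \<open>simp_all add: \<sigma> comm\<close>)
qed

text \<open>In characteristic 2 every element is its own negative, so the identity satisfies the
  skewness condition.\<close>

lemma standard_pair_iv:
  assumes q: "quadratic_type_iv \<iota>" and pair: "associated_pair \<iota> \<sigma> e"
  shows "standard_pair \<iota> \<sigma> e"
proof -
  have comm: "x * y = y * x" for x y :: 'a using q by (simp add: quadratic_type_iv_def commutative_def)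
  have sq: "\<exists>c. x * x = \<iota> c" for x
    using q by (auto simp: quadratic_type_iv_def power2_eq_square image_iff)
  have "(1 + 1 :: 'f) = 0" using q of_nat_CHAR[where 'a = 'f] by (simp add: quadratic_type_iv_def)
  then have "\<iota> 1 + \<iota> 1 = 0" unfolding iota(2)[symmetric] by simp
  then have "(1 + 1) * x = 0" for x :: 'a by simp
  then have char: "- x = x" for x :: 'a
    by (metis add.inverse_unique distrib_right mult_1)
  have \<sigma>: "\<sigma> = id" and lin: "Vector_Spaces.linear (fscale \<iota>) (*) e" and e: "\<exists>x. e x \<noteq> 0"
    using pair q by (auto simp: associated_pair_def standard_involution_def)
  show ?thesis
  proof (rule standard_pair.intro)
    show "e (x * y) = e (y * x)" for x y by (simp add: comm[of x])
    show "\<exists>c. \<sigma> x * x = \<iota> c" for x using sq \<sigma> by simp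
  qed (use lin e in \<open>simp_all add: \<sigma> comm char\<close>)
qed

text \<open>Shared by the separable quadratic and the quaternion case. The trace is not zero:
  otherwise \<open>\<sigma>\<close> is negation, \<open>\<sigma> 1 = 1\<close> forces characteristic
  2, and negation is then the identity.\<close>

lemma trace_form:
  assumes e: "\<And>x. \<iota> (e x) = x + \<sigma> x" and inv: "\<And>x. \<sigma> (\<sigma> x) = x" and \<sigma>: "\<sigma> 1 = 1" "\<sigma> \<noteq> id"
  shows "e (\<sigma> x) = e x" "e x = 0 \<Longrightarrow> \<sigma> x = - x" "\<exists>x. e x \<noteq> 0"
proof -
  have "\<iota> (e (\<sigma> x)) = \<iota> (e x)" using e[of "\<sigma> x"] e[of x] inv by (simp add: add.commute)
  then show "e (\<sigma> x) = e x" by simp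
  show neg: "\<sigma> x = - x" if "e x = 0" for x
    using e[of x] that by (simp add: eq_neg_iff_add_eq_0 add.commute)
  show "\<exists>x. e x \<noteq> 0"
  proof (rule ccontr)
    assume "\<not> ?thesis"
    then have neg: "\<sigma> x = - x" for x using neg by blast
    then have "(- 1 :: 'a) = 1" using \<sigma>(1) by metis
    then have "\<sigma> x = x" for x using neg[of x] by (metis mult_1 mult_minus_left)
    then show False using \<sigma>(2) by auto
  qed
qed

lemma standard_pair_iii:
  assumes q: "quadratic_type_iii \<iota>" and pair: "associated_pair \<iota> \<sigma> e"
  shows "standard_pair \<iota> \<sigma> e"
proof -
  have "d = 4" using q has_degree_unique[of 4] by (simp add: quadratic_type_iii_def)
  then have "range \<iota> \<noteq> UNIV" using range_iota_eq_UNIV_iff by simp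
  then have nc: "\<exists>x y :: 'a. x * y \<noteq> y * x"
    using q by (auto simp: quadratic_type_iii_def quaternion_algebra_def)
  have \<sigma>lin: "Vector_Spaces.linear (fscale \<iota>) (fscale \<iota>) \<sigma>"
    and inv: "\<And>x. \<sigma> (\<sigma> x) = x" and anti: "\<And>x y. \<sigma> (x * y) = \<sigma> y * \<sigma> x"
    and nr: "\<And>x. x * \<sigma> x \<in> range \<iota>"
    and lin: "Vector_Spaces.linear (fscale \<iota>) (*) e" and e: "\<And>x. \<iota> (e x) = x + \<sigma> x"
    using pair q by (auto simp: associated_pair_def standard_involution_def quaternionic_conjugation_def)
  have add: "\<sigma> (x + y) = \<sigma> x + \<sigma> y" and scale: "\<sigma> (\<iota> c * x) = \<iota> c * \<sigma> x" for x y c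
    using \<sigma>lin by (auto simp: Vector_Spaces.linear_iff fscale_def)
  have \<sigma>1: "\<sigma> 1 = 1" using anti[of "\<sigma> 1" 1] inv by simp
  have \<sigma>\<iota>: "\<sigma> (\<iota> c) = \<iota> c" for c using scale[of c 1] \<sigma>1 by simp
  have \<sigma>0: "\<sigma> 0 = 0" using \<sigma>\<iota>[of 0] by simp
  have nr': "\<exists>c. \<sigma> x * x = \<iota> c" for x
  proof (cases "x = 0")
    case False
    obtain c where c: "x * \<sigma> x = \<iota> c" using nr[of x] by auto
    have "x * (\<sigma> x * x) = x * \<iota> c" using c by (simp add: mult.assoc[symmetric] iota_central)
    then show ?thesis using False by auto
  qed (auto simp: \<sigma>0 intro!: exI[of _ 0])
  have "\<sigma> \<noteq> id" using nc anti by (metis id_apply)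
  note trace = trace_form[OF e inv \<sigma>1 this]
  show ?thesis
  proof (rule standard_pair.intro)
    \<comment> \<open>Both sides are compared after multiplication by \<open>x\<close>. The norm of
      \<open>x\<close> is central and the same from either side, so \<open>\<sigma> y\<close> can
      pass it.\<close>
    show "e (x * y) = e (y * x)" for x y
    proof (cases "x = 0")
      case False
      obtain c where c: "x * \<sigma> x = \<iota> c" using nr[of x] by auto
      obtain c' where c': "\<sigma> x * x = \<iota> c'" using nr' by blast
      have "x * \<iota> c' = \<iota> c * x" using c c' by (metis mult.assoc)
      then have "\<iota> c' = \<iota> c" using False by (simp add: iota_central)
      have "\<iota> (e (x * y)) * x = x * y * x + \<sigma> y * (\<sigma> x * x)"
        by (simp add: e anti distrib_right mult.assoc)
      also have "\<sigma> y * (\<sigma> x * x) = x * \<sigma> x * \<sigma> y"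
        using c c' \<open>\<iota> c' = \<iota> c\<close> by (metis iota_central)
      also have "x * y * x + x * \<sigma> x * \<sigma> y = x * \<iota> (e (y * x))"
        by (simp add: e anti distrib_left mult.assoc)
      finally have "x * \<iota> (e (x * y)) = x * \<iota> (e (y * x))" by (simp add: iota_central)
      then show ?thesis using False by simp
    qed simp
  qed (use add anti inv \<sigma>\<iota> lin trace nr' in auto)
qed

text \<open>An element \<open>h\<close> moved by \<open>\<sigma>\<close> generates D over F and
  satisfies a quadratic equation with roots \<open>h\<close> and \<open>\<iota> s - h\<close>. Hence
  the identity and \<open>\<sigma>\<close> are the only automorphisms, and the Galois trace is
  \<open>x + \<sigma> x\<close>.\<close>

lemma standard_pair_ii:
  assumes q: "quadratic_type_ii \<iota>" and pair: "associated_pair \<iota> \<sigma> e"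
  shows "standard_pair \<iota> \<sigma> e"
proof -
  have d: "d = 2" using q has_degree_unique[of 2] by (simp add: quadratic_type_ii_def)
  have comm: "x * y = y * x" for x y :: 'a
    using q by (simp add: quadratic_type_ii_def separable_field_extension_def commutative_def)
  have aut: "\<sigma> \<in> F_automorphisms \<iota>" and nid: "\<sigma> \<noteq> id"
    and lin: "Vector_Spaces.linear (fscale \<iota>) (*) e"
    and e: "\<And>x. \<iota> (e x) = (\<Sum>\<tau>\<in>F_automorphisms \<iota>. \<tau> x)"
    using pair q by (auto simp: associated_pair_def standard_involution_def)
  note \<sigma> = F_automorphismsD[OF aut]
  obtain h where h: "\<sigma> h \<noteq> h" using nid by (auto simp: fun_eq_iff)
  then have h_ran: "h \<notin> range \<iota>" using \<sigma>(3) by auto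
  have "ds.dim (ds.span (insert h (range \<iota>))) = 2"
    using ds.dim_insert_subspace[of "range \<iota>" h] h_ran dim_range_iota ds.subspace_span[of "{1}"]
    unfolding span_1 by simp
  then have span: "ds.span (insert h (range \<iota>)) = UNIV"
    by (intro ds.subspace_dim_equal) (auto simp: fd_D(2) d)
  have gen: "\<exists>s t. x = \<iota> s + \<iota> t * h" for x
  proof -
    obtain t where "x - fscale \<iota> t h \<in> ds.span (range \<iota>)"
      using span ds.span_breakdown_eq[of x h "range \<iota>"] by auto
    then have "x - \<iota> t * h \<in> range \<iota>"
      unfolding span_1[symmetric] ds.span_span by (simp add: fscale_def)
    then obtain s where "x - \<iota> t * h = \<iota> s" by auto
    then have "x = \<iota> s + \<iota> t * h" by (simp add: diff_eq_eq)
    then show ?thesis by blast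
  qed
  obtain r s where hh: "h * h = \<iota> r + \<iota> s * h" using gen by blast
  have conj: "\<tau> h = h \<or> \<tau> h = \<iota> s - h" if "\<tau> \<in> F_automorphisms \<iota>" for \<tau>
  proof -
    note \<tau> = F_automorphismsD[OF that]
    have "\<tau> h * \<tau> h = \<iota> r + \<iota> s * \<tau> h" using arg_cong[OF hh, of \<tau>] by (simp add: \<tau>)
    then have "(\<tau> h - h) * (\<tau> h - (\<iota> s - h)) = 0"
      using hh comm[of h "\<tau> h"] comm[of h "\<iota> s"] comm[of "\<tau> h" "\<iota> s"]
      by (simp add: left_diff_distrib right_diff_distrib)
    then show ?thesis by auto
  qed
  have eq: "\<tau> = \<tau>'" if "\<tau> \<in> F_automorphisms \<iota>" "\<tau>' \<in> F_automorphisms \<iota>" "\<tau> h = \<tau>' h" for \<tau> \<tau>'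
  proof
    fix x
    obtain s t where "x = \<iota> s + \<iota> t * h" using gen by blast
    then show "\<tau> x = \<tau>' x" using that(3) by (simp add: F_automorphismsD[OF that(1)] F_automorphismsD[OF that(2)])
  qed
  have \<sigma>h: "\<sigma> h = \<iota> s - h" using conj[OF aut] h by simp
  have auts: "F_automorphisms \<iota> = {id, \<sigma>}"
  proof
    show "F_automorphisms \<iota> \<subseteq> {id, \<sigma>}"
    proof
      fix \<tau> assume \<tau>: "\<tau> \<in> F_automorphisms \<iota>"
      show "\<tau> \<in> {id, \<sigma>}"
        using conj[OF \<tau>] eq[OF \<tau> id_F_automorphism] eq[OF \<tau> aut] \<sigma>h by auto
    qed
  qed (use aut id_F_automorphism in auto)
  have e: "\<iota> (e x) = x + \<sigma> x" for x using e[of x] nid by (simp add: auts)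
  have diff: "\<sigma> (x - y) = \<sigma> x - \<sigma> y" for x y using \<sigma>(1)[of "x - y" y] by simp
  have inv: "\<sigma> (\<sigma> x) = x" for x
  proof -
    obtain u v where "x = \<iota> u + \<iota> v * h" using gen by blast
    then show ?thesis by (simp add: \<sigma> \<sigma>h diff)
  qed
  \<comment> \<open>The fixed space contains F and misses \<open>h\<close>, so by dimension it is F;
    norms are fixed by \<open>\<sigma>\<close> and therefore lie in F.\<close>
  let ?Fix = "{x. \<sigma> x = x}"
  have "range \<iota> = ?Fix"
  proof (rule ds.subspace_dim_equal)
    show sF: "ds.subspace ?Fix"
      by (rule ds.subspaceI) (use \<sigma> \<sigma>(3)[of 0] in \<open>auto simp: fscale_def\<close>)
    show "ds.dim ?Fix \<le> ds.dim (range \<iota>)"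
      using ds.dim_less_if_not_in[OF sF, of UNIV h] h dim_range_iota fd_D(2) d by simp
    show "ds.subspace (range \<iota>)" unfolding span_1[symmetric] by simp
  qed (use \<sigma>(3) in auto)
  then have nr: "\<exists>c. \<sigma> x * x = \<iota> c" for x
    using \<sigma>(2)[of "\<sigma> x" x] inv[of x] comm[of x "\<sigma> x"] by (auto simp: set_eq_iff image_iff)
  have "\<sigma> 1 = 1" using \<sigma>(3)[of 1] by simp
  note trace = trace_form[OF e inv this nid]
  show ?thesis
  proof (rule standard_pair.intro)
    show "e (x * y) = e (y * x)" for x y by (simp add: comm[of x])
    show "\<sigma> (x * y) = \<sigma> y * \<sigma> x" for x y using \<sigma>(2)[of x y] comm by metis
  qed (use \<sigma> inv lin nr trace in auto)
qed

lemma standard_pair_if_associated_pair: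
  "quadratic_type \<iota> \<Longrightarrow> associated_pair \<iota> \<sigma> e \<Longrightarrow> standard_pair \<iota> \<sigma> e"
  unfolding quadratic_type_def
  using standard_pair_i standard_pair_ii standard_pair_iii standard_pair_iv by blast

end

text \<open>Used once for columns and once more for matrices, which are vectors of rows.\<close>

lemma finite_dimensional_vec:
  fixes s :: "'f::field \<Rightarrow> 'b::ab_group_add \<Rightarrow> 'b"
  assumes "finite_dimensional_vector_space s B"
  shows "finite_dimensional_vector_space (\<lambda>c X. \<chi> i::'n::finite. s c (X $ i)) {axis i b |i b. b \<in> B}"
proof -
  interpret s: finite_dimensional_vector_space s B by (rule assms)
  let ?s = "\<lambda>c X. \<chi> i::'n. s c (X $ i)"
  let ?B = "{axis i b |(i::'n) b. b \<in> B}"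
  interpret v: vector_space ?s
    by unfold_locales (simp_all add: vec_eq_iff s.scale_left_distrib s.scale_right_distrib)
  have B: "?B = (\<lambda>(i, b). axis i b) ` (UNIV \<times> B)" by auto
  have "0 \<notin> B" using s.independent_Basis s.dependent_zero by blast
  then have inj: "inj_on (\<lambda>(i::'n, b). axis i b) (UNIV \<times> B)"
    by (auto simp: inj_on_def axis_eq_axis)
  show ?thesis
  proof unfold_locales
    show fin: "finite ?B" unfolding B using s.finite_Basis by simp
    show "v.independent ?B"
    proof (rule v.independent_if_scalars_zero[OF fin])
      fix f x assume eq: "(\<Sum>x\<in>?B. ?s (f x) x) = 0" and "x \<in> ?B"
      then obtain i b where x: "x = axis i b" "b \<in> B" by auto
      have "(\<Sum>x\<in>?B. ?s (f x) x) = (\<Sum>j\<in>UNIV. \<Sum>b\<in>B. ?s (f (axis j b)) (axis j b))"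
        unfolding B sum.reindex[OF inj] by (simp add: sum.cartesian_product case_prod_unfold)
      then have "0 = (\<Sum>j\<in>UNIV. \<Sum>b\<in>B. ?s (f (axis j b)) (axis j b)) $ i" using eq by simp
      also have "\<dots> = (\<Sum>j\<in>UNIV. \<Sum>b\<in>B. s (f (axis j b)) (if j = i then b else 0))"
        by (auto simp: axis_def intro!: sum.cong)
      also have "\<dots> = (\<Sum>j\<in>UNIV. if j = i then (\<Sum>b\<in>B. s (f (axis i b)) b) else 0)"
        by (intro sum.cong) auto
      also have "\<dots> = (\<Sum>b\<in>B. s (f (axis i b)) b)" by simp
      finally show "f x = 0"
        using s.independentD[OF s.independent_Basis s.finite_Basis order_refl, of "\<lambda>b. f (axis i b)" b] x
        by simp
    qed
    show "v.span ?B = UNIV"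
    proof (intro equalityI subsetI UNIV_I)
      fix X :: "'b^'n"
      have "axis i y \<in> v.span ?B" for i y
      proof -
        have "y \<in> s.span B" using s.span_Basis by simp
        then show ?thesis
        proof (induction rule: s.span_induct_alt)
          case base
          have "axis i 0 = (0 :: 'b^'n)" by (simp add: axis_def vec_eq_iff)
          show ?case unfolding \<open>axis i 0 = 0\<close> by (rule v.span_zero)
        next
          case (step c b y)
          have "axis i (s c b + y) = ?s c (axis i b) + axis i y" by (simp add: axis_def vec_eq_iff)
          moreover have "axis i b \<in> v.span ?B" using step(1) by (intro v.span_base) blast
          ultimately show ?case using v.span_add[OF v.span_scale step(2)] by simp
        qed
      qed
      then have "(\<Sum>i\<in>UNIV. axis i (X $ i)) \<in> v.span ?B" by (intro v.span_sum)
      moreover have "(\<Sum>i\<in>UNIV. axis i (X $ i)) = X" by (simp add: vec_eq_iff axis_def)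
      ultimately show "X \<in> v.span ?B" by simp
    qed
  qed
qed

lemma finite_dimensional_vscale:
  assumes "finite_dimensional_vector_space (fscale \<iota>) B"
  shows "\<exists>Bv. finite_dimensional_vector_space (vscale \<iota> :: _ \<Rightarrow> 'a::division_ring^'n::finite \<Rightarrow> _) Bv"
    and "\<exists>Bm. finite_dimensional_vector_space (fscale_mat \<iota> :: _ \<Rightarrow> 'a^'n^'m::finite \<Rightarrow> _) Bm"
proof -
  have v: "(vscale \<iota> :: _ \<Rightarrow> 'a^'n \<Rightarrow> _) = (\<lambda>c X. \<chi> i. fscale \<iota> c (X $ i))"
    by (simp add: vscale_def fscale_def fun_eq_iff)
  have m: "(fscale_mat \<iota> :: _ \<Rightarrow> 'a^'n^'m \<Rightarrow> _) = (\<lambda>c X. \<chi> i. vscale \<iota> c (X $ i))"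
    by (simp add: fscale_mat_def fscale_def vscale_def fun_eq_iff vec_eq_iff)
  show 1: "\<exists>Bv. finite_dimensional_vector_space (vscale \<iota> :: _ \<Rightarrow> 'a^'n \<Rightarrow> _) Bv"
    unfolding v using finite_dimensional_vec[OF assms] by blast
  then show "\<exists>Bm. finite_dimensional_vector_space (fscale_mat \<iota> :: _ \<Rightarrow> 'a^'n^'m \<Rightarrow> _) Bm"
    unfolding m using finite_dimensional_vec by blast
qed

subsection \<open>Spaces of alternating operators\<close>

text \<open>The diagonal condition is stated apart from antisymmetry, which does not imply it in
  characteristic 2.\<close>

lemma sum_alternating:
  fixes f :: "'i \<Rightarrow> 'i \<Rightarrow> 'b::ab_group_add"
  assumes "finite I" "\<And>i. i \<in> I \<Longrightarrow> f i i = 0" "\<And>i j. i \<in> I \<Longrightarrow> j \<in> I \<Longrightarrow> f i j = - f j i"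
  shows "(\<Sum>i\<in>I. \<Sum>j\<in>I. f i j) = 0"
  using assms
proof (induction I)
  case empty
  show ?case by simp
next
  case (insert k I)
  have "(\<Sum>i\<in>I. f i k) = - (\<Sum>j\<in>I. f k j)"
    unfolding sum_negf[symmetric] by (intro sum.cong refl) (rule insert.prems(2), simp_all)
  moreover have "f k k = 0" "(\<Sum>i\<in>I. \<Sum>j\<in>I. f i j) = 0"
    using insert.IH insert.prems by blast+
  ultimately show ?case using insert.hyps by (simp add: sum.distrib)
qed

context quadratic_algebra
begin

definition herm :: "'a^'n \<Rightarrow> 'a^'n \<Rightarrow> 'a" where
  "herm X Y = (\<Sum>i\<in>UNIV. \<sigma> (X $ i) * Y $ i)"

lemma herm_simps:
  "herm (X + X') Y = herm X Y + herm X' Y" "herm X (Y + Y') = herm X Y + herm X Y'"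
  "herm (X \<star> a) Y = \<sigma> a * herm X Y" "herm X (Y \<star> a) = herm X Y * a"
  by (simp_all add: herm_def sigma_add sigma_mult distrib_left distrib_right sum.distrib
      sum_distrib_left sum_distrib_right mult.assoc)

lemma sigma_sum: "\<sigma> (\<Sum>i\<in>A. g i) = (\<Sum>i\<in>A. \<sigma> (g i))"
  by (induction A rule: infinite_finite_induct) (simp_all add: sigma_add)

lemma e_sum: "e (\<Sum>i\<in>A. g i) = (\<Sum>i\<in>A. e (g i))"
  by (induction A rule: infinite_finite_induct) (simp_all add: e_simps)

lemma herm_axis: "herm (axis i a) Y = \<sigma> a * Y $ i"
proof -
  have "herm (axis i a) Y = (\<Sum>j\<in>UNIV. if j = i then \<sigma> a * Y $ i else 0)"
    unfolding herm_def by (intro sum.cong) (auto simp: axis_def)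
  then show ?thesis by simp
qed

lemma herm_star: "herm X (A *v Y) = herm (star \<sigma> A *v X) Y"
proof -
  have "herm X (A *v Y) = (\<Sum>i\<in>UNIV. \<Sum>j\<in>UNIV. \<sigma> (X $ i) * A $ i $ j * Y $ j)"
    by (simp add: herm_def matrix_vector_mult_def sum_distrib_left mult.assoc)
  also have "\<dots> = (\<Sum>j\<in>UNIV. \<Sum>i\<in>UNIV. \<sigma> (X $ i) * A $ i $ j * Y $ j)" by (rule sum.swap)
  also have "\<dots> = herm (star \<sigma> A *v X) Y"
    by (simp add: herm_def matrix_vector_mult_def star_def transpose_def sigma_sum sigma_mult sum_distrib_right)
  finally show ?thesis .
qed

lemma star_star: "star \<sigma> (star \<sigma> A) = A"
  by (simp add: star_def transpose_def vec_eq_iff)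

lemma star_mult: "star \<sigma> (A ** B) = star \<sigma> B ** star \<sigma> A"
  by (simp add: star_def transpose_def vec_eq_iff matrix_matrix_mult_def sigma_sum sigma_mult)

lemma star_mat_1: "star \<sigma> (mat 1) = mat 1"
  by (auto simp: star_def transpose_def vec_eq_iff mat_def)

lemma matrix_eqI_herm:
  fixes A B :: "'a^'n^'n"
  assumes "\<And>X Y. e (herm X (A *v Y)) = e (herm X (B *v Y))"
  shows "A = B"
  unfolding matrix_eq vec_eq_iff
proof (intro allI e_eqI')
  fix Y :: "'a^'n" and i y
  show "e (y * (A *v Y) $ i) = e (y * (B *v Y) $ i)"
    using assms[of "axis i (\<sigma> y)" Y] by (simp add: herm_axis)
qed

text \<open>Turns the entrywise definition into an alternation condition. One direction pairs the
  terms at \<open>(i, j)\<close> and \<open>(j, i)\<close> through the invariance of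
  \<open>e\<close> under \<open>\<sigma>\<close>; the other evaluates and polarizes at coordinate
  vectors.\<close>

lemma SH_iff: "A \<in> SH \<sigma> e \<longleftrightarrow> (\<forall>X. e (herm X (A *v X)) = 0)"
proof
  assume A: "A \<in> SH \<sigma> e"
  then have "star \<sigma> A $ j $ i = (- A) $ j $ i" for i j by (simp add: SH_def)
  then have skew: "\<sigma> (A $ i $ j) = - A $ j $ i" for i j by (simp add: star_def transpose_def)
  show "\<forall>X. e (herm X (A *v X)) = 0"
  proof
    fix X :: "'a^'n"
    have "e (herm X (A *v X)) = (\<Sum>i\<in>UNIV. \<Sum>j\<in>UNIV. e (\<sigma> (X $ i) * A $ i $ j * X $ j))"
      by (simp add: herm_def matrix_vector_mult_def sum_distrib_left mult.assoc e_sum)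
    also have "\<dots> = 0"
    proof (rule sum_alternating)
      show "e (\<sigma> (X $ i) * A $ i $ i * X $ i) = 0" for i
        using A by (simp add: e_conj(1) SH_def)
      show "e (\<sigma> (X $ i) * A $ i $ j * X $ j) = - e (\<sigma> (X $ j) * A $ j $ i * X $ i)" for i j
        using e_sigma[of "\<sigma> (X $ i) * A $ i $ j * X $ j"] skew[of i j]
        by (simp add: sigma_mult e_simps mult.assoc del: e_sigma)
    qed simp
    finally show "e (herm X (A *v X)) = 0" .
  qed
next
  assume A: "\<forall>X. e (herm X (A *v X)) = 0"
  have pol: "e (herm X (A *v Y)) + e (herm Y (A *v X)) = 0" for X Y
    using A[rule_format, of "X + Y"] A[rule_format, of X] A[rule_format, of Y]
    by (simp add: mv_distrib herm_simps e_simps add.commute)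
  have col: "(A *v axis j a) $ i = A $ i $ j * a" for i j a
    by (simp add: matrix_vector_mult_def axis_def if_distrib[of "\<lambda>x. _ * x"] cong: if_cong)
  have diag: "e (A $ i $ i) = 0" for i
    using A[rule_format, of "axis i 1"] by (simp add: herm_axis col)
  moreover have "\<sigma> (A $ j $ i) = - A $ i $ j" for i j
  proof (rule e_eqI)
    fix y
    have "e (A $ i $ j * y) + e (\<sigma> y * A $ j $ i) = 0"
      using pol[of "axis i 1" "axis j y"] by (simp add: herm_axis col)
    moreover have "e (\<sigma> y * A $ j $ i) = e (\<sigma> (A $ j $ i) * y)"
      using e_sigma[of "\<sigma> y * A $ j $ i"] by (simp add: sigma_mult del: e_sigma)
    ultimately show "e (\<sigma> (A $ j $ i) * y) = e (- A $ i $ j * y)"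
      by (simp add: e_simps eq_neg_iff_add_eq_0 add.commute)
  qed
  ultimately show "A \<in> SH \<sigma> e" by (simp add: SH_def star_def transpose_def vec_eq_iff)
qed

lemma dim_kernel_ge:
  assumes E: "vs.subspace E" and f: "\<And>X Y. f (X + Y) = f X + f Y" "\<And>c X. f (X \<star> \<iota> c) = c * (f X :: 'f)"
  shows "vs.dim E \<le> vs.dim {X \<in> E. f X = 0} + 1"
proof -
  interpret vf: finite_dimensional_vector_space_pair "vscale \<iota>" Bv "(*) :: 'f \<Rightarrow> 'f \<Rightarrow> 'f" "{1}"
    by unfold_locales
  have "Vector_Spaces.linear (vscale \<iota>) (*) f"
    unfolding Vector_Spaces.linear_iff
    using f vs.vector_space_axioms vector_space_over_itself.vector_space_axioms by (simp add: vscale_eq)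
  from vf.rank_nullity[OF this E] show ?thesis
    using vector_space_over_itself.dim_subset_UNIV[of "f ` E"]
    by (simp add: vector_space_over_itself.dimension_def)
qed

section \<open>The alternating operators of a nonisotropic form\<close>

definition alt_ops :: "('a^'n \<Rightarrow> 'a^'n \<Rightarrow> 'a) \<Rightarrow> ('a^'n^'n) set" where
  "alt_ops b = {M. \<forall>X. e (b X (M *v X)) = 0}"

context
  fixes b :: "'a^'n \<Rightarrow> 'a^'n \<Rightarrow> 'a"
  assumes sesq: "sesquilinear_on UNIV b" and noniso: "nonisotropic_on UNIV b"
begin

lemmas b_simps = sesquilinear_onD[OF sesq, OF UNIV_I UNIV_I] sesquilinear_onD(1,2)[OF sesq, OF UNIV_I UNIV_I UNIV_I]

lemma b_0: "b X 0 = 0" "b 0 X = 0"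
  using sesquilinear_on_0[OF sesq right_subspace_UNIV] by simp_all

lemma b_diff: "b X (Y - Z) = b X Y - b X Z"
  by (rule sesquilinear_on_diff[OF sesq right_subspace_UNIV]) simp_all

lemma b_nz: "X \<noteq> 0 \<Longrightarrow> e (b X X) \<noteq> 0" "X \<noteq> 0 \<Longrightarrow> b X X \<noteq> 0"
  using nonisotropic_onD[OF noniso UNIV_I] by blast+

lemma subspace_alt_ops: "ms.subspace (alt_ops b)"
  by (rule ms.subspaceI)
    (auto simp: alt_ops_def b_0 b_simps e_simps mv_distrib)

lemma alt_ops_trivial_spectrum: "trivial_spectrum_mod (alt_ops b) {0} UNIV"
  unfolding trivial_spectrum_mod_def
proof (intro ballI impI)
  fix M X assume "M \<in> alt_ops b" "M *v X - X \<in> {0}"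
  then have "e (b X X) = 0" by (auto simp: alt_ops_def) metis
  then show "X \<in> {0}" using b_nz by blast
qed

text \<open>The vanishing clause serves the dimension count, where the operator must also kill
  vectors chosen before.\<close>

lemma alt_ops_transitive:
  assumes X: "X \<noteq> 0" and Y: "e (b X Y) = 0"
  shows "\<exists>M\<in>alt_ops b. M *v X = Y \<and> (\<forall>Z. b Z X = 0 \<and> b Z Y = 0 \<longrightarrow> M *v Z = 0)"
proof -
  \<comment> \<open>Normalized so that \<open>b X G = 1\<close>.\<close>
  define G where "G = X \<star> inverse (b X X)"
  define z where "z = b X Y"
  have bG: "b Z G = b Z X * inverse (b X X)" for Z by (simp add: G_def b_simps)
  have z: "\<sigma> z = - z" using e_eq_0[OF Y] by (simp add: z_def)
  \<comment> \<open>Under \<open>b Z\<close> the first two terms are exchanged by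
    \<open>\<sigma>\<close>, so their \<open>e\<close>-values cancel. The third removes the unwanted
    multiple of \<open>G\<close> at \<open>X\<close>, because \<open>z\<close> is skew.\<close>
  obtain M where M: "\<And>Z. M *v Z = Y \<star> \<sigma> (b Z G) - G \<star> \<sigma> (b Z Y) - G \<star> (z * \<sigma> (b Z G))"
    using right_linear_matrix[of "\<lambda>Z. Y \<star> \<sigma> (b Z G) - G \<star> \<sigma> (b Z Y) - G \<star> (z * \<sigma> (b Z G))"]
    by (auto simp: b_simps sigma_add sigma_mult rscale_add_right distrib_left mult.assoc)
  have "M *v X = Y"
    unfolding M bG z_def[symmetric] z using b_nz[OF X] by simp
  moreover have "e (b Z (M *v Z)) = 0" for Z
  proof -
    have "b Z (M *v Z) = b Z Y * \<sigma> (b Z G) - b Z G * \<sigma> (b Z Y) - b Z G * z * \<sigma> (b Z G)"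
      unfolding M by (simp add: b_simps b_diff mult.assoc)
    moreover have "e (b Z Y * \<sigma> (b Z G)) = e (b Z G * \<sigma> (b Z Y))"
      using e_sigma[of "b Z Y * \<sigma> (b Z G)"] by (simp add: sigma_mult del: e_sigma)
    ultimately show ?thesis using Y by (simp add: e_simps e_conj(2) z_def)
  qed
  moreover have "M *v Z = 0" if "b Z X = 0" "b Z Y = 0" for Z
    unfolding M bG using that by simp
  ultimately show ?thesis unfolding alt_ops_def by blast
qed

text \<open>Vectors are moved into \<open>A\<close> one at a time. The operators that kill
  \<open>A\<close> still move a vector \<open>X\<close> of the right orthogonal of \<open>A\<close>
  to all of a hyperplane there, and those that also kill \<open>X\<close> form the next
  stage.\<close>

lemma alt_ops_dim_aux:
  "vs.dim {Y. \<forall>Z\<in>A. b Z Y = 0} = k * d \<Longrightarrow>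
    opt_dim d k \<le> ms.dim {M \<in> alt_ops b. \<forall>Z\<in>A. M *v Z = 0}"
proof (induction k arbitrary: A)
  case (Suc k)
  let ?E = "{Y. \<forall>Z\<in>A. b Z Y = 0}" and ?V = "{M \<in> alt_ops b. \<forall>Z\<in>A. M *v Z = 0}"
  have E: "right_subspace ?E" unfolding right_subspace_iff by (auto simp: b_0 b_simps)
  have "\<exists>X\<in>?E. X \<noteq> 0"
  proof (rule ccontr)
    assume "\<not> ?thesis"
    then have "?E \<subseteq> {0}" by blast
    then have "vs.dim ?E = 0" by simp
    then show False using Suc.prems d_pos by simp
  qed
  then obtain X where X: "X \<in> ?E" "X \<noteq> 0" by blast
  let ?E' = "{Y. \<forall>Z\<in>insert X A. b Z Y = 0}"
  have E': "right_subspace ?E'" unfolding right_subspace_iff by (auto simp: b_0 b_simps)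
  have XE': "X \<notin> ?E'" using b_nz[OF X(2)] by auto
  have "?E' = {Z \<in> ?E. b X Z = 0}" by auto
  then have "?E = radjoin ?E' X"
    using X b_nz[OF X(2)] radjoin_kernel[OF E X(1), of "b X"] by (simp add: b_diff b_simps)
  then have "vs.dim ?E' = k * d" using dim_radjoin[OF E' XE'] Suc.prems by simp
  from Suc.IH[OF this] have IH: "opt_dim d k \<le> ms.dim (stab ?V X)"
    by (simp add: conj_ac)
  let ?H = "{Y \<in> ?E. e (b X Y) = 0}"
  have "?H \<subseteq> (\<lambda>M. M *v X) ` ?V"
  proof
    fix Y assume Y: "Y \<in> ?H"
    then obtain M where "M \<in> alt_ops b" "M *v X = Y" "\<forall>Z. b Z X = 0 \<and> b Z Y = 0 \<longrightarrow> M *v Z = 0"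
      using alt_ops_transitive[OF X(2), of Y] by auto
    then show "Y \<in> (\<lambda>M. M *v X) ` ?V" using X Y by (auto intro!: image_eqI[where x = M])
  qed
  then have "vs.dim ?H \<le> vs.dim ((\<lambda>M. M *v X) ` ?V)" by (rule vs.dim_subset)
  moreover have "vs.dim ?E \<le> vs.dim ?H + 1"
    by (rule dim_kernel_ge[OF subspace_right[OF E]]) (simp_all add: b_simps e_simps)
  moreover have "ms.subspace ?V"
    using subspace_matrices_into[OF subspace_alt_ops right_subspace_0, of A] by simp
  ultimately show ?case using eval_rank_nullity[of ?V X] IH Suc.prems by simp
qed simp

lemma alt_ops_dim:
  "vs.dim (UNIV :: ('a^'n) set) = k * d \<Longrightarrow> opt_dim d k \<le> ms.dim (alt_ops b)"
  using alt_ops_dim_aux[of "{}" k] by simp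

text \<open>An invariant subspace that contains \<open>X \<noteq> 0\<close> contains the hyperplane
  where \<open>e (b X _)\<close> vanishes, and also \<open>X\<close>, which lies outside it.\<close>

lemma alt_ops_irreducible: "irreducible_on (alt_ops b) UNIV"
  unfolding irreducible_on_def
proof (intro allI impI)
  fix W assume "right_subspace W \<and> W \<subseteq> UNIV \<and> acts_on (alt_ops b) W"
  then have W: "right_subspace W" "acts_on (alt_ops b) W" by auto
  have "W = UNIV" if X: "X \<in> W" "X \<noteq> 0" for X
  proof (intro equalityI subsetI UNIV_I)
    fix Y
    let ?a = "\<iota> (e (b X Y) / e (b X X))"
    have "e (b X (Y - X \<star> ?a)) = 0"
      using b_nz[OF X(2)] by (simp add: b_diff b_simps e_simps)
    then obtain M where "M \<in> alt_ops b" "M *v X = Y - X \<star> ?a"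
      using alt_ops_transitive[OF X(2)] by blast
    then have "Y - X \<star> ?a \<in> W" using W(2) X(1) unfolding acts_on_def by metis
    then show "Y \<in> W" using right_subspaceD(2,3)[OF W(1)] X(1) by (metis diff_add_cancel)
  qed
  then show "W = {0} \<or> W = UNIV" using right_subspaceD(1)[OF W(1)] by blast
qed

lemma matrix_of_form:
  "\<exists>P. \<forall>X Y. b X Y = herm X (P *v Y)"
proof (intro exI allI)
  fix X Y
  have bs1: "b (\<Sum>i\<in>A. g i) Z = (\<Sum>i\<in>A. b (g i) Z)" for A Z and g :: "'n \<Rightarrow> 'a^'n"
    by (induction A rule: infinite_finite_induct) (simp_all add: b_0 b_simps)
  have bs2: "b Z (\<Sum>i\<in>A. g i) = (\<Sum>i\<in>A. b Z (g i))" for A Z and g :: "'n \<Rightarrow> 'a^'n"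
    by (induction A rule: infinite_finite_induct) (simp_all add: b_0 b_simps)
  have row: "b Z Y = (\<Sum>j\<in>UNIV. b Z (axis j 1) * Y $ j)" for Z
    by (subst vec_eq_sum_axis[of Y]) (simp add: bs2 b_simps)
  have "b X Y = (\<Sum>i\<in>UNIV. \<sigma> (X $ i) * b (axis i 1) Y)"
    by (subst vec_eq_sum_axis[of X]) (simp add: bs1 b_simps)
  then show "b X Y = herm X ((\<chi> i j. b (axis i 1) (axis j 1)) *v Y)"
    by (simp add: herm_def matrix_vector_mult_def row[symmetric])
qed

end

section \<open>Translation between forms and matrices\<close>

lemma sesq_matrix: "sesquilinear_on UNIV (\<lambda>X Y. herm X (P *v Y))"
  by (simp add: sesquilinear_on_def herm_simps mv_distrib)

lemma nonisotropic_matrix_iff: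
  "nonisotropic_on UNIV (\<lambda>X Y. herm X (P *v Y)) \<longleftrightarrow> e_nonisotropic \<sigma> e P"
  by (simp add: nonisotropic_on_def e_nonisotropic_def herm_def)

lemma matrix_inv_mult:
  assumes "invertible P"
  shows "P ** matrix_inv P = mat 1" "matrix_inv P ** P = mat 1"
  using someI_ex[OF assms[unfolded invertible_def]] by (simp_all add: matrix_inv_def)

text \<open>\<open>M\<close> is alternating for the form of \<open>P\<close> precisely when
  \<open>P ** M\<close> satisfies the criterion of \<open>SH_iff\<close>.\<close>

lemma alt_ops_eq_SH:
  assumes P: "invertible P"
  shows "alt_ops (\<lambda>X Y. herm X (P *v Y)) = (\<lambda>M. matrix_inv P ** M) ` SH \<sigma> e"
proof -
  have A: "M \<in> alt_ops (\<lambda>X Y. herm X (P *v Y)) \<longleftrightarrow> P ** M \<in> SH \<sigma> e" for M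
    by (simp add: alt_ops_def SH_iff matrix_vector_mul_assoc)
  have inv: "matrix_inv P ** (P ** M) = M" "P ** (matrix_inv P ** M) = M" for M
    by (simp_all add: matrix_mul_assoc matrix_inv_mult[OF P])
  show ?thesis
  proof (intro equalityI subsetI)
    fix M assume "M \<in> alt_ops (\<lambda>X Y. herm X (P *v Y))"
    then have "matrix_inv P ** (P ** M) \<in> (\<lambda>M. matrix_inv P ** M) ` SH \<sigma> e"
      unfolding A by (rule imageI)
    then show "M \<in> (\<lambda>M. matrix_inv P ** M) ` SH \<sigma> e" by (simp only: inv)
  qed (auto simp: A inv)
qed

text \<open>Injectivity gives surjectivity through the finite F-dimension, and the inverse map,
  being right linear, is again a matrix.\<close>

lemma invertible_if_injective:
  fixes A :: "'a^'n^'n"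
  assumes inj: "\<And>X. A *v X = 0 \<Longrightarrow> X = 0"
  shows "invertible A"
proof -
  have surj: "range ((*v) A) = UNIV"
    by (rule vs.linear_injective_on_imp_surjective[OF linear_mult_vec]) (use inj in auto)
  have "\<forall>Y. \<exists>X. Y = A *v X" using surjD[OF surj] by blast
  then obtain g where g: "\<And>Y. A *v g Y = Y" by metis
  have eq: "X = Y" if "A *v X = A *v Y" for X Y
    using inj[of "X - Y"] that by (simp add: mv_diff_distrib)
  have "\<exists>B. \<forall>X. B *v X = g X"
    by (rule right_linear_matrix; rule eq) (simp_all add: mv_distrib g)
  then obtain B where B: "\<And>X. B *v X = g X" by blast
  have "B *v (A *v X) = X" for X by (rule eq) (simp only: B g)
  then have "A ** B = mat 1" "B ** A = mat 1"
    by (simp_all add: matrix_eq matrix_vector_mul_assoc[symmetric] B g)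
  then show ?thesis unfolding invertible_def by blast
qed

lemma trivial_spectrum_iff:
  "trivial_spectrum_subspace \<iota> S \<longleftrightarrow> ms.subspace S \<and> trivial_spectrum_mod S {0} (UNIV :: ('a^'n) set)"
proof -
  have "invertible (mat 1 - M) \<longleftrightarrow> (\<forall>X. M *v X - X = 0 \<longrightarrow> X = 0)" for M :: "'a^'n^'n"
  proof
    assume "invertible (mat 1 - M)"
    then obtain B where B: "B ** (mat 1 - M) = mat 1" by (auto simp: invertible_def)
    show "\<forall>X. M *v X - X = 0 \<longrightarrow> X = 0"
    proof (intro allI impI)
      fix X assume "M *v X - X = 0"
      then have "(mat 1 - M) *v X = 0" by (simp add: mv_diff_distrib)
      then have "(B ** (mat 1 - M)) *v X = 0" by (simp add: matrix_vector_mul_assoc[symmetric])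
      then show "X = 0" by (simp add: B)
    qed
  next
    assume "\<forall>X. M *v X - X = 0 \<longrightarrow> X = 0"
    then show "invertible (mat 1 - M)"
      by (intro invertible_if_injective) (simp add: mv_diff_distrib)
  qed
  then show ?thesis by (auto simp: trivial_spectrum_subspace_def trivial_spectrum_mod_def)
qed

lemma irreducible_set_iff: "irreducible_set S \<longleftrightarrow> irreducible_on S (UNIV :: ('a^'n) set)"
  by (auto simp: irreducible_set_def irreducible_on_def acts_on_def)

text \<open>Triangular matrices with diagonal entries in a hyperplane that avoids 1.\<close>

lemma triangular_example:
  fixes I :: "'n set"
  assumes "finite I"
  shows "\<exists>V. ms.subspace V \<and> trivial_spectrum_mod V {0} UNIV \<and>
      (\<forall>M\<in>V. \<forall>X. \<forall>i. i \<notin> I \<longrightarrow> (M *v X) $ i = 0) \<and> (\<forall>M\<in>V. \<forall>i. i \<notin> I \<longrightarrow> M *v axis i 1 = 0) \<and>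
      opt_dim d (card I) \<le> ms.dim V \<and> vs.dim {X :: 'a^'n. \<forall>i. i \<notin> I \<longrightarrow> X $ i = 0} = card I * d"
  using assms
proof (induction I)
  case empty
  have "{X :: 'a^'n. \<forall>i. i \<notin> {} \<longrightarrow> X $ i = 0} = {0}" by (auto simp: vec_eq_iff)
  then show ?case by (intro exI[of _ "{0}"]) (simp add: trivial_spectrum_mod_def)
next
  case (insert j I)
  let ?E = "{X :: 'a^'n. \<forall>i. i \<notin> I \<longrightarrow> X $ i = 0}"
    and ?F = "{X :: 'a^'n. \<forall>i. i \<notin> insert j I \<longrightarrow> X $ i = 0}"
  obtain V where V: "ms.subspace V" "trivial_spectrum_mod V {0} UNIV"
    and rows: "\<And>M X i. M \<in> V \<Longrightarrow> i \<notin> I \<Longrightarrow> (M *v X) $ i = 0"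
    and cols: "\<And>M i. M \<in> V \<Longrightarrow> i \<notin> I \<Longrightarrow> M *v axis i 1 = 0"
    and dV: "opt_dim d (card I) \<le> ms.dim V" and dE: "vs.dim ?E = card I * d"
    using insert.IH by blast
  \<comment> \<open>The form \<open>e (q * y)\<close> of \<open>y\<close> does not vanish at 1, so
    its kernel is a hyperplane of D that misses 1.\<close>
  obtain q where q: "e q \<noteq> 0" using e_nonzero by blast
  have E: "right_subspace ?E" and F: "right_subspace ?F" unfolding right_subspace_iff by auto
  have jE: "axis j 1 \<notin> ?E" using insert.hyps by (auto simp: axis_def)
  have "?F = radjoin ?E (axis j 1)"
  proof
    show "radjoin ?E (axis j 1) \<subseteq> ?F"
      by (rule radjoin_subset[OF F]) (auto simp: axis_def)
    show "?F \<subseteq> radjoin ?E (axis j 1)"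
    proof
      fix X assume X: "X \<in> ?F"
      have "X - axis j 1 \<star> (X $ j) \<in> ?E" using X by (auto simp: axis_def)
      from radjoinI[OF this, of "axis j 1" "X $ j"] show "X \<in> radjoin ?E (axis j 1)" by simp
    qed
  qed
  then have dF: "vs.dim ?F = card (insert j I) * d"
    using dim_radjoin[OF E jE] dE insert.hyps by simp
  let ?H = "{Y \<in> ?F. e (q * Y $ j) = 0}"
  \<comment> \<open>Adds to \<open>V\<close> a column at \<open>j\<close>, supported on
    \<open>insert j I\<close>, whose diagonal entry lies in that hyperplane.\<close>
  define U where "U = {M. \<exists>A\<in>V. \<exists>Y\<in>?H. \<forall>X. M *v X = A *v X + Y \<star> (X $ j)}"
  have UI: "M \<in> U" if "A \<in> V" "Y \<in> ?H" "\<And>X. M *v X = A *v X + Y \<star> (X $ j)" for M A Y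
    using that unfolding U_def by blast
  have H: "vs.subspace ?H"
    by (rule vs.subspaceI) (auto simp: vscale_eq e_simps distrib_left mult.assoc[symmetric])
  have "ms.subspace U"
  proof (rule ms.subspaceI)
    show "0 \<in> U" by (rule UI[of 0 0]) (use ms.subspace_0[OF V(1)] in \<open>auto simp: e_simps\<close>)
  next
    fix M M' assume "M \<in> U" "M' \<in> U"
    then obtain A Y A' Y' where
      "A \<in> V" "Y \<in> ?H" "\<And>X. M *v X = A *v X + Y \<star> (X $ j)"
      "A' \<in> V" "Y' \<in> ?H" "\<And>X. M' *v X = A' *v X + Y' \<star> (X $ j)"
      unfolding U_def by blast
    then show "M + M' \<in> U"
      by (intro UI[of "A + A'" "Y + Y'"] ms.subspace_add[OF V(1)] vs.subspace_add[OF H])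
        (simp_all add: mv_distrib)
  next
    fix c M assume "M \<in> U"
    then obtain A Y where "A \<in> V" "Y \<in> ?H" "\<And>X. M *v X = A *v X + Y \<star> (X $ j)"
      unfolding U_def by blast
    moreover have "Y \<star> \<iota> c \<in> ?H" using vs.subspace_scale[OF H \<open>Y \<in> ?H\<close>, of c] by (simp add: vscale_eq)
    ultimately show "fscale_mat \<iota> c M \<in> U"
      by (intro UI[of "fscale_mat \<iota> c A" "Y \<star> \<iota> c"] ms.subspace_scale[OF V(1)])
        (simp_all add: iota_central)
  qed
  moreover have "trivial_spectrum_mod U {0} UNIV"
    unfolding trivial_spectrum_mod_def
  proof (intro ballI impI)
    fix M X assume "M \<in> U" and fix0: "M *v X - X \<in> {0}"
    then obtain A Y where A: "A \<in> V" "Y \<in> ?H" and M: "\<And>X. M *v X = A *v X + Y \<star> (X $ j)"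
      unfolding U_def by blast
    have "X $ j = (A *v X + Y \<star> (X $ j)) $ j" using fix0 M by simp
    then have "X $ j = Y $ j * X $ j" using rows[OF A(1) insert.hyps(2)] by simp
    moreover have "Y $ j \<noteq> 1" using A(2) q by auto
    ultimately have "X $ j = 0" by (metis mult_cancel_right1)
    then have "A *v X - X \<in> {0}" using fix0 M by simp
    then show "X \<in> {0}" using V(2) A(1) by (simp add: trivial_spectrum_mod_def)
  qed
  moreover have "(M *v X) $ i = 0" if "M \<in> U" "i \<notin> insert j I" for M X i
    using that rows unfolding U_def by auto
  moreover have "M *v axis i 1 = 0" if "M \<in> U" "i \<notin> insert j I" for M i
  proof -
    have "axis i 1 $ j = (0 :: 'a)" using that by (auto simp: axis_def)
    then show ?thesis using that cols unfolding U_def by auto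
  qed
  moreover have "opt_dim d (card (insert j I)) \<le> ms.dim U"
  proof -
    have "V \<subseteq> {M \<in> U. M *v axis j 1 = 0}"
      using cols insert.hyps by (auto intro: UI[of _ 0] simp: e_simps)
    then have "ms.dim V \<le> ms.dim {M \<in> U. M *v axis j 1 = 0}" by (rule ms.dim_subset)
    moreover have "?H \<subseteq> (\<lambda>M. M *v axis j 1) ` U"
    proof
      fix Y assume Y: "Y \<in> ?H"
      obtain M where M: "\<And>X. M *v X = Y \<star> (X $ j)"
        using right_linear_matrix[of "\<lambda>X. Y \<star> (X $ j)"] by (auto simp: rscale_add_right)
      have "M \<in> U" by (rule UI[OF ms.subspace_0[OF V(1)] Y]) (simp add: M)
      moreover have "M *v axis j 1 = Y" by (simp add: M)
      ultimately show "Y \<in> (\<lambda>M. M *v axis j 1) ` U" by blast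
    qed
    then have "vs.dim ?H \<le> vs.dim ((\<lambda>M. M *v axis j 1) ` U)" by (rule vs.dim_subset)
    moreover have "vs.dim ?F \<le> vs.dim ?H + 1"
      by (rule dim_kernel_ge[OF subspace_right[OF F]])
        (simp_all add: e_simps distrib_left mult.assoc[symmetric])
    ultimately show ?thesis
      using eval_rank_nullity[OF \<open>ms.subspace U\<close>, of "axis j 1"] dV dF insert.hyps by simp
  qed
  ultimately show ?case using dF by blast
qed

text \<open>\<open>exists_opt_dim\<close> bounds the optimal dimension from below by an example free
  of nonisotropic matrices, which may fail to exist.\<close>

lemma dim_UNIV_vec: "vs.dim (UNIV :: ('a^'n) set) = CARD('n) * d"
  and exists_opt_dim: "\<exists>V. trivial_spectrum_subspace \<iota> V \<and> opt_dim d CARD('n) \<le> ms.dim V"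
  using triangular_example[of UNIV] by (auto simp: trivial_spectrum_iff)

lemma acts_on_UNIV: "acts_on V UNIV" by (simp add: acts_on_def)

lemma dim_annihilating: "ms.dim {M \<in> V. \<forall>X. M *v X = 0} = 0"
proof -
  have "{M \<in> V. \<forall>X. M *v X = 0} \<subseteq> {0 :: 'a^'n^'n}" by (auto simp: matrix_eq)
  then show ?thesis by simp
qed

theorem irreducible_optimal_iff:
  fixes T :: "'f set" and S :: "('a^'n^'n) set"
  assumes T: "finite T" "CARD('n) * d \<le> card T"
  shows "optimal \<iota> S \<and> irreducible_set S \<longleftrightarrow>
    (\<exists>P. invertible P \<and> e_nonisotropic \<sigma> e P \<and> S = (\<lambda>M. matrix_inv P ** M) ` SH \<sigma> e)"
proof
  assume S: "optimal \<iota> S \<and> irreducible_set S"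
  then have sub: "ms.subspace S" and ts: "trivial_spectrum_mod S {0} UNIV" and irr: "irreducible_on S UNIV"
    by (auto simp: optimal_def trivial_spectrum_iff irreducible_set_iff)
  have "opt_dim d CARD('n) \<le> ms.dim S"
    using S exists_opt_dim unfolding optimal_def by (meson le_trans)
  then have "opt_dim d CARD('n) + ms.dim (ann S UNIV) \<le> ms.dim S"
    by (simp add: dim_annihilating)
  then obtain b where b: "sesquilinear_on UNIV b" "nonisotropic_on UNIV b" "alternating_on UNIV b S"
    using irreducible_optimal_form_exists[OF sub acts_on_UNIV ts right_subspace_UNIV dim_UNIV_vec _ irr T] by blast
  obtain P where "\<And>X Y. b X Y = herm X (P *v Y)" using matrix_of_form[OF b(1,2)] by blast
  then have bP: "b = (\<lambda>X Y. herm X (P *v Y))" by (intro ext)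
  have nP: "e_nonisotropic \<sigma> e P" using b(2) unfolding bP nonisotropic_matrix_iff .
  have P: "invertible P"
  proof (rule invertible_if_injective)
    fix X assume "P *v X = 0"
    then have "e (b X X) = 0" using sesquilinear_on_0(1)[OF sesq_matrix[of "mat 1"] right_subspace_UNIV]
      by (simp add: bP e_simps)
    then show "X = 0" using nonisotropic_onD(1)[OF b(2)] by blast
  qed
  \<comment> \<open>The larger space has trivial spectrum too, so optimality of \<open>S\<close>
    turns the inclusion into equality.\<close>
  have "S \<subseteq> alt_ops b" using b(3) by (auto simp: alternating_on_def alt_ops_def)
  moreover have "trivial_spectrum_subspace \<iota> (alt_ops b)"
    unfolding trivial_spectrum_iff
    using subspace_alt_ops[OF b(1,2)] alt_ops_trivial_spectrum[OF b(1,2)] by blast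
  then have "ms.dim (alt_ops b) \<le> ms.dim S" using S by (simp add: optimal_def)
  ultimately have "S = alt_ops b"
    by (intro ms.subspace_dim_equal[OF sub subspace_alt_ops[OF b(1,2)]])
  then show "\<exists>P. invertible P \<and> e_nonisotropic \<sigma> e P \<and> S = (\<lambda>M. matrix_inv P ** M) ` SH \<sigma> e"
    using P nP alt_ops_eq_SH[OF P] unfolding bP by blast
next
  assume "\<exists>P. invertible P \<and> e_nonisotropic \<sigma> e P \<and> S = (\<lambda>M. matrix_inv P ** M) ` SH \<sigma> e"
  then obtain P where P: "invertible P" "e_nonisotropic \<sigma> e P" and SP: "S = (\<lambda>M. matrix_inv P ** M) ` SH \<sigma> e"
    by blast
  let ?b = "\<lambda>X Y. herm X (P *v Y)"
  have S: "S = alt_ops ?b" using SP alt_ops_eq_SH[OF P(1)] by simp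
  have b: "sesquilinear_on UNIV ?b" "nonisotropic_on UNIV ?b"
    using sesq_matrix nonisotropic_matrix_iff P(2) by blast+
  have "trivial_spectrum_subspace \<iota> S"
    unfolding trivial_spectrum_iff S
    using subspace_alt_ops[OF b(1,2)] alt_ops_trivial_spectrum[OF b] by blast
  moreover have "ms.dim V \<le> ms.dim S" if V: "trivial_spectrum_subspace \<iota> V" for V :: "('a^'n^'n) set"
  proof -
    have "ms.dim V \<le> opt_dim d CARD('n) + ms.dim {M \<in> V. \<forall>X\<in>UNIV. M *v X \<in> {0}}"
      using V T by (intro trivial_spectrum_dim_le[OF right_subspace_0 right_subspace_UNIV])
        (auto simp: trivial_spectrum_iff dim_UNIV_vec[simplified] acts_on_def)
    also have "\<dots> \<le> ms.dim S"
      using alt_ops_dim[OF b dim_UNIV_vec] by (simp add: S dim_annihilating)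
    finally show ?thesis .
  qed
  ultimately show "optimal \<iota> S \<and> irreducible_set S"
    using alt_ops_irreducible[OF b] by (simp add: optimal_def irreducible_set_iff S)
qed

theorem similar_iff_homo_star_congruent:
  fixes P1 P2 :: "'a^'n^'n"
  assumes P1: "invertible P1" "e_nonisotropic \<sigma> e P1" and P2: "invertible P2" "e_nonisotropic \<sigma> e P2"
  shows "similar_sets ((\<lambda>M. matrix_inv P1 ** M) ` SH \<sigma> e) ((\<lambda>M. matrix_inv P2 ** M) ` SH \<sigma> e)
    \<longleftrightarrow> homo_star_congruent \<iota> \<sigma> P1 P2"
proof -
  let ?A = "\<lambda>P. alt_ops (\<lambda>X Y. herm X (P *v Y))"
  have A: "M \<in> ?A P \<longleftrightarrow> (\<forall>X. e (herm X (P *v (M *v X))) = 0)" for M P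
    by (simp add: alt_ops_def)
  have scale: "herm X (fscale_mat \<iota> c P *v Y) = herm X (P *v Y) * \<iota> c" for X Y c P
    by (simp add: herm_simps)
  show ?thesis
    unfolding alt_ops_eq_SH[OF P1(1), symmetric] alt_ops_eq_SH[OF P2(1), symmetric]
  proof
    assume "similar_sets (?A P1) (?A P2)"
    then obtain Q where Q: "invertible Q" and eq: "?A P2 = (\<lambda>M. Q ** M ** matrix_inv Q) ` ?A P1"
      by (auto simp: similar_sets_def)
    define R where "R = matrix_inv Q"
    have QR: "Q ** R = mat 1" "R ** Q = mat 1" using matrix_inv_mult[OF Q] by (simp_all add: R_def)
    have RQv: "R *v (Q *v X) = X" "Q *v (R *v X) = X" for X
      by (simp_all add: matrix_vector_mul_assoc QR)
    \<comment> \<open>The form of \<open>P1\<close> transported along \<open>R\<close>; the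
      conjugated operators are alternating for it.\<close>
    define P where "P = star \<sigma> R ** P1 ** R"
    have hermP: "herm X (P *v Y) = herm (R *v X) (P1 *v (R *v Y))" for X Y
      by (simp add: P_def herm_star[of "R *v X"] herm_star star_mult star_star matrix_vector_mul_assoc[symmetric])
    have sub: "e (herm X (P *v (M *v X))) = 0" if "M \<in> ?A P2" for M X
    proof -
      obtain N where N: "N \<in> ?A P1" "M = Q ** N ** R" using \<open>M \<in> ?A P2\<close> unfolding eq R_def by blast
      have "R *v (M *v X) = N *v (R *v X)" by (simp add: N(2) matrix_vector_mul_assoc[symmetric] RQv)
      then show ?thesis using N(1) unfolding hermP A by simp
    qed
    let ?b = "\<lambda>X Y. herm X (P2 *v Y)"
    have b: "sesquilinear_on UNIV ?b" "nonisotropic_on UNIV ?b"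
      using sesq_matrix nonisotropic_matrix_iff P2(2) by blast+
    \<comment> \<open>Each kernel of \<open>e (?b X _)\<close> with \<open>X \<noteq> 0\<close> is
      an orbit of the second space, on which the form of \<open>P\<close> vanishes as well.\<close>
    have "\<exists>l. \<forall>X\<in>UNIV. \<forall>Y\<in>UNIV. e (herm X (P *v Y)) = l * e (?b X Y)"
    proof (rule vs.proportional_bilinear_forms)
      show "e (herm X (P *v Y)) = 0" if XY: "e (?b X Y) = 0" for X Y
      proof (cases "X = 0")
        case True
        then show ?thesis using sesquilinear_on_0(2)[OF sesq_matrix right_subspace_UNIV] by (simp add: e_simps)
      next
        case False
        then obtain M where "M \<in> ?A P2" "M *v X = Y"
          using alt_ops_transitive[OF b False XY] by blast
        then show ?thesis using sub by blast
      qed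
      show "\<exists>X\<in>UNIV. e (?b X Y) \<noteq> 0" if "Y \<noteq> 0" for Y using nonisotropic_onD(1)[OF b(2)] that by blast
    qed (simp_all add: vs.bilinear_on_def herm_simps e_simps vscale_eq mv_distrib)
    then obtain l where l: "\<And>X Y. e (herm X (P *v Y)) = l * e (herm X (P2 *v Y))" by blast
    have Pl: "P = fscale_mat \<iota> l P2" by (rule matrix_eqI_herm) (simp only: scale l e_scale)
    have "l \<noteq> 0"
    proof
      assume "l = 0"
      let ?Y = "axis undefined 1 :: 'a^'n"
      have "e (herm ?Y (P1 *v ?Y)) = e (herm (Q *v ?Y) (P *v (Q *v ?Y)))" by (simp add: hermP RQv)
      then have "e (herm ?Y (P1 *v ?Y)) = 0" using l \<open>l = 0\<close> by simp
      moreover have "?Y \<noteq> 0" by (simp add: axis_eq_0_iff)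
      ultimately show False
        using P1(2) nonisotropic_onD(1)[of UNIV "\<lambda>X Y. herm X (P1 *v Y)" ?Y] by (simp add: nonisotropic_matrix_iff)
    qed
    have "P2 = fscale_mat \<iota> (inverse l) P"
      using \<open>l \<noteq> 0\<close> by (simp add: Pl matrix_eq)
    moreover have "invertible (star \<sigma> R)"
      unfolding invertible_def using QR by (metis star_mult star_mat_1)
    moreover have "P = star \<sigma> R ** P1 ** star \<sigma> (star \<sigma> R)" by (simp add: P_def star_star)
    ultimately show "homo_star_congruent \<iota> \<sigma> P1 P2"
      using \<open>l \<noteq> 0\<close> unfolding homo_star_congruent_def by (metis inverse_nonzero_iff_nonzero)
  next
    assume "homo_star_congruent \<iota> \<sigma> P1 P2"
    then obtain c P where c: "c \<noteq> 0" and P: "invertible P" and P2: "P2 = fscale_mat \<iota> c (P ** P1 ** star \<sigma> P)"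
      by (auto simp: homo_star_congruent_def)
    let ?R = "star \<sigma> P"
    \<comment> \<open>Congruence of the forms by \<open>P\<close> becomes conjugation of the
      operators by \<open>Q\<close>, whose inverse is \<open>star \<sigma> P\<close>.\<close>
    define Q where "Q = star \<sigma> (matrix_inv P)"
    have QR: "Q ** ?R = mat 1" "?R ** Q = mat 1"
      using matrix_inv_mult[OF P] by (simp_all add: Q_def star_mult[symmetric] star_mat_1)
    have RQv: "?R *v (Q *v X) = X" "Q *v (?R *v X) = X" for X
      by (simp_all add: matrix_vector_mul_assoc QR)
    have Q: "invertible Q" using QR by (auto simp: invertible_def)
    have "matrix_inv Q = matrix_inv Q ** (Q ** ?R)" by (simp add: QR)
    then have inv: "matrix_inv Q = ?R" by (simp add: matrix_mul_assoc matrix_inv_mult[OF Q])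
    have hermP2: "herm X (P2 *v Y) = herm (?R *v X) (P1 *v (?R *v Y)) * \<iota> c" for X Y
      unfolding P2 scale by (simp add: matrix_vector_mul_assoc[symmetric] herm_star[of _ P])
    have eq: "M \<in> ?A P2 \<longleftrightarrow> ?R ** M ** Q \<in> ?A P1" for M
      using c unfolding A by (simp add: hermP2 matrix_vector_mul_assoc[symmetric]) (metis RQv)
    have "Q ** (?R ** M ** Q) ** ?R = M" "?R ** (Q ** M ** ?R) ** Q = M" for M
      by (simp_all add: matrix_eq matrix_vector_mul_assoc[symmetric] RQv)
    then have "?A P2 = (\<lambda>M. Q ** M ** ?R) ` ?A P1"
      unfolding set_eq_iff image_iff using eq by metis
    then show "similar_sets (?A P1) (?A P2)"
      unfolding similar_sets_def using Q inv by metis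
  qed
qed

end

theorem corollary1p15:
  fixes \<iota> :: "'f::field \<Rightarrow> 'a::division_ring"
    and \<sigma> :: "'a \<Rightarrow> 'a" and e :: "'a \<Rightarrow> 'f" and d :: nat
  assumes "central_embedding \<iota>"
    and "has_degree \<iota> d"
    and "quadratic_type \<iota>"
    and "associated_pair \<iota> \<sigma> e"
    and "finite (UNIV :: 'f set) \<Longrightarrow> CARD('n::finite) * d \<le> CARD('f)"
  shows "{S :: ('a^'n^'n) set. optimal \<iota> S \<and> irreducible_set S} =
           {(\<lambda>M. matrix_inv P ** M) ` SH \<sigma> e |
              P :: 'a^'n^'n. invertible P \<and> e_nonisotropic \<sigma> e P} \<and>
         (\<forall>P1 P2 :: 'a^'n^'n.
           invertible P1 \<and> e_nonisotropic \<sigma> e P1 \<and> invertible P2 \<and> e_nonisotropic \<sigma> e P2 \<longrightarrow>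
           (similar_sets ((\<lambda>M. matrix_inv P1 ** M) ` SH \<sigma> e)
                         ((\<lambda>M. matrix_inv P2 ** M) ` SH \<sigma> e)
            \<longleftrightarrow> homo_star_congruent \<iota> \<sigma> P1 P2))"
proof -
  obtain Bd where Bd: "finite_dimensional_vector_space (fscale \<iota>) Bd" "card Bd = d"
    using assms(2) by (auto simp: has_degree_def)
  interpret C: central_algebra \<iota> d Bd by (rule central_algebra.intro) (use assms(1) Bd in auto)
  obtain Bv :: "('a^'n) set" where Bv: "finite_dimensional_vector_space (vscale \<iota>) Bv"
    using finite_dimensional_vscale(1)[OF Bd(1)] by blast
  obtain Bm :: "('a^'n^'n) set" where Bm: "finite_dimensional_vector_space (fscale_mat \<iota>) Bm"
    using finite_dimensional_vscale(2)[OF Bd(1)] by blast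
  have "standard_pair \<iota> \<sigma> e" by (rule C.standard_pair_if_associated_pair[OF assms(3,4)])
  then interpret quadratic_algebra \<iota> d Bd Bv Bm \<sigma> e
    by (intro quadratic_algebra.intro division_algebra.intro division_algebra_axioms.intro
        C.central_algebra_axioms Bv Bm)
  obtain T :: "'f set" where T: "finite T" "CARD('n) * d \<le> card T"
  proof (cases "finite (UNIV :: 'f set)")
    case True
    then show ?thesis using that[of UNIV] assms(5) by simp
  next
    case False
    then obtain T :: "'f set" where "finite T" "card T = CARD('n) * d"
      using infinite_arbitrarily_large by blast
    then show ?thesis using that by simp
  qed
  show ?thesis
  proof (intro conjI allI impI)
    show "{S :: ('a^'n^'n) set. optimal \<iota> S \<and> irreducible_set S} =
        {(\<lambda>M. matrix_inv P ** M) ` SH \<sigma> e |P. invertible P \<and> e_nonisotropic \<sigma> e P}"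
      unfolding irreducible_optimal_iff[OF T] by auto
  qed (simp add: similar_iff_homo_star_congruent)
qed

end
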